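(* Let $Y=\{y_j\}_{j=1}^N$ be i.i.d. samples from the density $p$ on $\mathcal{M}$, let $\hat\rho$ be the kNN-estimated bandwidth function computed from $Y$ with parameter $k=k_N$, and let $\bar\rho=p^{-1/d}$. Suppose that as $N\to\infty$, $k=o(N)$ and $k=\Omega(\log N)$. Then, when $N$ is sufficiently large, with probability higher than $1-N^{-10}$, $$\sup_{x\in\mathcal{M}}\frac{|\hat\rho(x)-\bar\rho(x)|}{\bar\rho(x)}\ \le\ O^{[p]}\!\left(\left(\frac{k}{N}\right)^{2/d}\right)+\frac{3\sqrt{13}}{d}\sqrt{\frac{\log N}{k}},$$ and the right-hand side is $o^{[p]}(1)$ as $N\to\infty$.
   Context: $\mathcal{M}$ is a $d$-dimensional $C^\infty$ compact manifold without boundary, isometrically embedded in $\mathbb{R}^D$ (points of $\mathcal M$ are identified with their images in $\mathbb{R}^D$; $\|\cdot\|$ is the Euclidean norm of $\mathbb{R}^D$), with Riemannian volume measure $dV$. $p\in C^\infty(\mathcal{M})$ is a probability density with respect to $dV$ with $0<p_{min}\le p(x)\le p_{max}<\infty$ for all $x\in\mathcal{M}$. kNN bandwidth: with $m_0=\int_{\mathbb{R}^d}\mathbf{1}_{[0,1)}(|u|^2)\,du$ (the volume of the unit ball in $\mathbb{R}^d$), $$\hat R(x):=\inf\Big\{r>0:\ \sum_{j=1}^{N}\mathbf{1}_{\{\|y_j-x\|<r\}}\ge k\Big\},\qquad \hat\rho(x):=\hat R(x)\left(\frac{1}{m_0}\frac{k}{N}\right)^{-1/d}.$$ Asymptotic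 notation: $f=O(g)$ means $|f|\le C|g|$ in the limit; $f=o(g)$ means $|f|/g\to0$; $f=\Omega(g)$ (for $f,g>0$) means $f/g\to\infty$. A superscript $^{[p]}$ indicates that the constant may depend on $p$; dependence on $\mathcal{M}$ (including $d$) is always allowed. *)

theory Defs
  imports "HOL-Probability.Probability" "HOL-Library.Landau_Symbols"
begin

section \<open>Smooth submanifolds of Euclidean space\<close>

text \<open>Meaningful for open \<open>S\<close> in a finite-dimensional space, where differentiability together with
  $C^n$ regularity of all directional derivatives is $C^{n+1}$ regularity.\<close>

fun Ck_on :: "nat \<Rightarrow> 'a::real_normed_vector set \<Rightarrow> ('a \<Rightarrow> 'b::real_normed_vector) \<Rightarrow> bool" where
  "Ck_on 0 S f \<longleftrightarrow> continuous_on S f"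
| "Ck_on (Suc n) S f \<longleftrightarrow>
     (\<forall>x\<in>S. f differentiable (at x)) \<and> (\<forall>v. Ck_on n S (\<lambda>x. frechet_derivative f (at x) v))"

definition smooth_on :: "'a::real_normed_vector set \<Rightarrow> ('a \<Rightarrow> 'b::real_normed_vector) \<Rightarrow> bool" where
  "smooth_on S f \<longleftrightarrow> (\<forall>n. Ck_on n S f)"

definition local_parametrization ::
  "(real^'n) set \<Rightarrow> (real^'d) set \<Rightarrow> (real^'d \<Rightarrow> real^'n) \<Rightarrow> bool" where
  "local_parametrization M U \<phi> \<longleftrightarrow>
     open U \<and> smooth_on U \<phi> \<and>
     (\<forall>u\<in>U. inj (frechet_derivative \<phi> (at u))) \<and>
     (\<exists>\<psi>. homeomorphism U (\<phi> ` U) \<phi> \<psi>) \<and>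
     openin (top_of_set M) (\<phi> ` U)"

text \<open>The dimension \<open>d\<close> is \<open>CARD('d)\<close>, passed as a type argument. Parametrizations have
  open domains in $\mathbb{R}^d$, so there is no boundary.\<close>

definition smooth_submanifold :: "'d::finite itself \<Rightarrow> (real^'n) set \<Rightarrow> bool" where
  "smooth_submanifold _ M \<longleftrightarrow>
     (\<forall>x\<in>M. \<exists>(U :: (real^'d) set) \<phi>. local_parametrization M U \<phi> \<and> x \<in> \<phi> ` U)"

definition smooth_on_submanifold ::
  "'d::finite itself \<Rightarrow> (real^'n) set \<Rightarrow> (real^'n \<Rightarrow> real) \<Rightarrow> bool" where
  "smooth_on_submanifold _ M f \<longleftrightarrow>
     (\<forall>(U :: (real^'d) set) \<phi>. local_parametrization M U \<phi> \<longrightarrow> smooth_on U (f \<circ> \<phi>))"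

text \<open>Coordinate matrix of the metric induced from the ambient inner product:
  $g_{ij}(u) = \langle \partial_i \phi(u), \partial_j \phi(u) \rangle$.\<close>

definition metric_matrix :: "(real^'d \<Rightarrow> real^'n) \<Rightarrow> real^'d \<Rightarrow> real^'d^'d" where
  "metric_matrix \<phi> u =
     (\<chi> i j. frechet_derivative \<phi> (at u) (axis i 1) \<bullet> frechet_derivative \<phi> (at u) (axis j 1))"

text \<open>\<open>V\<close> is the measure on the Borel sets of \<open>M\<close> given in every coordinate system by
  $\sqrt{\det g}\,du$. As countably many coordinate patches cover \<open>M\<close>, this determines \<open>V\<close>.\<close>

definition riemannian_volume ::
  "'d::finite itself \<Rightarrow> (real^'n) set \<Rightarrow> (real^'n) measure \<Rightarrow> bool" where
  "riemannian_volume _ M V \<longleftrightarrow>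
     space V = M \<and> sets V = sets (restrict_space borel M) \<and>
     (\<forall>(U :: (real^'d) set) \<phi>. local_parametrization M U \<phi> \<longrightarrow>
        (\<forall>A\<in>sets borel. A \<subseteq> U \<longrightarrow>
           emeasure V (\<phi> ` A) =
             (\<integral>\<^sup>+u\<in>A. ennreal (sqrt (det (metric_matrix \<phi> u))) \<partial>lborel)))"

section \<open>The kNN bandwidth\<close>

text \<open>A sample of size \<open>N\<close> is a function \<open>y\<close>, of which only the values on \<open>{1..N}\<close> matter.
  For \<open>k > N\<close> the set below is empty and its real infimum carries no meaning.\<close>

definition knn_radius :: "nat \<Rightarrow> nat \<Rightarrow> (nat \<Rightarrow> real^'n) \<Rightarrow> real^'n \<Rightarrow> real" where
  "knn_radius N k y x = Inf {r. r > 0 \<and> (\<Sum>j=1..N. of_bool (norm (y j - x) < r)) \<ge> k}"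

definition unit_ball_volume :: "'d::finite itself \<Rightarrow> real" where
  "unit_ball_volume _ = (\<integral>u. indicator {0..<1} ((norm u)\<^sup>2) \<partial>(lborel :: (real^'d) measure))"

definition knn_bandwidth ::
  "'d::finite itself \<Rightarrow> nat \<Rightarrow> nat \<Rightarrow> (nat \<Rightarrow> real^'n) \<Rightarrow> real^'n \<Rightarrow> real" where
  "knn_bandwidth T N k y x =
     knn_radius N k y x *
       (1 / unit_ball_volume T * (real k / real N)) powr (- 1 / real CARD('d))"

definition population_bandwidth ::
  "'d::finite itself \<Rightarrow> (real^'n \<Rightarrow> real) \<Rightarrow> real^'n \<Rightarrow> real" where
  "population_bandwidth _ p x = p x powr (- 1 / real CARD('d))"

text \<open>The joint law of \<open>N\<close> independent points with density \<open>p\<close> with respect to \<open>V\<close>.\<close>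

definition iid_samples ::
  "(real^'n) measure \<Rightarrow> (real^'n \<Rightarrow> real) \<Rightarrow> nat \<Rightarrow> (nat \<Rightarrow> real^'n) measure" where
  "iid_samples V p N = (\<Pi>\<^sub>M j\<in>{1..N}. density V (\<lambda>x. ennreal (p x)))"

end

theory Submission
  imports Defs
begin

text \<open>In a chart around $x$, the distance $\|\phi(u + r z) - \phi(u)\| / r$ is the norm
  $n(z) = \|d\phi_u z\|$, plus $r$ times an odd term, plus $O(r^2)$. Odd terms do not change volumes
  to first order, and neither does the first variation of the density, so the ball of radius $r$ about $x$
  has mass $m_0\, p(x)\, r^d (1 + O(r^2))$ uniformly in $x$.

  With $r = (k/N)^{1/d}$, an $r^3$-net has only $O((N/k)^3)$ points, a power that does not
  depend on $d$. At a net point the numbers of samples in the balls of radii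
  $m_0^{-1/d} \bar\rho\, r\, (1 \pm \tau)$ obey Chernoff bounds, which is enough room for a union bound.
  The kNN radius is 1-Lipschitz in $x$, so passing from the net to all of $M$ costs $r^3$, which is
  $O(r^2) = O((k/N)^{2/d})$ relative to the radius.\<close>

section \<open>Volumes of ellipsoids\<close>

text \<open>The indicator of a ball does not depend smoothly on the distance function, so the parity
  argument cannot be run on volumes directly. Volumes of homogeneous bodies are therefore expressed
  through the squared ramp \<open>(max 0 (1 - N z))\<^sup>2\<close>, which has a second-order Taylor
  bound in \<open>N z\<close>. A second obstacle is that the correction in the expansion of the
  distance is \<open>n z * c z\<close>, of degree two, so its sublevel sets are not dilates of each
  other; near \<open>n z = 1\<close> it can be traded for \<open>c z\<close>, of degree one, at cost
  O(r^2). The origin of the constants: a relative deviation of 10 sqrt(log N / k) in ball mass makes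
  each Chernoff bound at most N^-20. Bernoulli's inequality converts mass into radius and produces
  the factor 1/d. Since 3 sqrt 13 > 10.8, there is a surplus of 0.8, which absorbs the cross term
  between the random fluctuation and the O(r^2) error of the mass. A net of at most O(N^3) points
  leaves a failure probability O(N^-17), below N^-10 for large N.\<close>

text \<open>The transformation rule for volumes under linear maps is only available for well-ordered
  index types.\<close>

typedef (overloaded) ('a::finite) ordered_copy = "{..<CARD('a)}"
  by (rule exI[of _ 0]) auto

instance ordered_copy :: (finite) finite
proof
  show "finite (UNIV :: 'a ordered_copy set)"
    unfolding type_definition.univ[OF type_definition_ordered_copy] by auto
qed

instantiation ordered_copy :: (finite) wellorder
begin

definition "x \<le> y \<longleftrightarrow> Rep_ordered_copy x \<le> Rep_ordered_copy y"

definition "x < y \<longleftrightarrow> Rep_ordered_copy x < Rep_ordered_copy y"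

instance
proof
  fix P :: "'a ordered_copy \<Rightarrow> bool" and a
  assume step: "\<And>x. (\<And>y. y < x \<Longrightarrow> P y) \<Longrightarrow> P x"
  show "P a"
  proof (induction a rule: measure_induct_rule[of Rep_ordered_copy])
    case (less x)
    show ?case by (rule step) (use less in \<open>simp add: less_ordered_copy_def\<close>)
  qed
qed (auto simp: less_eq_ordered_copy_def less_ordered_copy_def Rep_ordered_copy_inject)

end

lemma card_ordered_copy: "CARD('a ordered_copy) = CARD('a::finite)"
  using type_definition.card[OF type_definition_ordered_copy] by simp

text \<open>Conjugating permutations with \<open>h\<close> preserves signs and matches the two
  Leibniz sums term by term.\<close>

lemma det_reindex:
  fixes A :: "real^'a^'a" and h :: "'b::finite \<Rightarrow> 'a::finite"
  assumes "bij h"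
  shows "det (\<chi> i j. A $ h i $ h j) = det A"
proof -
  let ?S = "UNIV :: 'b set"
  have b: "bij_betw h UNIV UNIV" and inj: "inj_on h UNIV" using assms bij_is_inj by auto
  have "bij_betw (map_permutation ?S h) {p. p permutes ?S} {p. p permutes (h ` ?S)}"
  proof (rule bij_betw_byWitness[where f'="\<lambda>q. inv h \<circ> q \<circ> h"])
    show "\<forall>p\<in>{p. p permutes ?S}. inv h \<circ> map_permutation ?S h p \<circ> h = p"
      by (auto simp: fun_eq_iff map_permutation_apply[OF inj] inv_f_f[OF inj])
    have "map_permutation ?S h (inv h \<circ> q \<circ> h) = q" for q
      using assms by (auto simp: map_permutation_def fun_eq_iff restrict_id_def bij_is_surj surj_f_inv_f)
    then show "\<forall>q\<in>{p. p permutes h ` ?S}. map_permutation ?S h (inv h \<circ> q \<circ> h) = q" by blast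
    show "map_permutation ?S h ` {p. p permutes ?S} \<subseteq> {p. p permutes h ` ?S}"
      using map_permutation_permutes[of h ?S "h ` ?S"] inj by (auto simp: bij_betw_def)
    have "bij (inv h \<circ> q \<circ> h)" if "q permutes (UNIV :: 'a set)" for q
      using that assms by (intro bij_comp bij_imp_bij_inv) (auto simp: permutes_bij)
    then show "(\<lambda>q. inv h \<circ> q \<circ> h) ` {p. p permutes h ` ?S} \<subseteq> {p. p permutes ?S}"
      using assms by (auto simp: bij_is_surj intro!: bij_imp_permutes)
  qed
  then have bij: "bij_betw (map_permutation ?S h) {p. p permutes ?S} {p. p permutes (UNIV :: 'a set)}"
    using assms by (simp add: bij_is_surj)
  have "det A = (\<Sum>p | p permutes ?S. of_int (sign (map_permutation ?S h p)) *
      prod (\<lambda>i. A $ i $ map_permutation ?S h p i) UNIV)"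
    unfolding det_def
    using sum.reindex_bij_betw[OF bij, of "\<lambda>p. of_int (sign p) * prod (\<lambda>i. A $ i $ p i) UNIV"] by simp
  also have "\<dots> = (\<Sum>p | p permutes ?S. of_int (sign p) * prod (\<lambda>i. A $ h i $ h (p i)) UNIV)"
  proof (rule sum.cong[OF refl])
    fix p assume "p \<in> {p. p permutes ?S}"
    then have "sign (map_permutation ?S h p) = sign p"
      by (intro sign_map_permutation) (auto simp: inj)
    moreover have "prod (\<lambda>i. A $ i $ map_permutation ?S h p i) UNIV = prod (\<lambda>i. A $ h i $ h (p i)) UNIV"
      using prod.reindex_bij_betw[OF b, of "\<lambda>i. A $ i $ map_permutation ?S h p i"]
      by (simp add: map_permutation_apply[OF inj])
    ultimately show "of_int (sign (map_permutation ?S h p)) *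
      prod (\<lambda>i. A $ i $ map_permutation ?S h p i) UNIV = of_int (sign p) * prod (\<lambda>i. A $ h i $ h (p i)) UNIV" by simp
  qed
  finally show ?thesis by (simp add: det_def)
qed

lemma prod_Basis_vec: "(\<Prod>b\<in>Basis. f b) = (\<Prod>i\<in>UNIV. f (axis i 1))" for f :: "real^'a \<Rightarrow> real"
proof -
  have "bij_betw (\<lambda>i. axis i 1) UNIV (Basis :: (real^'a) set)"
    by (auto simp: bij_betw_def inj_on_def axis_eq_axis Basis_vec_def)
  from prod.reindex_bij_betw[OF this, of f] show ?thesis by simp
qed

text \<open>Lebesgue measure is determined by boxes, and the preimage of a box under a relabelling
  of coordinates is a box with the same side lengths in another order.\<close>

lemma lborel_distr_reindex:
  fixes h :: "'b::finite \<Rightarrow> 'a::finite"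
  assumes "bij h"
  shows "distr lborel borel (\<lambda>x :: real^'a. (\<chi> i. x $ h i) :: real^'b) = lborel"
proof (rule lborel_eqI[symmetric])
  let ?P = "\<lambda>x :: real^'a. (\<chi> i. x $ h i) :: real^'b"
  have [measurable]: "?P \<in> borel \<rightarrow>\<^sub>M borel"
    by (intro borel_measurable_continuous_onI linear_continuous_on linear_conv_bounded_linear[THEN iffD1] linearI)
      (auto simp: vec_eq_iff)
  fix l u :: "real^'b" assume le: "\<And>b. b \<in> Basis \<Longrightarrow> l \<bullet> b \<le> u \<bullet> b"
  have le': "l $ i \<le> u $ i" for i
    using le[of "axis i 1"] by (simp add: inner_axis)
  let ?l = "(\<chi> i. l $ inv h i) :: real^'a" and ?u = "(\<chi> i. u $ inv h i) :: real^'a"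
  have "?P -` box l u = box ?l ?u"
  proof -
    have "(\<forall>i. R i (h i)) \<longleftrightarrow> (\<forall>j. R (inv h j) j)" for R
    proof (intro iffI allI)
      fix j assume "\<forall>i. R i (h i)"
      then have "R (inv h j) (h (inv h j))" by blast
      then show "R (inv h j) j" by (simp add: surj_f_inv_f[OF bij_is_surj[OF assms]])
    next
      fix i assume "\<forall>j. R (inv h j) j"
      then have "R (inv h (h i)) (h i)" by blast
      then show "R i (h i)" by (simp add: inv_f_f[OF bij_is_inj[OF assms]])
    qed
    from this[of "\<lambda>i j. l $ i < x $ j \<and> x $ j < u $ i" for x]
    have "x \<in> ?P -` box l u \<longleftrightarrow> x \<in> box ?l ?u" for x
      unfolding mem_box_cart vimage_eq vec_lambda_beta .
    then show ?thesis by blast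
  qed
  then have "emeasure (distr lborel borel ?P) (box l u) = emeasure lborel (box ?l ?u)"
    by (simp add: emeasure_distr)
  also have "\<dots> = ennreal (\<Prod>b\<in>Basis. (?u - ?l) \<bullet> b)"
  proof (rule emeasure_lborel_box)
    fix b :: "real^'a" assume "b \<in> Basis"
    then obtain i where "b = axis i 1" by (auto simp: Basis_vec_def)
    then show "?l \<bullet> b \<le> ?u \<bullet> b" using le'[of "inv h i"] by (simp add: inner_axis)
  qed
  also have "(\<Prod>b\<in>Basis. (?u - ?l) \<bullet> b) = (\<Prod>i\<in>UNIV. (u - l) $ inv h i)"
    by (simp add: prod_Basis_vec inner_axis)
  also have "\<dots> = (\<Prod>i\<in>UNIV. (u - l) $ i)"
    using assms by (intro prod.reindex_bij_betw) (simp add: bij_imp_bij_inv)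
  also have "\<dots> = (\<Prod>b\<in>Basis. (u - l) \<bullet> b)"
    by (simp add: prod_Basis_vec inner_axis)
  finally show "emeasure (distr lborel borel ?P) (box l u) = (\<Prod>b\<in>Basis. (u - l) \<bullet> b)" .
qed simp

lemma unit_ball_volume_eq: "unit_ball_volume TYPE('d::finite) = measure lborel (ball (0 :: real^'d) 1)"
proof -
  have "indicator {0..<1} ((norm u)\<^sup>2) = (indicator (ball 0 1) u :: real)" for u :: "real^'d"
    by (auto simp: indicator_def abs_square_less_1)
  then show ?thesis unfolding unit_ball_volume_def by simp
qed

lemma unit_ball_volume_pos: "unit_ball_volume TYPE('d::finite) > 0"
  unfolding unit_ball_volume_eq by (rule content_ball_pos) simp

text \<open>A linear isometry on the range of \<open>A\<close> turns \<open>A\<close> into a square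
  map \<open>B\<close> with the same Gram matrix up to relabelling, so the Gram determinant is the
  square of \<open>det (matrix B)\<close>. As \<open>B\<close> maps the ellipsoid onto the unit
  ball, the change-of-variables factor is the square root of the Gram determinant.\<close>

lemma ellipsoid_volume:
  fixes A :: "real^'d::finite \<Rightarrow> real^'n"
  assumes A: "linear A" and inj: "inj A"
  shows "measure lborel {w. norm (A w) < 1} * sqrt (det (\<chi> i j. A (axis i 1) \<bullet> A (axis j 1)))
    = unit_ball_volume TYPE('d)"
proof -
  obtain h :: "'d ordered_copy \<Rightarrow> 'd" where h: "bij h"
    using finite_same_card_bij[of "UNIV :: 'd ordered_copy set" "UNIV :: 'd set"]
    by (auto simp: card_ordered_copy)
  define P where "P x = ((\<chi> i. x $ h i) :: real^'d ordered_copy)" for x :: "real^'d"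
  define Q where "Q x = ((\<chi> i. x $ inv h i) :: real^'d)" for x :: "real^'d ordered_copy"
  have PQ: "P (Q x) = x" "Q (P y) = y" for x y
    using h by (auto simp: P_def Q_def vec_eq_iff bij_is_inj bij_is_surj surj_f_inv_f)
  have linQ: "linear Q" unfolding Q_def by (auto intro!: linearI simp: vec_eq_iff)
  have injQ: "inj Q" by (rule inj_on_inverseI[of _ P]) (rule PQ)
  have dim: "dim (range A) = CARD('d)"
    using dim_image_eq[OF A, of UNIV] inj by simp
  obtain f :: "real^'n \<Rightarrow> real^'d ordered_copy" where f: "linear f"
      "\<And>x. x \<in> range A \<Longrightarrow> norm (f x) = norm x"
    by (rule isometries_subspaces[of "range A" "UNIV :: (real^'d ordered_copy) set"])
      (use A dim in \<open>auto intro: linear_subspace_image simp: card_ordered_copy\<close>)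
  define B where "B x = f (A (Q x))" for x
  have linB: "linear B" using linear_compose[OF linear_compose[OF linQ A] f(1)]
    by (simp add: B_def[abs_def] o_def)
  have normB: "norm (B x) = norm (A (Q x))" for x by (simp add: B_def f)
  \<comment> \<open>Polarisation: \<open>f\<close> is only known to preserve norms on the range of
    \<open>A\<close>, and this already fixes the inner products.\<close>
  have innerB: "B x \<bullet> B y = A (Q x) \<bullet> A (Q y)" for x y
    using normB[of "x + y"] normB[of x] normB[of y]
    by (simp add: dot_norm linear_add[OF linB] linear_add[OF linQ] linear_add[OF A])
  have injB: "inj B"
    unfolding linear_injective_0[OF linB]
  proof (intro allI impI)
    fix x assume "B x = 0"
    then have "A (Q x) = 0" using normB[of x] by simp
    then have "Q x = 0" using inj linear_injective_0[OF A] by blast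
    then show "x = 0" using injQ linear_injective_0[OF linQ] by blast
  qed
  have surjB: "surj B" using linear_injective_imp_surjective[OF linB injB] by simp
  have Qaxis: "Q (axis i 1) = axis (h i) 1" for i
  proof -
    have "inv h j = i \<longleftrightarrow> j = h i" for j
      using bij_inv_eq_iff[OF h, of i j] by auto
    then show ?thesis by (simp add: Q_def axis_def vec_eq_iff)
  qed
  have "matrix B = (\<chi> i j. B (axis j 1) $ i)" by (simp add: matrix_def)
  then have "transpose (matrix B) ** matrix B = (\<chi> i j. B (axis i 1) \<bullet> B (axis j 1))"
    by (simp add: vec_eq_iff matrix_matrix_mult_def transpose_def inner_vec_def)
  also have "\<dots> = (\<chi> i j. (\<chi> i j. A (axis i 1) \<bullet> A (axis j 1)) $ h i $ h j)"
    by (simp add: innerB Qaxis vec_eq_iff)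
  finally have "det (transpose (matrix B) ** matrix B) = det (\<chi> i j. A (axis i 1) \<bullet> A (axis j 1))"
    by (simp only: det_reindex[OF h])
  then have "det (\<chi> i j. A (axis i 1) \<bullet> A (axis j 1)) = (det (matrix B))\<^sup>2"
    by (simp add: det_mul power2_eq_square)
  then have det: "sqrt (det (\<chi> i j. A (axis i 1) \<bullet> A (axis j 1))) = \<bar>det (matrix B)\<bar>"
    by simp
  have contB: "continuous_on UNIV B"
    using linB by (simp add: linear_continuous_on linear_conv_bounded_linear)
  let ?E = "{x. norm (B x) < 1}"
  have E: "?E \<in> sets borel"
    using contB by (intro borel_open open_Collect_less continuous_intros) auto
  have [measurable]: "P \<in> borel \<rightarrow>\<^sub>M borel"
    unfolding P_def by (intro borel_measurable_continuous_onI linear_continuous_on linear_conv_bounded_linear[THEN iffD1] linearI)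
      (auto simp: vec_eq_iff)
  have "measure lborel {w. norm (A w) < 1} = measure (distr lborel borel P) ?E"
    using E by (subst measure_distr) (auto intro!: arg_cong[of _ _ "measure lborel"] simp: normB PQ)
  then have m: "measure lborel {w. norm (A w) < 1} = measure lborel ?E"
    using lborel_distr_reindex[OF h] by (simp add: P_def[abs_def])
  \<comment> \<open>The lower bound from injectivity makes the ellipsoid bounded, hence of finite
    measure.\<close>
  obtain e where e: "e > 0" "\<And>x. norm (B x) \<ge> e * norm x"
    using linear_inj_bounded_below_pos[OF linB injB] by (metis mult.commute)
  have "?E \<subseteq> ball 0 (1/e)"
  proof
    fix x assume "x \<in> ?E"
    then have "e * norm x < 1" using e(2)[of x] by simp
    then show "x \<in> ball 0 (1/e)" using e(1) by (simp add: field_simps)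
  qed
  then have "?E \<in> lmeasurable"
    using E bounded_subset[OF bounded_ball] by (intro bounded_set_imp_lmeasurable) auto
  moreover have "B ` ?E = ball 0 1"
  proof (intro equalityI subsetI)
    fix y :: "real^'d ordered_copy" assume "y \<in> ball 0 1"
    moreover obtain x where "y = B x" using surjB by (rule surjE)
    ultimately show "y \<in> B ` ?E" by simp
  qed auto
  ultimately have "measure lebesgue (ball 0 1 :: (real^'d ordered_copy) set) = \<bar>det (matrix B)\<bar> * measure lebesgue ?E"
    using measure_linear_image[OF linB, of ?E] by simp
  moreover have "measure lebesgue ?E = measure lborel ?E" using E by (simp add: measure_completion)
  moreover have "measure lebesgue (ball 0 1 :: (real^'d ordered_copy) set) = measure lborel (ball (0::real^'d) 1)"
    by (simp add: content_ball card_ordered_copy)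
  ultimately show ?thesis by (simp add: unit_ball_volume_eq det m)
qed

section \<open>Volumes of perturbed gauges\<close>

lemma measure_homogeneous_sublevel:
  fixes N :: "'a::euclidean_space \<Rightarrow> real"
  assumes [measurable]: "N \<in> borel_measurable borel"
    and hom: "\<And>t z. t > 0 \<Longrightarrow> N (t *\<^sub>R z) = t * N z" and t: "t > 0"
  shows "emeasure lborel {z. N z < t} = ennreal (t ^ DIM('a)) * emeasure lborel {z. N z < 1}"
proof -
  have *: "{z. N z < t} = (\<lambda>z. t *\<^sub>R z + 0) ` {z. N z < 1}"
  proof (intro equalityI subsetI)
    fix z assume "z \<in> {z. N z < t}"
    then have "z = t *\<^sub>R ((1/t) *\<^sub>R z) + 0 \<and> N ((1/t) *\<^sub>R z) < 1"
      using t by (simp add: hom del: scaleR_left.minus)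
    then show "z \<in> (\<lambda>z. t *\<^sub>R z + 0) ` {z. N z < 1}" by blast
  next
    fix z assume "z \<in> (\<lambda>z. t *\<^sub>R z + 0) ` {z. N z < 1}"
    then obtain y where y: "z = t *\<^sub>R y" "N y < 1" by auto
    then show "z \<in> {z. N z < t}" using t by (simp add: hom)
  qed
  have "emeasure lborel {z. N z < t} = emeasure lebesgue ((\<lambda>z. t *\<^sub>R z + 0) ` {z. N z < 1})"
    unfolding *[symmetric] by (simp add: emeasure_completion)
  also have "\<dots> = ennreal (t ^ DIM('a)) * emeasure lebesgue {z. N z < 1}"
    using t by (subst emeasure_lebesgue_affine) (auto simp: ennreal_power)
  finally show ?thesis by (simp add: emeasure_completion)
qed

text \<open>The integrand is the derivative of \<open>- (1 - t)\<^sup>2\<close>. This is a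
  layer-cake formula: for \<open>s = N z\<close> the condition \<open>s < t\<close> describes a
  strict sublevel set of \<open>N\<close>, whose volume scales with \<open>t\<close>.\<close>

lemma nn_integral_ramp:
  assumes "0 \<le> s"
  shows "(\<integral>\<^sup>+t. ennreal (2 * (1 - t)) * indicator {s<..1} t \<partial>lborel) = ennreal ((max 0 (1 - s))\<^sup>2)"
proof (cases "s \<le> 1")
  case True
  have "(\<integral>\<^sup>+t. ennreal (2 * (1 - t)) * indicator {s<..1} t \<partial>lborel)
      = (\<integral>\<^sup>+t. ennreal (2 * (1 - t)) * indicator {s..1} t \<partial>lborel)"
    by (intro nn_integral_cong_AE) (use AE_lborel_singleton[of s] in eventually_elim, auto simp: indicator_def)
  also have "\<dots> = ennreal (- (1 - 1)\<^sup>2 - (- (1 - s)\<^sup>2))"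
    by (rule nn_integral_FTC_Icc) (use True in \<open>auto intro!: derivative_eq_intros\<close>)
  finally show ?thesis using True by (simp add: max_def)
qed (simp add: max_def)

text \<open>The Beta integral with value \<open>2 / ((d + 1) * (d + 2))\<close>. It will be divided
  out, for which it has to be finite and positive.\<close>

definition ramp_moment :: "nat \<Rightarrow> ennreal" where
  "ramp_moment d = (\<integral>\<^sup>+t. ennreal (2 * (1 - t)) * indicator {0<..1} t * ennreal (t ^ d) \<partial>lborel)"

lemma ramp_moment_finite: "ramp_moment d < \<infinity>"
proof -
  have "ramp_moment d \<le> (\<integral>\<^sup>+t. ennreal 2 * indicator {0..1} t \<partial>(lborel :: real measure))"
    unfolding ramp_moment_def
  proof (rule nn_integral_mono)
    fix t :: real
    have "2 * (1 - t) * t ^ d \<le> 2 * 1" if "0 < t" "t \<le> 1"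
      using that by (intro mult_mono) (auto intro: power_le_one)
    then show "ennreal (2 * (1 - t)) * indicator {0<..1} t * ennreal (t ^ d) \<le> ennreal 2 * indicator {0..1} t"
      by (auto simp: indicator_def ennreal_mult[symmetric] ennreal_le_iff2 simp flip: ennreal_numeral)
  qed
  also have "\<dots> = 2" by (subst nn_integral_cmult_indicator) auto
  finally show ?thesis by (auto simp: less_top[symmetric] top_unique)
qed

lemma ramp_moment_pos: "ramp_moment d > 0"
proof (rule ccontr)
  assume "\<not> ramp_moment d > 0"
  then have "(\<integral>\<^sup>+t. ennreal (2 * (1 - t)) * indicator {0<..1} t * ennreal (t ^ d) \<partial>lborel) = 0"
    by (simp add: ramp_moment_def)
  then have "AE t in lborel. ennreal (2 * (1 - t)) * indicator {0<..1} t * ennreal (t ^ d) = 0"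
    by (subst (asm) nn_integral_0_iff_AE) auto
  then have "AE t in lborel. t \<notin> {0<..<1::real}"
    by eventually_elim (auto simp: indicator_def ennreal_eq_0_iff zero_less_power dest: zero_less_power[of _ d] split: if_splits)
  then have "emeasure lborel {0<..<1::real} = 0"
    by (subst (asm) AE_iff_measurable[of "{0<..<1}"]) auto
  then show False by simp
qed

text \<open>Volume of the unit body of a gauge \<open>N\<close> as an integral in which \<open>N\<close> enters smoothly; this
  replaces polar coordinates when the gauge is perturbed.\<close>

lemma nn_integral_ramp_gauge:
  fixes N :: "'a::euclidean_space \<Rightarrow> real"
  assumes [measurable]: "N \<in> borel_measurable borel"
    and hom: "\<And>t z. t > 0 \<Longrightarrow> N (t *\<^sub>R z) = t * N z" and nonneg: "\<And>z. N z \<ge> 0"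
  shows "(\<integral>\<^sup>+z. ennreal ((max 0 (1 - N z))\<^sup>2) \<partial>lborel) = ramp_moment DIM('a) * emeasure lborel {z. N z < 1}"
proof -
  have "(\<integral>\<^sup>+z. ennreal ((max 0 (1 - N z))\<^sup>2) \<partial>lborel)
      = (\<integral>\<^sup>+z. \<integral>\<^sup>+t. ennreal (2 * (1 - t)) * indicator {0<..1} t * indicator {z. N z < t} z \<partial>lborel \<partial>lborel)"
    by (intro nn_integral_cong, subst nn_integral_ramp[symmetric])
      (auto simp: nonneg indicator_def intro!: nn_integral_cong dest: le_less_trans[OF nonneg])
  also have "\<dots> = (\<integral>\<^sup>+t. \<integral>\<^sup>+z. ennreal (2 * (1 - t)) * indicator {0<..1} t * indicator {z. N z < t} z \<partial>lborel \<partial>lborel)"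
    by (rule lborel_pair.Fubini') measurable
  also have "\<dots> = (\<integral>\<^sup>+t. ennreal (2 * (1 - t)) * indicator {0<..1} t * ennreal (t ^ DIM('a)) * emeasure lborel {z. N z < 1} \<partial>lborel)"
  proof (rule nn_integral_cong)
    fix t :: real
    have "(\<integral>\<^sup>+z. ennreal (2 * (1 - t)) * indicator {0<..1} t * indicator {z. N z < t} z \<partial>lborel)
      = ennreal (2 * (1 - t)) * indicator {0<..1} t * emeasure lborel {z. N z < t}"
      by (subst nn_integral_cmult_indicator) auto
    then show "(\<integral>\<^sup>+z. ennreal (2 * (1 - t)) * indicator {0<..1} t * indicator {z. N z < t} z \<partial>lborel)
      = ennreal (2 * (1 - t)) * indicator {0<..1} t * ennreal (t ^ DIM('a)) * emeasure lborel {z. N z < 1}"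
      using measure_homogeneous_sublevel[OF assms(1) hom, of t]
      by (cases "t > 0") (auto simp: mult.assoc)
  qed
  also have "\<dots> = ramp_moment DIM('a) * emeasure lborel {z. N z < 1}"
    unfolding ramp_moment_def by (subst nn_integral_multc) auto
  finally show ?thesis .
qed

text \<open>By convexity the power lies below its chord over the unit interval, of slope
  \<open>2 ^ d - 1\<close>; the induction carries this sharper slope.\<close>

lemma power_one_plus_le:
  fixes t :: real
  assumes "0 \<le> t" "t \<le> 1"
  shows "(1 + t) ^ d \<le> 1 + 2 ^ d * t"
proof -
  have "(1 + t) ^ d \<le> 1 + (2 ^ d - 1) * t"
  proof (induction d)
    case (Suc d)
    have "(1 + t) ^ Suc d \<le> (1 + t) * (1 + (2 ^ d - 1) * t)"
      using Suc assms by (simp add: mult_left_mono)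
    also have "\<dots> = 1 + 2 ^ d * t + (2 ^ d - 1) * (t * t)" by (simp add: algebra_simps)
    also have "(2 ^ d - 1) * (t * t) \<le> (2 ^ d - 1) * t"
      using assms by (intro mult_left_mono) (auto simp: mult_left_le)
    finally show ?case by (simp add: algebra_simps)
  qed simp
  then show ?thesis using assms by (simp add: algebra_simps)
qed

lemma power_one_minus_ge:
  fixes t :: real
  assumes "0 \<le> t" "t \<le> 1"
  shows "1 - 2 ^ d * t \<le> (1 - t) ^ d"
proof -
  have "1 - real d * t \<le> (1 - t) ^ d"
    using Bernoulli_inequality[of "- t" d] assms by simp
  moreover have "real d * t \<le> 2 ^ d * t"
    using assms of_nat_less_two_power[of d, where 'a=real] by (intro mult_right_mono) auto
  ultimately show ?thesis by linarith
qed

text \<open>The squared ramp has derivative \<open>- 2 * max 0 (1 - s)\<close>, which is Lipschitz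
  with constant 2. Squaring is what removes the kink of the ramp at 1.\<close>

lemma ramp_taylor:
  fixes s t :: real
  shows "\<bar>(max 0 (1 - t))\<^sup>2 - (max 0 (1 - s))\<^sup>2 + 2 * max 0 (1 - s) * (t - s)\<bar> \<le> (t - s)\<^sup>2"
proof -
  consider "s \<le> 1" "t \<le> 1" | "s \<le> 1" "t > 1" | "s > 1" "t \<le> 1" | "s > 1" "t > 1" by linarith
  then show ?thesis
  proof cases
    case 1
    then have "(max 0 (1 - t))\<^sup>2 - (max 0 (1 - s))\<^sup>2 + 2 * max 0 (1 - s) * (t - s) = (t - s)\<^sup>2"
      by (simp add: max_def power2_eq_square algebra_simps)
    then show ?thesis by simp
  next
    case 2
    have "(max 0 (1 - t))\<^sup>2 - (max 0 (1 - s))\<^sup>2 + 2 * max 0 (1 - s) * (t - s) = (t - s)\<^sup>2 - (t - 1)\<^sup>2"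
      using 2 by (simp add: max_def power2_eq_square algebra_simps)
    moreover have "(t - 1)\<^sup>2 \<le> (t - s)\<^sup>2" using 2 by (intro power_mono) auto
    ultimately show ?thesis by simp
  next
    case 3
    have "(max 0 (1 - t))\<^sup>2 - (max 0 (1 - s))\<^sup>2 + 2 * max 0 (1 - s) * (t - s) = (1 - t)\<^sup>2"
      using 3 by (simp add: max_def)
    moreover have "(1 - t)\<^sup>2 \<le> (s - t)\<^sup>2" using 3 by (intro power_mono) auto
    ultimately show ?thesis by (simp add: power2_commute)
  qed (auto simp: max_def)
qed

lemma emeasure_cball_less_top [simp]: "emeasure lborel (cball (c :: 'a::euclidean_space) r) < top"
  using emeasure_bounded_finite[OF bounded_cball] by (simp add: less_top)

lemma integrable_bounded_support:
  fixes f :: "'a::euclidean_space \<Rightarrow> real"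
  assumes [measurable]: "f \<in> borel_measurable borel"
    and "\<And>z. \<bar>f z\<bar> \<le> B" and "\<And>z. norm z > R \<Longrightarrow> f z = 0"
  shows "integrable lborel f"
proof (rule Bochner_Integration.integrable_bound)
  have B: "0 \<le> B" using assms(2)[of 0] by linarith
  show "integrable lborel (\<lambda>z. B * indicator (cball 0 R) z :: real)"
    by (intro integrable_mult_right integrable_real_indicator) auto
  show "AE z in lborel. norm (f z) \<le> norm (B * indicator (cball 0 R) z)"
    using assms(2,3) B by (intro AE_I2) (auto simp: indicator_def not_le)
qed simp

lemma lborel_distr_uminus_euclidean: "distr lborel borel uminus = (lborel :: 'a::euclidean_space measure)"
  using lborel_affine[of "-1" "0::'a"] by (simp add: density_1)

lemma integral_lborel_uminus:
  fixes f :: "'a::euclidean_space \<Rightarrow> real"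
  assumes [measurable]: "f \<in> borel_measurable borel"
  shows "(\<integral>z. f (- z) \<partial>lborel) = (\<integral>z. f z \<partial>lborel)"
proof -
  have "(\<integral>z. f z \<partial>distr lborel borel uminus) = (\<integral>z. f (- z) \<partial>lborel)"
    by (rule integral_distr) auto
  then show ?thesis by (simp add: lborel_distr_uminus_euclidean)
qed

text \<open>Both \<open>n\<close> and \<open>c\<close> are homogeneous of degree one, so the
  sublevel sets of \<open>n + r * c\<close> are dilates of one body for each fixed \<open>r\<close>.
  The constants \<open>a\<close>, \<open>b\<close>, \<open>K\<close> are kept explicit because the
  estimates must be uniform over the centres of the balls.\<close>

locale perturbed_gauge =
  fixes n c :: "'a::euclidean_space \<Rightarrow> real" and a b K :: real
  assumes meas [measurable]: "n \<in> borel_measurable borel" "c \<in> borel_measurable borel"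
    and a: "a > 0" and K: "K \<ge> 0"
    and n_hom: "\<And>t z. t > 0 \<Longrightarrow> n (t *\<^sub>R z) = t * n z" and c_hom: "\<And>t z. t > 0 \<Longrightarrow> c (t *\<^sub>R z) = t * c z"
    and even: "\<And>z. n (- z) = n z" and odd: "\<And>z. c (- z) = - c z"
    and n_ge: "\<And>z. a * norm z \<le> n z" and n_le: "\<And>z. n z \<le> b * norm z"
    and c_le: "\<And>z. \<bar>c z\<bar> \<le> K * norm z"
begin

text \<open>Once \<open>r * K \<le> a / 2\<close>, the perturbed gauge is still at least
  \<open>a / 2 * norm z\<close>, so its unit body lies in the ball of this radius.\<close>

definition R :: real where "R = 2 / a"

definition V :: real where "V = measure lborel (cball (0::'a) R)"

definition gauge where "gauge r z = n z + r * c z"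

definition vol where "vol r = measure lborel {z. gauge r z < 1}"

lemma gauge_meas [measurable]: "gauge r \<in> borel_measurable borel"
  unfolding gauge_def[abs_def] by measurable

lemma gauge_hom: "t > 0 \<Longrightarrow> gauge r (t *\<^sub>R z) = t * gauge r z"
  by (simp add: gauge_def n_hom c_hom algebra_simps)

lemma gauge_ge:
  assumes "0 \<le> r" "r * K \<le> a / 2"
  shows "a / 2 * norm z \<le> gauge r z"
proof -
  have "r * \<bar>c z\<bar> \<le> r * (K * norm z)" using c_le assms by (intro mult_left_mono) auto
  also have "\<dots> \<le> a / 2 * norm z" using assms mult_right_mono[of "r * K" "a/2" "norm z"] by simp
  finally have "\<bar>r * c z\<bar> \<le> a / 2 * norm z" using assms by (simp add: abs_mult)
  then show ?thesis using n_ge[of z] by (simp add: gauge_def abs_le_iff field_simps)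
qed

lemma gauge_nonneg:
  assumes "0 \<le> r" "r * K \<le> a / 2"
  shows "0 \<le> gauge r z"
  using gauge_ge[OF assms, of z] a by (smt (verit) divide_pos_pos mult_nonneg_nonneg norm_ge_zero)

lemma norm_le_R:
  assumes "0 \<le> r" "r * K \<le> a / 2" "gauge r z \<le> 1"
  shows "norm z \<le> R"
  using gauge_ge[OF assms(1,2), of z] assms(3) a by (simp add: R_def field_simps)

lemma gauge_0: "gauge 0 z = n z" by (simp add: gauge_def)

lemma sublevel_fmeasurable:
  assumes "0 \<le> r" "r * K \<le> a / 2"
  shows "{z. gauge r z < 1} \<in> fmeasurable lborel"
proof (rule fmeasurableI2)
  show "cball 0 R \<in> fmeasurable lborel"
    by (auto intro!: fmeasurableI)
  show "{z. gauge r z < 1} \<subseteq> cball 0 R"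
    using norm_le_R[OF assms] by auto
qed simp

lemma vol_le:
  assumes "0 \<le> r" "r * K \<le> a / 2"
  shows "vol r \<le> V"
  unfolding vol_def V_def using norm_le_R[OF assms]
  by (intro measure_mono_fmeasurable) (auto intro!: fmeasurableI)

lemma integral_ramp_gauge:
  assumes "0 \<le> r" "r * K \<le> a / 2"
  shows "(\<integral>z. (max 0 (1 - gauge r z))\<^sup>2 \<partial>lborel) = enn2real (ramp_moment DIM('a)) * vol r"
proof -
  have "(\<integral>z. (max 0 (1 - gauge r z))\<^sup>2 \<partial>lborel) = enn2real (\<integral>\<^sup>+z. ennreal ((max 0 (1 - gauge r z))\<^sup>2) \<partial>lborel)"
    by (rule integral_eq_nn_integral) auto
  also have "\<dots> = enn2real (ramp_moment DIM('a) * emeasure lborel {z. gauge r z < 1})"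
    by (subst nn_integral_ramp_gauge) (auto simp: gauge_hom gauge_nonneg[OF assms])
  finally show ?thesis by (simp add: enn2real_mult vol_def measure_def)
qed

text \<open>In the Taylor expansion of the squared ramp, the term linear in \<open>r\<close> is an
  even function of \<open>z\<close> times the odd \<open>c z\<close>, so its integral vanishes. The
  remainder is at most \<open>(r * c z)\<^sup>2\<close> and supported in the ball of radius
  \<open>R\<close>.\<close>

lemma volume_perturbation:
  assumes r: "0 \<le> r" "r * K \<le> a / 2"
  shows "\<bar>vol r - vol 0\<bar> \<le> (K * R)\<^sup>2 * V / enn2real (ramp_moment DIM('a)) * r\<^sup>2"
proof -
  let ?f = "\<lambda>r z. (max 0 (1 - gauge r z))\<^sup>2" and ?l = "\<lambda>z. 2 * max 0 (1 - n z) * (r * c z)"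
  have zero: "?f s z = 0" if "norm z > R" "0 \<le> s" "s * K \<le> a / 2" for s z
    using norm_le_R[OF that(2,3), of z] that(1) by (auto simp: max_def)
  have f_int: "integrable lborel (?f s)" if "0 \<le> s" "s * K \<le> a / 2" for s
    using zero[OF _ that] gauge_nonneg[OF that]
    by (intro integrable_bounded_support[where B=1 and R=R]) (auto simp: abs_square_le_1 max_def abs_le_iff power_le_one)
  have K0: "0 * K \<le> a / 2" using a by simp
  have l_zero: "?l z = 0" if "norm z > R" for z
    using zero[OF that order_refl K0] by (simp add: gauge_0)
  have l_bd: "\<bar>?l z\<bar> \<le> 2 * (r * (K * R))" for z
  proof (cases "norm z > R")
    case False
    have "\<bar>c z\<bar> \<le> K * R" using c_le[of z] False K by (meson mult_left_mono not_less order_trans)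
    then have "\<bar>r * c z\<bar> \<le> r * (K * R)" using r by (simp add: abs_mult mult_left_mono)
    moreover have "\<bar>max 0 (1 - n z)\<bar> \<le> 1" using gauge_nonneg[OF order_refl K0, of z] by (auto simp: gauge_0 max_def)
    ultimately have "\<bar>max 0 (1 - n z)\<bar> * \<bar>r * c z\<bar> \<le> 1 * (r * (K * R))" by (intro mult_mono) auto
    then show ?thesis by (simp add: abs_mult)
  next
    case True
    have "0 \<le> 2 * (r * (K * R))" using r a K by (simp add: R_def)
    then show ?thesis unfolding l_zero[OF True] by simp
  qed
  have l_int: "integrable lborel ?l"
    by (rule integrable_bounded_support[where R=R, OF _ l_bd l_zero]) auto
  have "(\<integral>z. ?l z \<partial>lborel) = (\<integral>z. ?l (- z) \<partial>lborel)" by (rule integral_lborel_uminus[symmetric]) simp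
  also have "\<dots> = - (\<integral>z. ?l z \<partial>lborel)" by (simp add: even odd)
  finally have l0: "(\<integral>z. ?l z \<partial>lborel) = 0" by simp
  have bound: "\<bar>?f r z - ?f 0 z + ?l z\<bar> \<le> (K * R)\<^sup>2 * r\<^sup>2 * indicator (cball 0 R) z" for z
  proof (cases "norm z > R")
    case True
    then show ?thesis using zero[OF True r] zero[OF True order_refl K0] l_zero[OF True] by simp
  next
    case False
    have "\<bar>c z\<bar> \<le> K * R" using c_le[of z] False K by (meson mult_left_mono not_less order_trans)
    then have "(c z)\<^sup>2 \<le> (K * R)\<^sup>2" by (simp add: abs_le_square_iff[symmetric] a K R_def less_imp_le abs_of_nonneg)
    then have "(r * c z)\<^sup>2 \<le> (K * R)\<^sup>2 * r\<^sup>2" by (simp add: power_mult_distrib mult.commute[of _ "r\<^sup>2"] mult_left_mono)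
    moreover have "\<bar>?f r z - ?f 0 z + ?l z\<bar> \<le> (r * c z)\<^sup>2"
      using ramp_taylor[of "gauge r z" "n z"] by (simp add: gauge_def)
    ultimately show ?thesis using False by simp
  qed
  have "\<bar>(\<integral>z. ?f r z \<partial>lborel) - (\<integral>z. ?f 0 z \<partial>lborel)\<bar> = \<bar>\<integral>z. ?f r z - ?f 0 z + ?l z \<partial>lborel\<bar>"
    using f_int[OF r] f_int[OF order_refl K0] l_int l0 by simp
  also have "\<dots> \<le> (\<integral>z. (K * R)\<^sup>2 * r\<^sup>2 * indicator (cball (0::'a) R) z \<partial>lborel)"
  proof (rule integral_abs_bound_integral)
    show "integrable lborel (\<lambda>z. ?f r z - ?f 0 z + ?l z)"
      using f_int[OF r] f_int[OF order_refl K0] l_int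
      by (intro Bochner_Integration.integrable_add Bochner_Integration.integrable_diff)
    show "integrable lborel (\<lambda>z. (K * R)\<^sup>2 * r\<^sup>2 * indicator (cball (0::'a) R) z :: real)"
      by (intro integrable_mult_right integrable_real_indicator) auto
  qed (rule bound)
  also have "\<dots> = (K * R)\<^sup>2 * V * r\<^sup>2" by (simp add: V_def)
  finally have "enn2real (ramp_moment DIM('a)) * \<bar>vol r - vol 0\<bar> \<le> (K * R)\<^sup>2 * V * r\<^sup>2"
    unfolding integral_ramp_gauge[OF r] integral_ramp_gauge[OF order_refl K0] right_diff_distrib[symmetric] abs_mult
    by simp
  moreover have "enn2real (ramp_moment DIM('a)) > 0"
    using ramp_moment_pos ramp_moment_finite by (simp add: enn2real_positive_iff less_top)
  ultimately show ?thesis by (simp add: field_simps)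
qed

lemma vol_scaled:
  assumes "t > 0"
  shows "measure lborel {z. gauge r z < t} = t ^ DIM('a) * vol r"
  using measure_homogeneous_sublevel[OF gauge_meas[of r] gauge_hom assms] assms
  by (simp add: measure_def vol_def enn2real_mult)

lemma scaled_sublevel_fmeasurable:
  assumes "0 \<le> r" "r * K \<le> a / 2" "t > 0"
  shows "{z. gauge r z < t} \<in> fmeasurable lborel"
  using measure_homogeneous_sublevel[OF gauge_meas[of r] gauge_hom assms(3)] sublevel_fmeasurable[OF assms(1,2)]
  by (intro fmeasurableI) (auto simp: ennreal_mult_less_top fmeasurable_def)

text \<open>By homogeneity both sets are dilates of the unit body, so only powers of
  \<open>1 + t\<close> and \<open>1 - t\<close> have to be compared with 1.\<close>

lemma shell_volume:
  assumes r: "0 \<le> r" "r * K \<le> a / 2" and t: "0 \<le> t" "t < 1"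
  shows "measure lborel {z. gauge r z < 1 + t} \<le> vol r + 2 ^ DIM('a) * t * V"
    and "vol r - 2 ^ DIM('a) * t * V \<le> measure lborel {z. gauge r z < 1 - t}"
proof -
  have v: "vol r \<ge> 0" by (simp add: vol_def)
  have "(1 + t) ^ DIM('a) * vol r \<le> (1 + 2 ^ DIM('a) * t) * vol r"
    using t v by (intro mult_right_mono power_one_plus_le) auto
  moreover have *: "2 ^ DIM('a) * t * vol r \<le> 2 ^ DIM('a) * t * V"
    using t vol_le[OF r] by (intro mult_left_mono) auto
  ultimately show "measure lborel {z. gauge r z < 1 + t} \<le> vol r + 2 ^ DIM('a) * t * V"
    using t by (simp add: vol_scaled algebra_simps)
  have "(1 - 2 ^ DIM('a) * t) * vol r \<le> (1 - t) ^ DIM('a) * vol r"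
    using t v by (intro mult_right_mono power_one_minus_ge) auto
  then show "vol r - 2 ^ DIM('a) * t * V \<le> measure lborel {z. gauge r z < 1 - t}"
    unfolding vol_scaled[of "1 - t", simplified, OF t(2)] using * by (simp add: algebra_simps)
qed

text \<open>\<open>S\<close> is the rescaled ball in a chart, \<open>n\<close> the norm at the centre, \<open>c\<close> the odd correction. As the
  correction and the first variation of \<open>H\<close> are odd, both contribute only at second order.\<close>

lemma integral_over_perturbed_ball:
  fixes \<Phi> H :: "'a \<Rightarrow> real"
  assumes r: "0 < r" "r * K \<le> a / 2" "r \<le> 1"
    and L: "L \<ge> 0" and G: "G = L + b * R * K * R" and D: "D = G + L + K * R" and C': "C' = K * R * D + L"
    and small: "C' * r\<^sup>2 < 1" "D * r < 1"
    and Phi: "\<And>z. norm z \<le> R \<Longrightarrow> \<bar>\<Phi> z - n z - r * (n z * c z)\<bar> \<le> L * r\<^sup>2"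
    and S: "S = {z. norm z \<le> R \<and> \<Phi> z < 1}" "S \<in> sets borel"
    and [measurable]: "H \<in> borel_measurable borel"
    and H0: "\<bar>H0\<bar> \<le> L" and H1: "\<And>z. norm z \<le> R \<Longrightarrow> \<bar>H z - H0\<bar> \<le> L * r"
    and H2: "\<And>z. norm z \<le> R \<Longrightarrow> \<bar>H z + H (- z) - 2 * H0\<bar> \<le> L * r\<^sup>2"
  shows "\<bar>(\<integral>z. indicator S z * H z \<partial>lborel) - H0 * measure lborel {z. n z < 1}\<bar>
    \<le> (L * (2 ^ DIM('a) * C' * V + (K * R)\<^sup>2 * V / enn2real (ramp_moment DIM('a))) +
       (L * V + L * (2 * 2 ^ DIM('a) * D * V))) * r\<^sup>2"
proof -
  have r0: "0 \<le> r" and R0: "R > 0" using r a by (auto simp: R_def)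
  have K0: "0 * K \<le> a / 2" using a by simp
  have S_meas [measurable]: "S \<in> sets borel" by fact
  have r2: "r\<^sup>2 \<le> r" using r by (simp add: power2_eq_square mult_left_le)
  have b: "b \<ge> 0"
  proof -
    obtain e :: 'a where "e \<in> Basis" using nonempty_Basis by blast
    then have "norm e = 1" by simp
    then show ?thesis using n_ge[of e] n_le[of e] a by simp
  qed
  have c_R: "\<bar>c z\<bar> \<le> K * R" if "norm z \<le> R" for z
    using c_le[of z] that K by (meson mult_left_mono order_trans)
  have n_R: "0 \<le> n z" "n z \<le> b * R" if "norm z \<le> R" for z
    using n_le[of z] that b gauge_nonneg[OF order_refl K0, of z]
    by (auto simp: gauge_0 intro: order_trans[OF _ mult_left_mono])
  have G0: "G \<ge> 0" using L b R0 K unfolding G by simp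
  have D0: "D \<ge> 0" and C'0: "C' \<ge> 0" using G0 L K R0 unfolding C' D by auto
  \<comment> \<open>To first order \<open>\<Phi>\<close> is just \<open>n\<close>; the bounds on
    \<open>n\<close> and \<open>c\<close> over the ball of radius \<open>R\<close> give the constant
    \<open>G\<close>.\<close>
  have close: "\<bar>\<Phi> z - n z\<bar> \<le> G * r" if z: "norm z \<le> R" for z
  proof -
    have "\<bar>n z * c z\<bar> \<le> b * R * (K * R)"
      unfolding abs_mult using n_R[OF z] c_R[OF z] b R0 by (intro mult_mono) auto
    then have "\<bar>r * (n z * c z)\<bar> \<le> r * (b * R * (K * R))"
      using r0 by (simp add: abs_mult mult_left_mono)
    moreover have "L * r\<^sup>2 \<le> L * r" using r2 L by (rule mult_left_mono)
    ultimately show ?thesis using Phi[OF z] by (simp add: G algebra_simps)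
  qed
  have cr: "\<bar>r * c z\<bar> \<le> r * (K * R)" if "norm z \<le> R" for z
    using c_R[OF that] r0 by (simp add: abs_mult mult_left_mono)
  \<comment> \<open>Replacing \<open>n z * c z\<close> by \<open>c z\<close> costs
    \<open>r * c z * (n z - 1)\<close>. This is of second order only where \<open>n z\<close> is
    within O(r) of 1, hence the restriction to a shell.\<close>
  have gauge_Phi: "\<bar>\<Phi> z - gauge r z\<bar> \<le> C' * r\<^sup>2" if z: "norm z \<le> R" and "\<bar>n z - 1\<bar> \<le> D * r" for z
  proof -
    have "\<bar>r * c z * (n z - 1)\<bar> \<le> r * (K * R) * (D * r)"
      unfolding abs_mult[of "r * c z"] using that cr[OF z] by (intro mult_mono) auto
    moreover have "\<Phi> z - gauge r z = (\<Phi> z - n z - r * (n z * c z)) + r * c z * (n z - 1)"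
      by (simp add: gauge_def algebra_simps)
    ultimately show ?thesis using Phi[OF z] by (simp add: C' algebra_simps power2_eq_square)
  qed
  have DG: "G * r + r * (K * R) + L * r = D * r" by (simp add: D algebra_simps)
  have Lr: "L * r \<ge> 0" and Gr: "G * r \<ge> 0" and KRr: "r * (K * R) \<ge> 0" using L r0 G0 K R0 by auto
  \<comment> \<open>Outside the shell of half-width \<open>D * r\<close>, the value
    \<open>n z\<close> decides on which side of 1 both \<open>\<Phi> z\<close> and the gauge lie:
    \<open>D\<close> exceeds the first-order errors \<open>G\<close> and \<open>K * R\<close>.
    Inside it the two differ by \<open>C' * r\<^sup>2\<close>.\<close>
  have S_sub: "S \<subseteq> {z. gauge r z < 1 + C' * r\<^sup>2}"
  proof
    fix z assume "z \<in> S"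
    then have z: "norm z \<le> R" "\<Phi> z < 1" by (auto simp: S)
    show "z \<in> {z. gauge r z < 1 + C' * r\<^sup>2}"
    proof (cases "\<bar>n z - 1\<bar> \<le> D * r")
      case True
      then show ?thesis using gauge_Phi[OF z(1)] z by auto
    next
      case False
      then have "n z < 1 - D * r" using close[OF z(1)] z(2) DG Lr KRr by linarith
      then have "gauge r z < 1" using cr[OF z(1)] DG Gr Lr by (simp add: gauge_def)
      moreover have "C' * r\<^sup>2 \<ge> 0" using C'0 by simp
      ultimately show ?thesis by simp
    qed
  qed
  have S_sup: "{z. gauge r z < 1 - C' * r\<^sup>2} \<subseteq> S"
  proof
    fix z assume "z \<in> {z. gauge r z < 1 - C' * r\<^sup>2}"
    then have z: "gauge r z < 1 - C' * r\<^sup>2" by simp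
    have C'r: "C' * r\<^sup>2 \<ge> 0" using C'0 by simp
    then have zR: "norm z \<le> R" using norm_le_R[OF r0 r(2), of z] z by simp
    have "\<Phi> z < 1"
    proof (cases "\<bar>n z - 1\<bar> \<le> D * r")
      case True
      then show ?thesis using gauge_Phi[OF zR] z by auto
    next
      case False
      moreover have "\<not> n z > 1 + D * r"
        using z C'r cr[OF zR] DG Gr Lr by (simp add: gauge_def)
      ultimately have "n z < 1 - D * r" by linarith
      then show ?thesis using close[OF zR] DG Lr KRr by linarith
    qed
    then show "z \<in> S" using zR by (simp add: S)
  qed
  have S_fm: "S \<in> fmeasurable lborel"
    by (rule fmeasurableI2[of "cball 0 R"]) (auto simp: S(1) S(2)[unfolded S(1)] intro!: fmeasurableI)
  have S_vol: "\<bar>measure lborel S - vol r\<bar> \<le> 2 ^ DIM('a) * (C' * r\<^sup>2) * V"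
  proof -
    have "C' * r\<^sup>2 \<ge> 0" using C'0 by simp
    note sh = shell_volume[OF r0 r(2) this small(1)]
    have "measure lborel S \<le> measure lborel {z. gauge r z < 1 + C' * r\<^sup>2}"
      using S_sub \<open>C' * r\<^sup>2 \<ge> 0\<close> by (intro measure_mono_fmeasurable scaled_sublevel_fmeasurable[OF r0 r(2)]) auto
    moreover have "measure lborel {z. gauge r z < 1 - C' * r\<^sup>2} \<le> measure lborel S"
      using S_sup S_fm by (intro measure_mono_fmeasurable) auto
    ultimately show ?thesis using sh by (simp add: abs_le_iff)
  qed
  let ?shell = "{z. n z < 1 + D * r} - {z. n z < 1 - D * r}"
  have D_r: "0 \<le> D * r" using D0 r0 by simp
  have shell_fm: "{z. n z < 1 + D * r} \<in> fmeasurable lborel" "{z. n z < 1 - D * r} \<in> fmeasurable lborel"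
    using scaled_sublevel_fmeasurable[OF order_refl K0] D_r small(2) by (auto simp: gauge_0)
  have shell_vol: "measure lborel ?shell \<le> 2 * 2 ^ DIM('a) * (D * r) * V"
  proof -
    have "measure lborel ?shell = measure lborel {z. n z < 1 + D * r} - measure lborel {z. n z < 1 - D * r}"
      using shell_fm D_r by (intro measurable_measure_Diff) auto
    then show ?thesis using shell_volume[OF order_refl K0 D_r small(2)] by (simp add: gauge_0)
  qed
  \<comment> \<open>If \<open>S\<close> contains \<open>z\<close> but not \<open>- z\<close>, then
    \<open>\<Phi>\<close> takes values on both sides of 1 at these points, while \<open>n\<close> is
    even; so \<open>n z\<close> is close to 1.\<close>
  have in_shell: "z \<in> ?shell" if "z \<in> S" "- z \<notin> S" for z
  proof -
    have z: "norm z \<le> R" "\<Phi> z < 1" "\<Phi> (- z) \<ge> 1" using that by (auto simp: S)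
    then show ?thesis using close[OF z(1)] close[of "- z"] DG Lr KRr by (auto simp: even abs_le_iff)
  qed
  define \<eta> where "\<eta> z = indicator S z * (H z - H0)" for z
  have \<eta>_meas [measurable]: "\<eta> \<in> borel_measurable borel" unfolding \<eta>_def[abs_def] by measurable
  have \<eta>_bd: "\<bar>\<eta> z\<bar> \<le> L * r" for z
    using H1[of z] Lr by (auto simp: \<eta>_def indicator_def S)
  have \<eta>_int: "integrable lborel \<eta>"
    by (rule integrable_bounded_support[where R=R, OF _ \<eta>_bd]) (simp, simp add: \<eta>_def S)
  have \<eta>_int': "integrable lborel (\<lambda>z. \<eta> (- z))"
    by (rule integrable_bounded_support[where R=R, OF _ \<eta>_bd]) (simp, simp add: \<eta>_def S)
  \<comment> \<open>\<open>S\<close> is not symmetric. Where it contains both \<open>z\<close> and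
    \<open>- z\<close>, the second difference of \<open>H\<close> is O(r^2). Where it contains only
    one of them, the bound is merely O(r), but such points form a shell of volume O(r).\<close>
  have sym_bd: "\<bar>\<eta> z + \<eta> (- z)\<bar> \<le> L * r\<^sup>2 * indicator (cball 0 R) z + L * r * indicator ?shell z" for z
  proof -
    have Lr2: "0 \<le> L * r\<^sup>2" using L by simp
    consider "z \<in> S" "- z \<in> S" | "z \<in> S" "- z \<notin> S" | "z \<notin> S" "- z \<in> S" | "z \<notin> S" "- z \<notin> S" by blast
    then show ?thesis
    proof cases
      case 1
      then have "\<eta> z + \<eta> (- z) = H z + H (- z) - 2 * H0" "norm z \<le> R" by (auto simp: \<eta>_def S)
      then show ?thesis using H2[of z] Lr by (simp add: indicator_def)
    next
      case 2
      then have "\<eta> z + \<eta> (- z) = \<eta> z" by (simp add: \<eta>_def)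
      then show ?thesis using in_shell[OF 2] \<eta>_bd[of z] Lr2 by (auto simp: indicator_def)
    next
      case 3
      then have "\<eta> z + \<eta> (- z) = \<eta> (- z)" by (simp add: \<eta>_def)
      moreover have "z \<in> ?shell" using in_shell[of "- z"] 3 by (simp add: even)
      ultimately show ?thesis using \<eta>_bd[of "- z"] Lr2 by (auto simp: indicator_def)
    next
      case 4
      then show ?thesis using L Lr by (simp add: \<eta>_def)
    qed
  qed
  have shell_sets: "?shell \<in> fmeasurable lborel" using shell_fm by (rule fmeasurable.Diff)
  have "2 * \<bar>\<integral>z. \<eta> z \<partial>lborel\<bar> = \<bar>\<integral>z. \<eta> z + \<eta> (- z) \<partial>lborel\<bar>"
    using \<eta>_int \<eta>_int' integral_lborel_uminus[OF \<eta>_meas] by simp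
  also have "\<dots> \<le> (\<integral>z. L * r\<^sup>2 * indicator (cball 0 R) z + L * r * indicator ?shell z \<partial>lborel)"
    using shell_sets
    by (intro integral_abs_bound_integral Bochner_Integration.integrable_add \<eta>_int \<eta>_int' sym_bd
        integrable_mult_right integrable_real_indicator) (auto simp: fmeasurable_def)
  also have "\<dots> = L * r\<^sup>2 * V + L * r * measure lborel ?shell"
    using shell_sets by (subst Bochner_Integration.integral_add)
      (auto intro!: integrable_mult_right integrable_real_indicator simp: V_def fmeasurable_def)
  also have "\<dots> \<le> L * r\<^sup>2 * V + L * r * (2 * 2 ^ DIM('a) * (D * r) * V)"
    using shell_vol Lr by (intro add_left_mono mult_left_mono)
  finally have \<eta>_le: "\<bar>\<integral>z. \<eta> z \<partial>lborel\<bar> \<le> (L * V + L * (2 * 2 ^ DIM('a) * D * V)) * r\<^sup>2"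
    by (simp add: algebra_simps power2_eq_square)
  have "(\<integral>z. indicator S z * H z \<partial>lborel) = (\<integral>z. H0 * indicator S z + \<eta> z \<partial>lborel)"
    by (intro Bochner_Integration.integral_cong) (auto simp: \<eta>_def algebra_simps)
  also have "\<dots> = H0 * measure lborel S + (\<integral>z. \<eta> z \<partial>lborel)"
    using S_fm by (subst Bochner_Integration.integral_add)
      (auto intro!: integrable_mult_right integrable_real_indicator \<eta>_int simp: fmeasurable_def)
  finally have "(\<integral>z. indicator S z * H z \<partial>lborel) - H0 * vol 0
    = H0 * (measure lborel S - vol r) + H0 * (vol r - vol 0) + (\<integral>z. \<eta> z \<partial>lborel)" by (simp add: algebra_simps)
  moreover have "\<bar>H0 * (measure lborel S - vol r)\<bar> \<le> L * (2 ^ DIM('a) * (C' * r\<^sup>2) * V)"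
    unfolding abs_mult using H0 S_vol L by (intro mult_mono) auto
  moreover have "\<bar>H0 * (vol r - vol 0)\<bar> \<le> L * ((K * R)\<^sup>2 * V / enn2real (ramp_moment DIM('a)) * r\<^sup>2)"
    unfolding abs_mult using H0 volume_perturbation[OF r0 r(2)] L by (intro mult_mono) auto
  ultimately have "\<bar>(\<integral>z. indicator S z * H z \<partial>lborel) - H0 * vol 0\<bar> \<le>
      L * (2 ^ DIM('a) * (C' * r\<^sup>2) * V) + L * ((K * R)\<^sup>2 * V / enn2real (ramp_moment DIM('a)) * r\<^sup>2)
      + (L * V + L * (2 * 2 ^ DIM('a) * D * V)) * r\<^sup>2"
    using \<eta>_le by linarith
  then show ?thesis by (simp add: vol_def gauge_0 algebra_simps)
qed

end

section \<open>Taylor expansions and second differences\<close>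

text \<open>Taylor expansion along a segment needs only the diagonal of the \<open>m\<close>-th
  derivative, all directions equal to \<open>w\<close>. Iterating one fixed direction matches the
  recursion of \<open>Ck_on\<close> and avoids multilinear maps.\<close>

primrec iter_deriv :: "nat \<Rightarrow> 'a::real_normed_vector \<Rightarrow> ('a \<Rightarrow> 'b::real_normed_vector) \<Rightarrow> 'a \<Rightarrow> 'b" where
  "iter_deriv 0 w f = f"
| "iter_deriv (Suc m) w f = iter_deriv m w (\<lambda>x. frechet_derivative f (at x) w)"

lemma frechet_derivative_cong_open:
  assumes "open U" "x \<in> U" "\<And>y. y \<in> U \<Longrightarrow> f y = g y"
  shows "frechet_derivative f (at x) = frechet_derivative g (at x)"
    and "f differentiable at x \<longleftrightarrow> g differentiable at x"
proof -
  have "(f has_derivative D) (at x) \<longleftrightarrow> (g has_derivative D) (at x)" for D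
    using assms has_derivative_transform_within_open[of f D x UNIV U g]
      has_derivative_transform_within_open[of g D x UNIV U f] by auto
  then show "frechet_derivative f (at x) = frechet_derivative g (at x)" "f differentiable at x \<longleftrightarrow> g differentiable at x"
    by (simp_all add: frechet_derivative_def differentiable_def)
qed

lemma Ck_on_SucD: "Ck_on (Suc n) U f \<Longrightarrow> Ck_on n U f"
proof (induction n arbitrary: f)
  case 0
  then show ?case
    by (auto intro!: continuous_at_imp_continuous_on differentiable_imp_continuous_within)
next
  case (Suc n)
  from Suc.prems have "\<forall>x\<in>U. f differentiable at x" "\<forall>v. Ck_on (Suc n) U (\<lambda>x. frechet_derivative f (at x) v)"
    by simp_all
  with Suc.IH show ?case by simp
qed

lemma Ck_on_mono: "Ck_on n U f \<Longrightarrow> m \<le> n \<Longrightarrow> Ck_on m U f"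
  by (induction n) (auto simp: le_Suc_eq simp del: Ck_on.simps dest: Ck_on_SucD)

lemma Ck_on_imp_continuous_on: "Ck_on n U f \<Longrightarrow> continuous_on U f"
  using Ck_on_mono[of n U f 0] by simp

lemma iter_deriv_cong:
  assumes "open U" "\<And>y. y \<in> U \<Longrightarrow> f y = g y" "x \<in> U"
  shows "iter_deriv m w f x = iter_deriv m w g x"
  using assms(2)
proof (induction m arbitrary: f g)
  case (Suc m)
  have "iter_deriv m w (\<lambda>x. frechet_derivative f (at x) w) x = iter_deriv m w (\<lambda>x. frechet_derivative g (at x) w) x"
    using frechet_derivative_cong_open(1)[OF assms(1) _ Suc.prems] by (intro Suc.IH) auto
  then show ?case by simp
qed (use assms in auto)

lemma frechet_derivative_scaled_sum:
  assumes "\<And>i. i \<in> I \<Longrightarrow> g i differentiable at x"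
  shows "(\<lambda>x. \<Sum>i\<in>I. a i *\<^sub>R g i x) differentiable at x"
    and "frechet_derivative (\<lambda>x. \<Sum>i\<in>I. a i *\<^sub>R g i x) (at x) = (\<lambda>v. \<Sum>i\<in>I. a i *\<^sub>R frechet_derivative (g i) (at x) v)"
proof -
  have "((\<lambda>x. \<Sum>i\<in>I. a i *\<^sub>R g i x) has_derivative (\<lambda>v. \<Sum>i\<in>I. a i *\<^sub>R frechet_derivative (g i) (at x) v)) (at x)"
    using assms by (intro has_derivative_sum has_derivative_scaleR_right) (simp add: frechet_derivative_works)
  then show "(\<lambda>x. \<Sum>i\<in>I. a i *\<^sub>R g i x) differentiable at x"
    "frechet_derivative (\<lambda>x. \<Sum>i\<in>I. a i *\<^sub>R g i x) (at x) = (\<lambda>v. \<Sum>i\<in>I. a i *\<^sub>R frechet_derivative (g i) (at x) v)"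
    by (auto simp: differentiable_def dest: frechet_derivative_at)
qed

lemma iter_deriv_scaled_sum:
  assumes U: "open U" "x \<in> U" and "\<And>i. i \<in> I \<Longrightarrow> Ck_on m U (g i)"
  shows "iter_deriv m w (\<lambda>x. \<Sum>i\<in>I. a i *\<^sub>R g i x) x = (\<Sum>i\<in>I. a i *\<^sub>R iter_deriv m w (g i) x)"
  using assms(3)
proof (induction m arbitrary: g)
  case (Suc m)
  have d: "g i differentiable at y" if "i \<in> I" "y \<in> U" for i y using Suc.prems that by simp
  have "iter_deriv m w (\<lambda>y. frechet_derivative (\<lambda>x. \<Sum>i\<in>I. a i *\<^sub>R g i x) (at y) w) x
     = iter_deriv m w (\<lambda>y. \<Sum>i\<in>I. a i *\<^sub>R frechet_derivative (g i) (at y) w) x"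
    using d by (intro iter_deriv_cong[OF U(1) _ U(2)]) (simp add: frechet_derivative_scaled_sum)
  also have "\<dots> = (\<Sum>i\<in>I. a i *\<^sub>R iter_deriv m w (\<lambda>y. frechet_derivative (g i) (at y) w) x)"
    using Suc.prems by (intro Suc.IH) simp
  finally show ?case by simp
qed simp

text \<open>Makes the dependence on the direction explicit: the coordinates of \<open>w\<close>
  times derivatives of the partial derivatives. Bounds and continuity in \<open>w\<close> then
  follow by induction on \<open>m\<close>.\<close>

lemma iter_deriv_Suc_expand:
  fixes f :: "'a::euclidean_space \<Rightarrow> 'b::real_normed_vector"
  assumes U: "open U" "x \<in> U" and f: "Ck_on (Suc m) U f"
  shows "iter_deriv (Suc m) w f x = (\<Sum>i\<in>Basis. (w \<bullet> i) *\<^sub>R iter_deriv m w (\<lambda>x. frechet_derivative f (at x) i) x)"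
proof -
  have "frechet_derivative f (at y) w = (\<Sum>i\<in>Basis. (w \<bullet> i) *\<^sub>R frechet_derivative f (at y) i)" if "y \<in> U" for y
  proof -
    have lin: "linear (frechet_derivative f (at y))" using f that by (intro linear_frechet_derivative) simp
    have "frechet_derivative f (at y) (\<Sum>i\<in>Basis. (w \<bullet> i) *\<^sub>R i) = (\<Sum>i\<in>Basis. (w \<bullet> i) *\<^sub>R frechet_derivative f (at y) i)"
      by (simp add: linear_sum[OF lin] linear_cmul[OF lin])
    then show ?thesis by (simp add: euclidean_representation)
  qed
  then have "iter_deriv (Suc m) w f x = iter_deriv m w (\<lambda>y. \<Sum>i\<in>Basis. (w \<bullet> i) *\<^sub>R frechet_derivative f (at y) i) x"
    unfolding iter_deriv.simps by (rule iter_deriv_cong[OF U(1) _ U(2)])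
  also have "\<dots> = (\<Sum>i\<in>Basis. (w \<bullet> i) *\<^sub>R iter_deriv m w (\<lambda>x. frechet_derivative f (at x) i) x)"
    using f by (intro iter_deriv_scaled_sum[OF U]) simp
  finally show ?thesis .
qed

text \<open>Each expansion in the basis contributes one factor \<open>norm w\<close>; after
  \<open>m\<close> of them, continuous functions on a compact set remain. The constant is thus
  uniform in the point and in the direction.\<close>

lemma iter_deriv_bound:
  fixes f :: "'a::euclidean_space \<Rightarrow> 'b::real_normed_vector"
  assumes U: "open U" and K: "compact K" "K \<subseteq> U" and f: "Ck_on m U f"
  shows "\<exists>C\<ge>0. \<forall>x\<in>K. \<forall>w. norm (iter_deriv m w f x) \<le> C * norm w ^ m"
  using f
proof (induction m arbitrary: f)
  case 0
  then have "continuous_on K f" using K continuous_on_subset by auto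
  then have "bounded (f ` K)" using K compact_continuous_image compact_imp_bounded by blast
  then obtain C where "\<forall>x\<in>K. norm (f x) \<le> C" by (auto simp: bounded_iff)
  then have "\<forall>x\<in>K. norm (f x) \<le> max 0 C" by force
  then show ?case by (intro exI[of _ "max 0 C"]) auto
next
  case (Suc m)
  have "\<forall>i. \<exists>C\<ge>0. \<forall>x\<in>K. \<forall>w. norm (iter_deriv m w (\<lambda>x. frechet_derivative f (at x) i) x) \<le> C * norm w ^ m"
    using Suc.prems by (intro allI Suc.IH) simp
  then obtain C where C: "\<And>i. C i \<ge> 0"
    "\<And>i x w. x \<in> K \<Longrightarrow> norm (iter_deriv m w (\<lambda>x. frechet_derivative f (at x) i) x) \<le> C i * norm w ^ m"
    by metis
  show ?case
  proof (intro exI[of _ "\<Sum>i\<in>Basis. C i"] conjI ballI allI)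
    fix x w assume x: "x \<in> K"
    have "norm (iter_deriv (Suc m) w f x) \<le> (\<Sum>i\<in>Basis. norm ((w \<bullet> i) *\<^sub>R iter_deriv m w (\<lambda>x. frechet_derivative f (at x) i) x))"
      using x K unfolding iter_deriv_Suc_expand[OF U subsetD[OF K(2) x] Suc.prems] by (intro norm_sum)
    also have "\<dots> \<le> (\<Sum>i\<in>Basis. norm w * (C i * norm w ^ m))"
      unfolding norm_scaleR using C x by (intro sum_mono mult_mono) (auto simp: Basis_le_norm)
    also have "\<dots> = (\<Sum>i\<in>Basis. C i) * norm w ^ Suc m"
      by (simp add: sum_distrib_right sum_distrib_left mult_ac)
    finally show "norm (iter_deriv (Suc m) w f x) \<le> (\<Sum>i\<in>Basis. C i) * norm w ^ Suc m" .
  qed (use C in \<open>auto intro: sum_nonneg\<close>)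
qed

lemma iter_deriv_scaleR:
  assumes U: "open U" "x \<in> U" and f: "Ck_on m U f"
  shows "iter_deriv m (t *\<^sub>R w) f x = t ^ m *\<^sub>R iter_deriv m w f x"
  using f
proof (induction m arbitrary: f)
  case (Suc m)
  \<comment> \<open>The sum over a one-element set brings the scalar multiple into the form of
    \<open>iter_deriv_scaled_sum\<close>.\<close>
  have "frechet_derivative f (at y) (t *\<^sub>R w) = (\<Sum>i\<in>{()}. t *\<^sub>R frechet_derivative f (at y) w)" if "y \<in> U" for y
  proof -
    have "linear (frechet_derivative f (at y))" using Suc.prems that by (intro linear_frechet_derivative) simp
    then show ?thesis by (simp add: linear_cmul)
  qed
  then have "iter_deriv (Suc m) (t *\<^sub>R w) f x
      = iter_deriv m (t *\<^sub>R w) (\<lambda>y. \<Sum>i\<in>{()}. t *\<^sub>R frechet_derivative f (at y) w) x"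
    unfolding iter_deriv.simps by (rule iter_deriv_cong[OF U(1) _ U(2)])
  also have "\<dots> = t *\<^sub>R iter_deriv m (t *\<^sub>R w) (\<lambda>y. frechet_derivative f (at y) w) x"
    using Suc.prems by (subst iter_deriv_scaled_sum[OF U]) auto
  also have "iter_deriv m (t *\<^sub>R w) (\<lambda>y. frechet_derivative f (at y) w) x = t ^ m *\<^sub>R iter_deriv m w (\<lambda>y. frechet_derivative f (at y) w) x"
    using Suc.prems by (intro Suc.IH) simp
  finally show ?case by simp
qed simp

lemma continuous_iter_deriv_direction:
  fixes f :: "'a::euclidean_space \<Rightarrow> 'b::real_normed_vector"
  assumes U: "open U" "x \<in> U" and f: "Ck_on m U f"
  shows "continuous_on UNIV (\<lambda>w. iter_deriv m w f x)"
  using f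
proof (induction m arbitrary: f)
  case (Suc m)
  have "continuous_on UNIV (\<lambda>w. iter_deriv m w (\<lambda>x. frechet_derivative f (at x) i) x)" for i
    using Suc.prems by (intro Suc.IH) simp
  then show ?case
    unfolding iter_deriv_Suc_expand[OF U Suc.prems] by (intro continuous_intros)
qed (simp)

text \<open>The recursion of \<open>iter_deriv\<close> takes the next derivative innermost, whereas
  the Taylor argument differentiates the result once more; the two orders agree.\<close>

lemma frechet_derivative_iter_deriv:
  assumes "Ck_on (Suc m) U f" "x \<in> U"
  shows "iter_deriv m w f differentiable at x"
    and "frechet_derivative (iter_deriv m w f) (at x) w = iter_deriv (Suc m) w f x"
proof -
  have "iter_deriv m w f differentiable at x \<and> frechet_derivative (iter_deriv m w f) (at x) w = iter_deriv (Suc m) w f x"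
    using assms(1)
  proof (induction m arbitrary: f)
    case (Suc m)
    have "Ck_on (Suc m) U (\<lambda>x. frechet_derivative f (at x) w)" using Suc.prems by simp
    from Suc.IH[OF this] show ?case by simp
  qed (use assms in simp)
  then show "iter_deriv m w f differentiable at x"
    "frechet_derivative (iter_deriv m w f) (at x) w = iter_deriv (Suc m) w f x" by auto
qed

text \<open>The real Maclaurin formula is applied to each coordinate of \<open>f\<close> along the
  segment. Its intermediate point depends on the coordinate, which is why the coordinate errors are
  summed and the dimension enters. The factor \<open>1 / fact m\<close> is dropped.\<close>

lemma Taylor_Ck_on:
  fixes f :: "'a::real_normed_vector \<Rightarrow> 'b::euclidean_space"
  assumes f: "Ck_on m U f" and m: "m > 0" and seg: "\<And>t. 0 \<le> t \<Longrightarrow> t \<le> 1 \<Longrightarrow> u + t *\<^sub>R w \<in> U"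
    and B: "\<And>t. 0 \<le> t \<Longrightarrow> t \<le> 1 \<Longrightarrow> norm (iter_deriv m w f (u + t *\<^sub>R w)) \<le> B"
  shows "norm (f (u + w) - (\<Sum>j<m. iter_deriv j w f u /\<^sub>R fact j)) \<le> real DIM('b) * B"
proof -
  have "\<bar>(f (u + w) - (\<Sum>j<m. iter_deriv j w f u /\<^sub>R fact j)) \<bullet> b\<bar> \<le> B" if b: "b \<in> Basis" for b
  proof -
    let ?d = "\<lambda>j t. iter_deriv j w f (u + t *\<^sub>R w) \<bullet> b"
    have "(?d j has_real_derivative ?d (Suc j) t) (at t)" if j: "j < m" and t: "0 \<le> t" "t \<le> 1" for j t
    proof -
      have C: "Ck_on (Suc j) U f" using j by (intro Ck_on_mono[OF f]) simp
      have "((\<lambda>t. u + t *\<^sub>R w) has_derivative (\<lambda>h. h *\<^sub>R w)) (at t)"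
        by (auto intro!: derivative_eq_intros)
      moreover have "(iter_deriv j w f has_derivative frechet_derivative (iter_deriv j w f) (at (u + t *\<^sub>R w))) (at (u + t *\<^sub>R w))"
        using frechet_derivative_iter_deriv(1)[OF C seg[OF t]] by (simp add: frechet_derivative_works)
      ultimately have "((\<lambda>t. iter_deriv j w f (u + t *\<^sub>R w)) has_derivative
          (\<lambda>h. frechet_derivative (iter_deriv j w f) (at (u + t *\<^sub>R w)) (h *\<^sub>R w))) (at t)"
        by (rule has_derivative_compose)
      then have "(?d j has_derivative (\<lambda>h. frechet_derivative (iter_deriv j w f) (at (u + t *\<^sub>R w)) (h *\<^sub>R w) \<bullet> b)) (at t)"
        by (rule has_derivative_inner_left)
      moreover have "(\<lambda>h. frechet_derivative (iter_deriv j w f) (at (u + t *\<^sub>R w)) (h *\<^sub>R w) \<bullet> b) = (*) (?d (Suc j) t)"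
        using linear_cmul[OF linear_frechet_derivative[OF frechet_derivative_iter_deriv(1)[OF C seg[OF t]]]]
          frechet_derivative_iter_deriv(2)[OF C seg[OF t]]
        by (auto simp del: iter_deriv.simps)
      ultimately show ?thesis by (simp add: has_field_derivative_def del: iter_deriv.simps)
    qed
    then obtain t where t: "0 < t" "t < 1"
      "f (u + w) \<bullet> b = (\<Sum>j<m. ?d j 0 / fact j * 1 ^ j) + ?d m t / fact m * 1 ^ m"
      using Maclaurin[of 1 m ?d "?d 0"] m by auto
    then have "(f (u + w) - (\<Sum>j<m. iter_deriv j w f u /\<^sub>R fact j)) \<bullet> b = ?d m t / fact m"
      by (simp add: inner_diff_left inner_sum_left divide_inverse mult.commute)
    moreover have "\<bar>?d m t\<bar> \<le> B" using t B[of t] Basis_le_norm[OF b, of "iter_deriv m w f (u + t *\<^sub>R w)"] by simp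
    moreover have "\<bar>?d m t\<bar> / fact m \<le> \<bar>?d m t\<bar> / 1" by (intro divide_left_mono) (auto simp: fact_ge_1)
    ultimately show ?thesis by simp
  qed
  then have "(\<Sum>b\<in>Basis. \<bar>(f (u + w) - (\<Sum>j<m. iter_deriv j w f u /\<^sub>R fact j)) \<bullet> b\<bar>) \<le> (\<Sum>b\<in>(Basis::'b set). B)"
    by (intro sum_mono)
  then show ?thesis using norm_le_l1[of "f (u + w) - (\<Sum>j<m. iter_deriv j w f u /\<^sub>R fact j)"] by simp
qed

text \<open>The doubled radius keeps the segment from any \<open>u\<close> in the small ball to
  \<open>u + w\<close> inside one compact subset of \<open>U\<close>, so one constant serves all of
  them.\<close>

lemma Taylor_Ck_on_uniform:
  fixes f :: "'a::euclidean_space \<Rightarrow> 'b::euclidean_space"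
  assumes U: "open U" "cball u0 (2 * \<delta>) \<subseteq> U" and f: "Ck_on m U f" and m: "m > 0"
  shows "\<exists>C\<ge>0. \<forall>u\<in>cball u0 \<delta>. \<forall>w. norm w \<le> \<delta> \<longrightarrow>
    norm (f (u + w) - (\<Sum>j<m. iter_deriv j w f u /\<^sub>R fact j)) \<le> C * norm w ^ m"
proof -
  obtain C where C: "C \<ge> 0" "\<And>x w. x \<in> cball u0 (2 * \<delta>) \<Longrightarrow> norm (iter_deriv m w f x) \<le> C * norm w ^ m"
    using iter_deriv_bound[OF U(1) compact_cball U(2) f] by blast
  show ?thesis
  proof (intro exI[of _ "real DIM('b) * C"] conjI ballI allI impI)
    fix u w :: 'a assume u: "u \<in> cball u0 \<delta>" and w: "norm w \<le> \<delta>"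
    have in_ball: "u + t *\<^sub>R w \<in> cball u0 (2 * \<delta>)" if "0 \<le> t" "t \<le> 1" for t
    proof -
      have "norm (t *\<^sub>R w) \<le> \<delta>" using that w mult_left_le_one_le[of "norm w" t] by simp
      moreover have "dist u0 (u + t *\<^sub>R w) \<le> dist u0 u + norm (t *\<^sub>R w)"
        using dist_triangle[of u0 "u + t *\<^sub>R w" u] by (simp add: dist_norm)
      ultimately show ?thesis using u by simp
    qed
    show "norm (f (u + w) - (\<Sum>j<m. iter_deriv j w f u /\<^sub>R fact j)) \<le> real DIM('b) * C * norm w ^ m"
      unfolding mult.assoc
      by (rule Taylor_Ck_on[OF f m]) (use in_ball U(2) C in \<open>auto simp del: iter_deriv.simps\<close>)
  qed (use C in auto)
qed

text \<open>The second difference records that the first variation is odd, without naming the derivative.\<close>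

definition second_difference_bounded :: "'a::real_normed_vector \<Rightarrow> real \<Rightarrow> ('a \<Rightarrow> real) \<Rightarrow> bool" where
  "second_difference_bounded u0 \<delta> f \<longleftrightarrow> (\<exists>C\<ge>0. \<forall>u\<in>cball u0 \<delta>. \<forall>w. norm w \<le> \<delta> \<longrightarrow>
     \<bar>f u\<bar> \<le> C \<and> \<bar>f (u + w) - f u\<bar> \<le> C * norm w \<and> \<bar>f (u + w) + f (u - w) - 2 * f u\<bar> \<le> C * (norm w)\<^sup>2)"

lemma second_difference_boundedI:
  assumes "C \<ge> 0"
    and "\<And>u. u \<in> cball u0 \<delta> \<Longrightarrow> \<bar>f u\<bar> \<le> C"
    and "\<And>u w. u \<in> cball u0 \<delta> \<Longrightarrow> norm w \<le> \<delta> \<Longrightarrow> \<bar>f (u + w) - f u\<bar> \<le> C * norm w"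
    and "\<And>u w. u \<in> cball u0 \<delta> \<Longrightarrow> norm w \<le> \<delta> \<Longrightarrow> \<bar>f (u + w) + f (u - w) - 2 * f u\<bar> \<le> C * (norm w)\<^sup>2"
  shows "second_difference_bounded u0 \<delta> f"
  unfolding second_difference_bounded_def using assms by (intro exI[of _ C]) simp

lemma second_difference_boundedE:
  assumes "second_difference_bounded u0 \<delta> f"
  obtains C where "C \<ge> 0"
    and "\<And>u. u \<in> cball u0 \<delta> \<Longrightarrow> \<delta> \<ge> 0 \<Longrightarrow> \<bar>f u\<bar> \<le> C"
    and "\<And>u w. u \<in> cball u0 \<delta> \<Longrightarrow> norm w \<le> \<delta> \<Longrightarrow> \<bar>f (u + w) - f u\<bar> \<le> C * norm w"
    and "\<And>u w. u \<in> cball u0 \<delta> \<Longrightarrow> norm w \<le> \<delta> \<Longrightarrow> \<bar>f (u + w) + f (u - w) - 2 * f u\<bar> \<le> C * (norm w)\<^sup>2"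
proof -
  from assms obtain C where C: "C \<ge> 0" "\<And>u w. u \<in> cball u0 \<delta> \<Longrightarrow> norm w \<le> \<delta> \<Longrightarrow>
     \<bar>f u\<bar> \<le> C \<and> \<bar>f (u + w) - f u\<bar> \<le> C * norm w \<and> \<bar>f (u + w) + f (u - w) - 2 * f u\<bar> \<le> C * (norm w)\<^sup>2"
    unfolding second_difference_bounded_def by blast
  show ?thesis by (rule that[of C]) (use C C(2)[of _ 0] in auto)
qed

text \<open>The linear Taylor terms at \<open>w\<close> and \<open>- w\<close> cancel, and two
  quadratic remainders are left.\<close>

lemma second_difference_bounded_Ck_on:
  fixes f :: "'a::euclidean_space \<Rightarrow> 'b::euclidean_space"
  assumes U: "open U" "cball u0 (2 * \<delta>) \<subseteq> U" and \<delta>: "\<delta> > 0" and f: "Ck_on 2 U f" and b: "b \<in> Basis"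
  shows "second_difference_bounded u0 \<delta> (\<lambda>u. f u \<bullet> b)"
proof -
  have sub: "cball u0 \<delta> \<subseteq> cball u0 (2 * \<delta>)" using \<delta> by auto
  have U1: "cball u0 \<delta> \<subseteq> U" using sub U by auto
  have f1: "Ck_on 1 U f" and f0: "Ck_on 0 U f" by (rule Ck_on_mono[OF f]; simp)+
  obtain C0 where C0: "C0 \<ge> 0" "\<And>u. u \<in> cball u0 \<delta> \<Longrightarrow> norm (f u) \<le> C0"
    using iter_deriv_bound[OF U(1) compact_cball U1 f0] by auto
  obtain C1 where C1: "C1 \<ge> 0" "\<And>u w. u \<in> cball u0 \<delta> \<Longrightarrow> norm w \<le> \<delta> \<Longrightarrow> norm (f (u + w) - f u) \<le> C1 * norm w"
    using Taylor_Ck_on_uniform[OF U f1] by auto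
  obtain C2 where C2: "C2 \<ge> 0" "\<And>u w. u \<in> cball u0 \<delta> \<Longrightarrow> norm w \<le> \<delta> \<Longrightarrow>
      norm (f (u + w) - (f u + frechet_derivative f (at u) w)) \<le> C2 * (norm w)\<^sup>2"
    using Taylor_Ck_on_uniform[OF U f] by (auto simp: numeral_2_eq_2)
  have ineqs: "\<bar>x \<bullet> b\<bar> \<le> norm x" for x :: 'b using b by (rule Basis_le_norm)
  show ?thesis
  proof (rule second_difference_boundedI[of "C0 + C1 + 2 * C2"])
    fix u assume u: "u \<in> cball u0 \<delta>"
    show "\<bar>f u \<bullet> b\<bar> \<le> C0 + C1 + 2 * C2" using ineqs[of "f u"] C0(2)[OF u] C1 C2 by linarith
    fix w :: 'a assume w: "norm w \<le> \<delta>"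
    have "\<bar>f (u + w) \<bullet> b - f u \<bullet> b\<bar> \<le> C1 * norm w"
      using ineqs[of "f (u + w) - f u"] C1(2)[OF u w] by (simp add: inner_diff_left)
    also have "\<dots> \<le> (C0 + C1 + 2 * C2) * norm w" using C0(1) C2(1) by (intro mult_right_mono) auto
    finally show "\<bar>f (u + w) \<bullet> b - f u \<bullet> b\<bar> \<le> (C0 + C1 + 2 * C2) * norm w" .
    have "linear (frechet_derivative f (at u))"
      using f1 u U1 by (intro linear_frechet_derivative) auto
    then have "f (u + w) + f (u - w) - 2 *\<^sub>R f u = (f (u + w) - (f u + frechet_derivative f (at u) w))
        + (f (u + (- w)) - (f u + frechet_derivative f (at u) (- w)))"
      by (simp add: linear_neg scaleR_2)
    also have "norm \<dots> \<le> C2 * (norm w)\<^sup>2 + C2 * (norm (- w))\<^sup>2"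
      by (intro norm_triangle_mono C2(2) u) (use w in auto)
    finally have "norm (f (u + w) + f (u - w) - 2 *\<^sub>R f u) \<le> 2 * C2 * (norm w)\<^sup>2" by simp
    then have "\<bar>f (u + w) \<bullet> b + f (u - w) \<bullet> b - 2 * (f u \<bullet> b)\<bar> \<le> 2 * C2 * (norm w)\<^sup>2"
      using ineqs[of "f (u + w) + f (u - w) - 2 *\<^sub>R f u"] by (simp add: inner_diff_left inner_add_left)
    also have "\<dots> \<le> (C0 + C1 + 2 * C2) * (norm w)\<^sup>2" using C0(1) C1(1) by (intro mult_right_mono) auto
    finally show "\<bar>f (u + w) \<bullet> b + f (u - w) \<bullet> b - 2 * (f u \<bullet> b)\<bar> \<le> (C0 + C1 + 2 * C2) * (norm w)\<^sup>2" .
  qed (use C0 C1 C2 in simp)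
qed

section \<open>Algebraic operations that preserve bounded second differences\<close>

lemma second_difference_bounded_const: "second_difference_bounded u0 \<delta> (\<lambda>u. k)"
  by (rule second_difference_boundedI[of "\<bar>k\<bar>"]) auto

lemma second_difference_bounded_add:
  assumes "second_difference_bounded u0 \<delta> f" "second_difference_bounded u0 \<delta> g" "\<delta> \<ge> 0"
  shows "second_difference_bounded u0 \<delta> (\<lambda>u. f u + g u)"
proof -
  from assms(1) obtain C where C: "C \<ge> 0"
    "\<And>u. u \<in> cball u0 \<delta> \<Longrightarrow> \<delta> \<ge> 0 \<Longrightarrow> \<bar>f u\<bar> \<le> C"
    "\<And>u w. u \<in> cball u0 \<delta> \<Longrightarrow> norm w \<le> \<delta> \<Longrightarrow> \<bar>f (u + w) - f u\<bar> \<le> C * norm w"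
    "\<And>u w. u \<in> cball u0 \<delta> \<Longrightarrow> norm w \<le> \<delta> \<Longrightarrow> \<bar>f (u + w) + f (u - w) - 2 * f u\<bar> \<le> C * (norm w)\<^sup>2"
    by (rule second_difference_boundedE) blast
  from assms(2) obtain D where D: "D \<ge> 0"
    "\<And>u. u \<in> cball u0 \<delta> \<Longrightarrow> \<delta> \<ge> 0 \<Longrightarrow> \<bar>g u\<bar> \<le> D"
    "\<And>u w. u \<in> cball u0 \<delta> \<Longrightarrow> norm w \<le> \<delta> \<Longrightarrow> \<bar>g (u + w) - g u\<bar> \<le> D * norm w"
    "\<And>u w. u \<in> cball u0 \<delta> \<Longrightarrow> norm w \<le> \<delta> \<Longrightarrow> \<bar>g (u + w) + g (u - w) - 2 * g u\<bar> \<le> D * (norm w)\<^sup>2"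
    by (rule second_difference_boundedE) blast
  show ?thesis
  proof (rule second_difference_boundedI[of "C + D"])
    fix u assume u: "u \<in> cball u0 \<delta>"
    show "\<bar>f u + g u\<bar> \<le> C + D" using C(2)[OF u assms(3)] D(2)[OF u assms(3)] by linarith
    fix w :: 'a assume w: "norm w \<le> \<delta>"
    show "\<bar>f (u + w) + g (u + w) - (f u + g u)\<bar> \<le> (C + D) * norm w"
      using C(3)[OF u w] D(3)[OF u w] unfolding distrib_right by linarith
    show "\<bar>f (u + w) + g (u + w) + (f (u - w) + g (u - w)) - 2 * (f u + g u)\<bar> \<le> (C + D) * (norm w)\<^sup>2"
    proof -
      have "f (u + w) + g (u + w) + (f (u - w) + g (u - w)) - 2 * (f u + g u)
        = (f (u + w) + f (u - w) - 2 * f u) + (g (u + w) + g (u - w) - 2 * g u)" by simp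
      then show ?thesis using abs_triangle_ineq[of "f (u + w) + f (u - w) - 2 * f u" "g (u + w) + g (u - w) - 2 * g u"]
          C(4)[OF u w] D(4)[OF u w] unfolding distrib_right by linarith
    qed
  qed (use C D in simp)
qed

lemma second_difference_bounded_mult:
  assumes "second_difference_bounded u0 \<delta> f" "second_difference_bounded u0 \<delta> g" and \<delta>: "\<delta> \<ge> 0"
  shows "second_difference_bounded u0 \<delta> (\<lambda>u. f u * g u)"
proof -
  from assms(1) obtain C where C: "C \<ge> 0"
    "\<And>u. u \<in> cball u0 \<delta> \<Longrightarrow> \<delta> \<ge> 0 \<Longrightarrow> \<bar>f u\<bar> \<le> C"
    "\<And>u w. u \<in> cball u0 \<delta> \<Longrightarrow> norm w \<le> \<delta> \<Longrightarrow> \<bar>f (u + w) - f u\<bar> \<le> C * norm w"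
    "\<And>u w. u \<in> cball u0 \<delta> \<Longrightarrow> norm w \<le> \<delta> \<Longrightarrow> \<bar>f (u + w) + f (u - w) - 2 * f u\<bar> \<le> C * (norm w)\<^sup>2"
    by (rule second_difference_boundedE) blast
  from assms(2) obtain D where D: "D \<ge> 0"
    "\<And>u. u \<in> cball u0 \<delta> \<Longrightarrow> \<delta> \<ge> 0 \<Longrightarrow> \<bar>g u\<bar> \<le> D"
    "\<And>u w. u \<in> cball u0 \<delta> \<Longrightarrow> norm w \<le> \<delta> \<Longrightarrow> \<bar>g (u + w) - g u\<bar> \<le> D * norm w"
    "\<And>u w. u \<in> cball u0 \<delta> \<Longrightarrow> norm w \<le> \<delta> \<Longrightarrow> \<bar>g (u + w) + g (u - w) - 2 * g u\<bar> \<le> D * (norm w)\<^sup>2"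
    by (rule second_difference_boundedE) blast
  \<comment> \<open>The second difference of a product consists of four terms, each at most
    \<open>C * D * (norm w)\<^sup>2\<close>. The first difference needs \<open>2 + \<delta>\<close>,
    where \<open>\<delta>\<close> bounds one factor of the product of two increments.\<close>
  let ?B = "C * D * (4 + \<delta>)"
  show ?thesis
  proof (rule second_difference_boundedI[of ?B])
    show CD: "?B \<ge> 0" using C D \<delta> by simp
    fix u assume u: "u \<in> cball u0 \<delta>"
    note fu = C(2)[OF u \<delta>] and gu = D(2)[OF u \<delta>]
    have "\<bar>f u * g u\<bar> \<le> C * D" unfolding abs_mult using fu gu C(1) by (intro mult_mono) auto
    also have "\<dots> \<le> ?B" using C(1) D(1) \<delta> mult_left_mono[of 1 "4 + \<delta>" "C * D"] by simp
    finally show "\<bar>f u * g u\<bar> \<le> ?B" .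
    fix w :: 'a assume w: "norm w \<le> \<delta>"
    have w': "norm (- w) \<le> \<delta>" using w by simp
    define \<alpha> \<alpha>' \<beta> \<beta>' where "\<alpha> = f (u + w) - f u" and "\<alpha>' = f (u - w) - f u"
      and "\<beta> = g (u + w) - g u" and "\<beta>' = g (u - w) - g u"
    have a: "\<bar>\<alpha>\<bar> \<le> C * norm w" "\<bar>\<alpha>'\<bar> \<le> C * norm w" "\<bar>\<beta>\<bar> \<le> D * norm w" "\<bar>\<beta>'\<bar> \<le> D * norm w"
      using C(3)[OF u w] C(3)[OF u w'] D(3)[OF u w] D(3)[OF u w'] by (auto simp: \<alpha>_def \<alpha>'_def \<beta>_def \<beta>'_def)
    have s: "\<bar>\<alpha> + \<alpha>'\<bar> \<le> C * (norm w)\<^sup>2" "\<bar>\<beta> + \<beta>'\<bar> \<le> D * (norm w)\<^sup>2"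
      using C(4)[OF u w] D(4)[OF u w] by (auto simp: \<alpha>_def \<alpha>'_def \<beta>_def \<beta>'_def)
    have p1: "\<bar>f u * \<beta>\<bar> \<le> C * (D * norm w)" unfolding abs_mult using fu a C(1) by (intro mult_mono) auto
    have p2: "\<bar>g u * \<alpha>\<bar> \<le> D * (C * norm w)" unfolding abs_mult using gu a D(1) by (intro mult_mono) auto
    have p3: "\<bar>\<alpha> * \<beta>\<bar> \<le> C * norm w * (D * norm w)" unfolding abs_mult using a C(1) by (intro mult_mono) auto
    have p4: "\<bar>\<alpha>' * \<beta>'\<bar> \<le> C * norm w * (D * norm w)" unfolding abs_mult using a C(1) by (intro mult_mono) auto
    have p5: "\<bar>f u * (\<beta> + \<beta>')\<bar> \<le> C * (D * (norm w)\<^sup>2)" unfolding abs_mult using fu s C(1) by (intro mult_mono) auto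
    have p6: "\<bar>g u * (\<alpha> + \<alpha>')\<bar> \<le> D * (C * (norm w)\<^sup>2)" unfolding abs_mult using gu s D(1) by (intro mult_mono) auto
    have "norm w * norm w \<le> \<delta> * norm w" using w by (intro mult_right_mono) auto
    then have p7: "C * D * (norm w * norm w) \<le> C * D * (\<delta> * norm w)" using C(1) D(1) by (intro mult_left_mono) auto
    have CDw: "0 \<le> C * D * norm w" "0 \<le> C * D * (\<delta> * (norm w)\<^sup>2)" using C(1) D(1) \<delta> by auto
    have "f (u + w) * g (u + w) - f u * g u = f u * \<beta> + g u * \<alpha> + \<alpha> * \<beta>"
      by (simp add: \<alpha>_def \<beta>_def algebra_simps)
    then have "\<bar>f (u + w) * g (u + w) - f u * g u\<bar> \<le> C * (D * norm w) + D * (C * norm w) + C * norm w * (D * norm w)"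
      using p1 p2 p3 by linarith
    also have "\<dots> \<le> ?B * norm w" using p7 CDw by (simp add: algebra_simps)
    finally show "\<bar>f (u + w) * g (u + w) - f u * g u\<bar> \<le> ?B * norm w" .
    have "f (u + w) * g (u + w) + f (u - w) * g (u - w) - 2 * (f u * g u)
       = f u * (\<beta> + \<beta>') + g u * (\<alpha> + \<alpha>') + \<alpha> * \<beta> + \<alpha>' * \<beta>'"
      by (simp add: \<alpha>_def \<beta>_def \<alpha>'_def \<beta>'_def algebra_simps)
    then have "\<bar>f (u + w) * g (u + w) + f (u - w) * g (u - w) - 2 * (f u * g u)\<bar>
      \<le> C * (D * (norm w)\<^sup>2) + D * (C * (norm w)\<^sup>2) + C * norm w * (D * norm w) + C * norm w * (D * norm w)"
      using p3 p4 p5 p6 by linarith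
    also have "\<dots> \<le> ?B * (norm w)\<^sup>2" using CDw by (simp add: algebra_simps power2_eq_square)
    finally show "\<bar>f (u + w) * g (u + w) + f (u - w) * g (u - w) - 2 * (f u * g u)\<bar> \<le> ?B * (norm w)\<^sup>2" .
  qed
qed

lemma second_difference_bounded_sum:
  assumes "\<And>i. i \<in> I \<Longrightarrow> second_difference_bounded u0 \<delta> (f i)" "\<delta> \<ge> 0"
  shows "second_difference_bounded u0 \<delta> (\<lambda>u. \<Sum>i\<in>I. f i u)"
  using assms
  by (induction I rule: infinite_finite_induct)
    (auto intro: second_difference_bounded_const second_difference_bounded_add)

lemma second_difference_bounded_prod:
  assumes "\<And>i. i \<in> I \<Longrightarrow> second_difference_bounded u0 \<delta> (f i)" "\<delta> \<ge> 0"
  shows "second_difference_bounded u0 \<delta> (\<lambda>u. \<Prod>i\<in>I. f i u)"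
  using assms
  by (induction I rule: infinite_finite_induct)
    (auto intro: second_difference_bounded_const second_difference_bounded_mult)

text \<open>Increments of the root are controlled by multiplying with the conjugate sum, which is at
  least \<open>sqrt m\<close>. The lower bound is required on the doubled ball because the shifted
  points lie there.\<close>

lemma second_difference_bounded_sqrt:
  assumes "second_difference_bounded u0 \<delta> f" and \<delta>: "\<delta> \<ge> 0" and m: "m > 0"
    and pos: "\<And>u. u \<in> cball u0 (2 * \<delta>) \<Longrightarrow> m \<le> f u"
  shows "second_difference_bounded u0 \<delta> (\<lambda>u. sqrt (f u))"
proof -
  from assms(1) obtain C where C: "C \<ge> 0"
    "\<And>u. u \<in> cball u0 \<delta> \<Longrightarrow> \<delta> \<ge> 0 \<Longrightarrow> \<bar>f u\<bar> \<le> C"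
    "\<And>u w. u \<in> cball u0 \<delta> \<Longrightarrow> norm w \<le> \<delta> \<Longrightarrow> \<bar>f (u + w) - f u\<bar> \<le> C * norm w"
    "\<And>u w. u \<in> cball u0 \<delta> \<Longrightarrow> norm w \<le> \<delta> \<Longrightarrow> \<bar>f (u + w) + f (u - w) - 2 * f u\<bar> \<le> C * (norm w)\<^sup>2"
    by (rule second_difference_boundedE) blast
  define B where "B = C / sqrt m"
  have B: "B \<ge> 0" using C m by (simp add: B_def)
  have ball: "u + w \<in> cball u0 (2 * \<delta>)" if "u \<in> cball u0 \<delta>" "norm w \<le> \<delta>" for u w :: 'a
    using that dist_triangle[of u0 "u + w" u] by (simp add: dist_norm)
  have first: "\<bar>sqrt (f (u + w)) - sqrt (f u)\<bar> \<le> B * norm w" if u: "u \<in> cball u0 \<delta>" and w: "norm w \<le> \<delta>" for u w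
  proof -
    have s: "sqrt m \<le> sqrt (f (u + w))" "sqrt m \<le> sqrt (f u)"
      using pos[OF ball[OF u w]] pos[OF ball[OF u, of 0]] \<delta> by auto
    have pos': "0 \<le> f (u + w)" "0 \<le> f u" using pos[OF ball[OF u w]] pos[OF ball[OF u, of 0]] \<delta> m by auto
    have "(sqrt (f (u + w)) - sqrt (f u)) * (sqrt (f (u + w)) + sqrt (f u)) = f (u + w) - f u"
      using pos' by (simp add: algebra_simps)
    then have "\<bar>sqrt (f (u + w)) - sqrt (f u)\<bar> * (sqrt (f (u + w)) + sqrt (f u)) = \<bar>f (u + w) - f u\<bar>"
      using pos' by (metis abs_mult abs_of_nonneg add_nonneg_nonneg real_sqrt_ge_zero)
    moreover have "\<bar>sqrt (f (u + w)) - sqrt (f u)\<bar> * sqrt m \<le> \<bar>sqrt (f (u + w)) - sqrt (f u)\<bar> * (sqrt (f (u + w)) + sqrt (f u))"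
      using s pos' by (intro mult_left_mono) (auto simp: add_increasing2)
    ultimately have "\<bar>sqrt (f (u + w)) - sqrt (f u)\<bar> * sqrt m \<le> C * norm w" using C(3)[OF u w] by linarith
    then show ?thesis using m by (simp add: B_def field_simps)
  qed
  let ?B = "sqrt C + B + (C + 2 * B\<^sup>2) / sqrt m"
  have nn: "(C + 2 * B\<^sup>2) / sqrt m \<ge> 0" using C m by simp
  show ?thesis
  proof (rule second_difference_boundedI[of ?B])
    show "?B \<ge> 0" using nn B C by simp
    fix u assume u: "u \<in> cball u0 \<delta>"
    have fu: "m \<le> f u" using pos[OF ball[OF u, of 0]] \<delta> by simp
    have "sqrt (f u) \<le> sqrt C" using C(2)[OF u \<delta>] by simp
    moreover have "sqrt (f u) \<ge> 0" using fu m by simp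
    ultimately show "\<bar>sqrt (f u)\<bar> \<le> ?B" using nn B by linarith
    fix w :: 'a assume w: "norm w \<le> \<delta>"
    have w': "norm (- w) \<le> \<delta>" using w by simp
    have "\<bar>sqrt (f (u + w)) - sqrt (f u)\<bar> \<le> B * norm w" by (rule first[OF u w])
    also have "\<dots> \<le> ?B * norm w" using nn C(1) by (intro mult_right_mono) auto
    finally show "\<bar>sqrt (f (u + w)) - sqrt (f u)\<bar> \<le> ?B * norm w" .
    define s x y where "s = sqrt (f u)" and "x = sqrt (f (u + w)) - s" and "y = sqrt (f (u - w)) - s"
    have xy: "\<bar>x\<bar> \<le> B * norm w" "\<bar>y\<bar> \<le> B * norm w"
      using first[OF u w] first[OF u w'] by (auto simp: x_def y_def s_def)
    have sq: "x\<^sup>2 \<le> (B * norm w)\<^sup>2" "y\<^sup>2 \<le> (B * norm w)\<^sup>2"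
      using xy B by (subst power2_le_iff_abs_le; simp)+
    have s: "sqrt m \<le> s" using fu by (simp add: s_def)
    then have s0: "s > 0" using m by (meson less_le_trans real_sqrt_gt_zero)
    have fpos: "f (u + w) \<ge> 0" "f (u - w) \<ge> 0" "f u \<ge> 0"
      using pos[OF ball[OF u w]] pos[OF ball[OF u w']] fu m by auto
    have "(x + s)\<^sup>2 = f (u + w)" "(y + s)\<^sup>2 = f (u - w)" "s\<^sup>2 = f u"
      using fpos by (auto simp: x_def y_def s_def)
    \<comment> \<open>Squaring \<open>x + s\<close> and \<open>y + s\<close> shows that the second
      difference of the root, \<open>x + y\<close>, is that of \<open>f\<close> minus two squared
      increments, divided by \<open>2 * s\<close>.\<close>
    then have "2 * s * (x + y) = f (u + w) + f (u - w) - 2 * f u - x\<^sup>2 - y\<^sup>2"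
      by (simp add: power2_eq_square algebra_simps)
    then have "\<bar>2 * s * (x + y)\<bar> \<le> C * (norm w)\<^sup>2 + 2 * (B * norm w)\<^sup>2"
      using C(4)[OF u w] sq zero_le_power2[of x] zero_le_power2[of y] by linarith
    moreover have "\<bar>2 * s * (x + y)\<bar> \<ge> sqrt m * \<bar>x + y\<bar>"
      using s s0 by (auto simp: abs_mult intro!: mult_right_mono)
    ultimately have "\<bar>x + y\<bar> \<le> (C + 2 * B\<^sup>2) / sqrt m * (norm w)\<^sup>2"
      using m by (simp add: field_simps power_mult_distrib)
    also have "\<dots> \<le> ?B * (norm w)\<^sup>2" using B C(1) by (intro mult_right_mono) auto
    finally show "\<bar>sqrt (f (u + w)) + sqrt (f (u - w)) - 2 * sqrt (f u)\<bar> \<le> ?B * (norm w)\<^sup>2"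
      by (simp add: x_def y_def s_def)
  qed
qed

section \<open>Small balls in a chart\<close>

text \<open>Multiplied by \<open>2 * norm a\<close>, the error becomes a difference of two squares,
  each at most \<open>(norm e)\<^sup>2\<close>; this comes from comparing the squared norms of
  \<open>a + e\<close> and \<open>a\<close>.\<close>

lemma norm_add_expansion:
  fixes a e :: "'a::real_inner"
  assumes "a \<noteq> 0"
  shows "\<bar>norm (a + e) - norm a - a \<bullet> e / norm a\<bar> \<le> (norm e)\<^sup>2 / norm a"
proof -
  define x y where "x = norm (a + e)" and "y = norm a"
  have y: "y > 0" using assms by (simp add: y_def)
  have "\<bar>x - y\<bar> \<le> norm e" using norm_triangle_ineq3[of "a + e" a] by (simp add: x_def y_def)
  then have sq: "(x - y)\<^sup>2 \<le> (norm e)\<^sup>2" by (simp add: power2_le_iff_abs_le)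
  have "x\<^sup>2 = y\<^sup>2 + 2 * (a \<bullet> e) + (norm e)\<^sup>2"
    unfolding x_def y_def power2_norm_eq_inner by (simp add: inner_add_left inner_add_right inner_commute)
  then have "2 * y * (x - y - a \<bullet> e / y) = (norm e)\<^sup>2 - (x - y)\<^sup>2"
    using y by (simp add: power2_eq_square field_simps)
  then have "2 * y * \<bar>x - y - a \<bullet> e / y\<bar> = \<bar>(norm e)\<^sup>2 - (x - y)\<^sup>2\<bar>"
    using y by (metis abs_mult abs_of_pos mult_pos_pos zero_less_numeral)
  also have "\<dots> \<le> 2 * (norm e)\<^sup>2" using sq zero_le_power2[of "x - y"] by linarith
  finally show ?thesis using y unfolding x_def[symmetric] y_def[symmetric] by (simp add: field_simps)
qed

section \<open>The derivative and the volume density of a parametrization\<close>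

definition volume_density :: "(real^'d \<Rightarrow> real^'n) \<Rightarrow> real^'d \<Rightarrow> real" where
  "volume_density \<phi> u = sqrt (det (metric_matrix \<phi> u))"

locale chart =
  fixes M :: "(real^'n) set" and U :: "(real^'d::finite) set" and \<phi> :: "real^'d \<Rightarrow> real^'n"
  assumes lp: "local_parametrization M U \<phi>"
begin

abbreviation "T u w \<equiv> frechet_derivative \<phi> (at u) w"

lemma open_U: "open U" using lp by (simp add: local_parametrization_def)

lemma Ck: "Ck_on m U \<phi>" using lp by (simp add: local_parametrization_def smooth_on_def)

lemma differentiable: "u \<in> U \<Longrightarrow> \<phi> differentiable at u"
  using Ck[of 1] by simp

lemma continuous: "continuous_on U \<phi>" using Ck_on_imp_continuous_on[OF Ck] .

lemma linear_T: "u \<in> U \<Longrightarrow> linear (frechet_derivative \<phi> (at u))"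
  by (intro linear_frechet_derivative differentiable)

lemma inj_T: "u \<in> U \<Longrightarrow> inj (frechet_derivative \<phi> (at u))"
  using lp by (simp add: local_parametrization_def)

lemma Ck_T: "Ck_on m U (\<lambda>u. T u v)"
  using Ck[of "Suc m"] by simp

lemma T_expand:
  assumes "u \<in> U"
  shows "T u w = (\<Sum>i\<in>Basis. (w \<bullet> i) *\<^sub>R T u i)"
  using iter_deriv_Suc_expand[OF open_U assms Ck, of 0 w] by simp

text \<open>Here the coordinates drop out of the leading term: the volume of the unit body of the
  pulled-back norm is cancelled by the Riemannian density.\<close>

lemma ellipsoid_density:
  assumes "u \<in> U"
  shows "measure lborel {w. norm (T u w) < 1} * volume_density \<phi> u = unit_ball_volume TYPE('d)"
  using ellipsoid_volume[OF linear_T inj_T, OF assms assms]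
  by (simp add: volume_density_def metric_matrix_def)

text \<open>Positivity is read off \<open>ellipsoid_density\<close>: a nonnegative volume times the
  root is the positive volume of the unit ball.\<close>

lemma det_metric_pos: "u \<in> U \<Longrightarrow> det (metric_matrix \<phi> u) > 0"
  using ellipsoid_density[of u] unit_ball_volume_pos[where 'd='d]
  by (auto simp: volume_density_def zero_less_mult_iff not_less measure_nonneg)
     (metis measure_nonneg mult_nonneg_nonpos not_less real_sqrt_le_0_iff)

lemma continuous_T: "continuous_on U (\<lambda>u. T u v)"
  using Ck_on_imp_continuous_on[OF Ck_T] .

lemma continuous_det_metric: "continuous_on U (\<lambda>u. det (metric_matrix \<phi> u))"
  unfolding det_def metric_matrix_def
  by (auto intro!: continuous_intros continuous_T)

lemma continuous_volume_density: "continuous_on U (volume_density \<phi>)"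
  unfolding volume_density_def[abs_def] by (intro continuous_intros continuous_det_metric)

text \<open>The determinant is a polynomial in inner products of partial derivatives of \<phi>. The
  square root needs a positive lower bound, which is the minimum over a compact ball.\<close>

lemma second_difference_bounded_volume_density:
  assumes sub: "cball u0 (2 * \<delta>) \<subseteq> U" and \<delta>: "\<delta> > 0"
  shows "second_difference_bounded u0 \<delta> (volume_density \<phi>)"
proof -
  have "second_difference_bounded u0 \<delta> (\<lambda>u. metric_matrix \<phi> u $ i $ j)" for i j
    unfolding metric_matrix_def inner_vec_def
    using second_difference_bounded_Ck_on[OF open_U sub \<delta> Ck_T, of "axis _ 1"] \<delta>
    by (auto intro!: second_difference_bounded_sum second_difference_bounded_mult simp: inner_axis)
  then have det: "second_difference_bounded u0 \<delta> (\<lambda>u. det (metric_matrix \<phi> u))"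
    unfolding det_def using \<delta>
    by (intro second_difference_bounded_sum second_difference_bounded_mult second_difference_bounded_prod
        second_difference_bounded_const) auto
  have "continuous_on (cball u0 (2 * \<delta>)) (\<lambda>u. det (metric_matrix \<phi> u))"
    using continuous_det_metric sub by (rule continuous_on_subset)
  moreover have "cball u0 (2 * \<delta>) \<noteq> {}" using \<delta> by auto
  ultimately obtain v where v: "v \<in> cball u0 (2 * \<delta>)"
      "\<And>u. u \<in> cball u0 (2 * \<delta>) \<Longrightarrow> det (metric_matrix \<phi> v) \<le> det (metric_matrix \<phi> u)"
    using continuous_attains_inf[OF compact_cball] by blast
  show ?thesis
    unfolding volume_density_def[abs_def]
    by (rule second_difference_bounded_sqrt[OF det _ _ v(2)]) (use \<delta> v sub det_metric_pos in auto)
qed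

lemma T_lower_bound:
  assumes "cball u0 \<delta> \<subseteq> U" "\<delta> \<ge> 0"
  shows "\<exists>a>0. \<forall>u\<in>cball u0 \<delta>. \<forall>w. a * norm w \<le> norm (T u w)"
proof -
  let ?K = "cball u0 \<delta> \<times> sphere (0 :: real^'d) 1"
  \<comment> \<open>Continuity in the base point is known for each fixed direction; expanding in the
    basis gives joint continuity in point and direction.\<close>
  have "continuous_on ?K (\<lambda>x. norm (\<Sum>i\<in>Basis. (snd x \<bullet> i) *\<^sub>R T (fst x) i))"
    by (intro continuous_intros continuous_on_compose2[OF continuous_T]) (use assms in auto)
  moreover have "?K \<noteq> {}" using assms(2) by (auto intro!: exI[of _ u0])
  ultimately obtain x where x: "x \<in> ?K"
     "\<And>y. y \<in> ?K \<Longrightarrow> norm (\<Sum>i\<in>Basis. (snd x \<bullet> i) *\<^sub>R T (fst x) i) \<le> norm (\<Sum>i\<in>Basis. (snd y \<bullet> i) *\<^sub>R T (fst y) i)"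
    using continuous_attains_inf[OF compact_Times[OF compact_cball compact_sphere]] by blast
  have xU: "fst x \<in> U" and x1: "norm (snd x) = 1" using x(1) assms by auto
  define a where "a = norm (T (fst x) (snd x))"
  have "snd x \<noteq> 0" using x1 by auto
  then have "T (fst x) (snd x) \<noteq> 0"
    using inj_T[OF xU] linear_injective_0[OF linear_T[OF xU]] by blast
  then have "a > 0" by (simp add: a_def)
  moreover have "a * norm w \<le> norm (T u w)" if u: "u \<in> cball u0 \<delta>" for u w
  proof (cases "w = 0")
    case False
    have uU: "u \<in> U" using u assms by auto
    have "(u, w /\<^sub>R norm w) \<in> ?K" using u False by simp
    from x(2)[OF this] have "a \<le> norm (T u (w /\<^sub>R norm w))"
      unfolding a_def fst_conv snd_conv T_expand[OF uU, of "w /\<^sub>R norm w"] T_expand[OF xU, of "snd x"] .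
    also have "\<dots> = norm (T u w) / norm w"
      using linear_cmul[OF linear_T[OF uU], of "inverse (norm w)" w] by (simp add: divide_inverse mult.commute)
    finally show ?thesis using False by (simp add: field_simps)
  qed simp
  ultimately show ?thesis by blast
qed

lemma sublevel_borel:
  assumes "compact A" "A \<subseteq> U"
  shows "{v \<in> A. norm (\<phi> v - \<phi> u) < r} \<in> sets borel"
proof -
  have "continuous_on A (\<lambda>v. norm (\<phi> v - \<phi> u))"
    using continuous_on_subset[OF continuous assms(2)] by (intro continuous_intros)
  from continuous_openin_preimage_gen[OF this open_lessThan[of r]]
  obtain B where "open B" "A \<inter> (\<lambda>v. norm (\<phi> v - \<phi> u)) -` {..<r} = A \<inter> B"
    by (auto simp: openin_open)
  moreover have "{v \<in> A. norm (\<phi> v - \<phi> u) < r} = A \<inter> (\<lambda>v. norm (\<phi> v - \<phi> u)) -` {..<r}" by auto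
  ultimately show ?thesis using assms(1) by (auto intro: borel_compact)
qed

text \<open>Rescaling by \<open>v = u + r *\<^sub>R z\<close> turns the set into the perturbed unit
  body of \<open>perturbed_gauge\<close>, and the Jacobian contributes \<open>r ^ CARD('d)\<close>.
  All constants come from suprema over compact balls, so they do not depend on
  \<open>u\<close>.\<close>

lemma chart_integral_expansion:
  fixes f :: "real^'d \<Rightarrow> real"
  assumes sub: "cball u0 (2 * \<delta>) \<subseteq> U" and \<delta>: "\<delta> > 0"
    and a: "a > 0" "\<And>u w. u \<in> cball u0 \<delta> \<Longrightarrow> a * norm w \<le> norm (T u w)"
    and f: "Ck_on 2 U f"
  shows "\<exists>C\<ge>0. \<exists>r\<^sub>0>0. \<forall>u\<in>cball u0 \<delta>. \<forall>r. 0 < r \<longrightarrow> r < r\<^sub>0 \<longrightarrow>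
    2 / a * r \<le> \<delta> \<and>
    \<bar>(\<integral>v. indicator {v. norm (v - u) \<le> 2 / a * r \<and> norm (\<phi> v - \<phi> u) < r} v *
          (indicator U v * (f v * volume_density \<phi> v)) \<partial>lborel)
      - unit_ball_volume TYPE('d) * f u * r ^ CARD('d)\<bar> \<le> C * r ^ (CARD('d) + 2)"
proof -
  have sub1: "cball u0 \<delta> \<subseteq> U" using sub \<delta> by (auto simp: subset_iff)
  obtain b where b: "b \<ge> 0" "\<And>u w. u \<in> cball u0 \<delta> \<Longrightarrow> norm (T u w) \<le> b * norm w"
    using iter_deriv_bound[OF open_U compact_cball sub1 Ck[of 1]] by auto
  obtain q\<^sub>1 where q\<^sub>1: "q\<^sub>1 \<ge> 0" "\<And>u w. u \<in> cball u0 \<delta> \<Longrightarrow> norm (iter_deriv 2 w \<phi> u) \<le> q\<^sub>1 * (norm w)\<^sup>2"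
    using iter_deriv_bound[OF open_U compact_cball sub1 Ck[of 2]] by blast
  obtain C\<^sub>3 where C\<^sub>3: "C\<^sub>3 \<ge> 0" "\<And>u w. u \<in> cball u0 \<delta> \<Longrightarrow> norm w \<le> \<delta> \<Longrightarrow>
      norm (\<phi> (u + w) - (\<phi> u + T u w + iter_deriv 2 w \<phi> u /\<^sub>R 2)) \<le> C\<^sub>3 * norm w ^ 3"
    using Taylor_Ck_on_uniform[OF open_U sub Ck[of 3]] by (auto simp: eval_nat_numeral)
  have "second_difference_bounded u0 \<delta> (\<lambda>u. f u * volume_density \<phi> u)"
    using second_difference_bounded_Ck_on[OF open_U sub \<delta> f, of 1] second_difference_bounded_volume_density[OF sub \<delta>] \<delta>
    by (intro second_difference_bounded_mult) auto
  then obtain C\<^sub>h where C\<^sub>h: "C\<^sub>h \<ge> 0"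
    "\<And>u. u \<in> cball u0 \<delta> \<Longrightarrow> \<delta> \<ge> 0 \<Longrightarrow> \<bar>f u * volume_density \<phi> u\<bar> \<le> C\<^sub>h"
    "\<And>u w. u \<in> cball u0 \<delta> \<Longrightarrow> norm w \<le> \<delta> \<Longrightarrow>
       \<bar>f (u + w) * volume_density \<phi> (u + w) - f u * volume_density \<phi> u\<bar> \<le> C\<^sub>h * norm w"
    "\<And>u w. u \<in> cball u0 \<delta> \<Longrightarrow> norm w \<le> \<delta> \<Longrightarrow>
       \<bar>f (u + w) * volume_density \<phi> (u + w) + f (u - w) * volume_density \<phi> (u - w) - 2 * (f u * volume_density \<phi> u)\<bar> \<le> C\<^sub>h * (norm w)\<^sup>2"
    by (rule second_difference_boundedE) blast
  \<comment> \<open>Cauchy-Schwarz bounds the correction \<open>c w\<close> below by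
    \<open>q\<^sub>1 * (norm w)\<^sup>2 / (2 * n w)\<close>, and \<open>n w\<close> is at least
    \<open>a * norm w\<close>.\<close>
  define K where "K = q\<^sub>1 / (2 * a)"
  define R where "R = 2 / a"
  \<comment> \<open>The first bracket collects the cubic Taylor remainder of \<phi> and the error of
    expanding a norm. The factor \<open>1 + R + R\<^sup>2\<close> covers the value, the first and
    the second difference of the integrand at once.\<close>
  define L where "L = (C\<^sub>3 * R ^ 3 + q\<^sub>1\<^sup>2 * R ^ 3 / a) + C\<^sub>h * (1 + R + R\<^sup>2)"
  define G where "G = L + b * R * K * R"
  define D where "D = G + L + K * R"
  define C' where "C' = K * R * D + L"
  define V where "V = measure lborel (cball (0::real^'d) R)"
  define C where "C = L * (2 ^ CARD('d) * C' * V + (K * R)\<^sup>2 * V / enn2real (ramp_moment CARD('d))) +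
       (L * V + L * (2 * 2 ^ CARD('d) * D * V))"
  have R: "R > 0" and K: "K \<ge> 0" using a q\<^sub>1 by (auto simp: R_def K_def)
  have L1: "C\<^sub>3 * R ^ 3 + q\<^sub>1\<^sup>2 * R ^ 3 / a \<le> L" and L2: "C\<^sub>h * (1 + R + R\<^sup>2) \<le> L" and L: "L \<ge> 0"
    using C\<^sub>3 q\<^sub>1 C\<^sub>h R a by (auto simp: L_def)
  have G: "G \<ge> 0" using L b K R by (simp add: G_def)
  have D: "D \<ge> 0" using L G K R by (simp add: D_def)
  have C': "C' \<ge> 0" using L K R D by (simp add: C'_def)
  have C: "C \<ge> 0" using L K R D C' by (simp add: C_def V_def)
  \<comment> \<open>One entry per smallness condition in \<open>rs\<close>; the summands 1 keep the
    denominators positive when a constant is zero.\<close>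
  define r\<^sub>0 where "r\<^sub>0 = min 1 (min (a / 2 / (K + 1)) (min (1 / (C' + 1)) (min (1 / (D + 1)) (\<delta> / R))))"
  have r\<^sub>0: "r\<^sub>0 > 0" using a K C' D \<delta> R by (simp add: r\<^sub>0_def)
  have main: "R * r \<le> \<delta> \<and>
    \<bar>(\<integral>v. indicator {v. norm (v - u) \<le> R * r \<and> norm (\<phi> v - \<phi> u) < r} v *
          (indicator U v * (f v * volume_density \<phi> v)) \<partial>lborel)
      - unit_ball_volume TYPE('d) * f u * r ^ CARD('d)\<bar> \<le> C * r ^ (CARD('d) + 2)"
    if u: "u \<in> cball u0 \<delta>" and r: "0 < r" "r < r\<^sub>0" for u r
  proof -
    have uU: "u \<in> U" using u sub1 by auto
    have rs: "r \<le> 1" "r * (K + 1) < a / 2" "r * (C' + 1) < 1" "r * (D + 1) < 1" "R * r \<le> \<delta>"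
      using r K C' D R by (auto simp: r\<^sub>0_def field_simps)
    have small: "r * K \<le> a / 2" "C' * r\<^sup>2 < 1" "D * r < 1"
    proof -
      show "r * K \<le> a / 2" "D * r < 1" using rs r by (auto simp: algebra_simps)
      have "C' * r\<^sup>2 \<le> C' * r" using r rs(1) C' by (intro mult_left_mono) (auto simp: power2_eq_square mult_left_le)
      then show "C' * r\<^sup>2 < 1" using rs r by (simp add: algebra_simps)
    qed
    define n where "n w = norm (T u w)" for w
    define q where "q w = iter_deriv 2 w \<phi> u" for w
    \<comment> \<open>By Taylor, the rescaled distance is the norm of
      \<open>T u w + (r / 2) *\<^sub>R q w\<close> up to O(r^2), that is, \<open>n w\<close> plus
      \<open>r\<close> times the inner product of \<open>T u w\<close> and \<open>q w\<close> over
      \<open>2 * n w\<close>. Dividing once more by \<open>n w\<close> gives degree one; since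
      \<open>q\<close> is quadratic and \<open>T u\<close> linear, the result is odd.\<close>
    define c where "c w = T u w \<bullet> q w / (2 * (n w)\<^sup>2)" for w
    have contT: "continuous_on UNIV (\<lambda>w. T u w)"
      using linear_T[OF uU] by (simp add: linear_continuous_on linear_conv_bounded_linear)
    have contq: "continuous_on UNIV q"
      unfolding q_def[abs_def] by (rule continuous_iter_deriv_direction[OF open_U uU Ck])
    have measT [measurable]: "(\<lambda>w. T u w) \<in> borel_measurable borel" and measq [measurable]: "q \<in> borel_measurable borel"
      using contT contq by (auto intro: borel_measurable_continuous_onI)
    have n_ge: "a * norm w \<le> n w" and n_le: "n w \<le> b * norm w" for w
      using a(2)[OF u] b(2)[OF u] by (auto simp: n_def)
    have q_le: "norm (q w) \<le> q\<^sub>1 * (norm w)\<^sup>2" for w using q\<^sub>1(2)[OF u] by (simp add: q_def)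
    have q_hom: "q (t *\<^sub>R w) = t\<^sup>2 *\<^sub>R q w" for t w
      unfolding q_def by (rule iter_deriv_scaleR[OF open_U uU Ck])
    have T_hom: "T u (t *\<^sub>R w) = t *\<^sub>R T u w" for t w by (rule linear_cmul[OF linear_T[OF uU]])
    have n_pos: "n w > 0" if "w \<noteq> 0" for w
      using n_ge[of w] a(1) that by (smt (verit) mult_pos_pos zero_less_norm_iff)
    have Tq: "\<bar>T u w \<bullet> q w\<bar> \<le> n w * (q\<^sub>1 * (norm w)\<^sup>2)" for w
      using Cauchy_Schwarz_ineq2[of "T u w" "q w"] mult_left_mono[OF q_le, of "n w" w] by (simp add: n_def)
    have c_le: "\<bar>c w\<bar> \<le> K * norm w" for w
    proof (cases "w = 0")
      case True
      then show ?thesis using linear_0[OF linear_T[OF uU]] by (simp add: c_def)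
    next
      case False
      have "\<bar>c w\<bar> \<le> n w * (q\<^sub>1 * (norm w)\<^sup>2) / (2 * (n w)\<^sup>2)"
        using Tq[of w] by (simp add: c_def abs_divide divide_right_mono)
      also have "\<dots> = q\<^sub>1 * (norm w)\<^sup>2 / (2 * n w)" using n_pos[OF False] by (simp add: power2_eq_square)
      also have "\<dots> \<le> q\<^sub>1 * (norm w)\<^sup>2 / (2 * (a * norm w))"
        using n_ge[of w] n_pos[OF False] a(1) False q\<^sub>1(1) by (intro divide_left_mono) auto
      also have "\<dots> = K * norm w" using False by (simp add: K_def power2_eq_square)
      finally show ?thesis .
    qed
    interpret pg: perturbed_gauge n c a b K
    proof
      show "n \<in> borel_measurable borel" unfolding n_def[abs_def] by measurable
      then show "c \<in> borel_measurable borel" unfolding c_def[abs_def] by measurable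
      show "n (t *\<^sub>R z) = t * n z" if "t > 0" for t z using that by (simp add: n_def T_hom)
      then show "c (t *\<^sub>R z) = t * c z" if "t > 0" for t z
        using that by (simp add: c_def T_hom q_hom power_mult_distrib)
      show "n (- z) = n z" for z using T_hom[of "-1" z] by (simp add: n_def)
      then show "c (- z) = - c z" for z using T_hom[of "-1" z] q_hom[of "-1" z] by (simp add: c_def)
    qed (use a K n_ge n_le c_le in auto)
    have R_eq: "pg.R = R" and V_eq: "pg.V = V" by (simp_all add: pg.R_def R_def pg.V_def V_def)
    \<comment> \<open>\<open>\<Phi>\<close> is the distance in units of \<open>r\<close>, so that
      the ball becomes \<open>\<Phi> z < 1\<close>. The function \<open>h\<close> is cut off outside
      \<open>U\<close> to be Borel on the whole space.\<close>
    define \<Phi> where "\<Phi> z = norm (\<phi> (u + r *\<^sub>R z) - \<phi> u) / r" for z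
    define h where "h v = indicator U v * (f v * volume_density \<phi> v)" for v
    define A where "A = {v. norm (v - u) \<le> R * r \<and> norm (\<phi> v - \<phi> u) < r}"
    define S where "S = {z. norm z \<le> R \<and> \<Phi> z < 1}"
    have scaled: "norm (r *\<^sub>R z) \<le> \<delta>" if "norm z \<le> R" for z :: "real^'d"
  proof -
    have "r * norm z \<le> r * R" using that r by (intro mult_left_mono) auto
    also have "\<dots> \<le> \<delta>" using rs(5) by (simp only: mult.commute)
    finally show ?thesis using r by simp
  qed
    have in_U: "u + w \<in> U" if "norm w \<le> \<delta>" for w
      using that u sub dist_triangle[of u0 "u + w" u] by (auto simp: dist_norm subset_iff)
    have n0: "T u 0 = 0" using linear_0[OF linear_T[OF uU]] .
    have Phi: "\<bar>\<Phi> z - n z - r * (n z * c z)\<bar> \<le> L * r\<^sup>2" if z: "norm z \<le> R" for z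
    proof (cases "z = 0")
      case True
      then show ?thesis using L by (simp add: \<Phi>_def n_def n0)
    next
      case False
      \<comment> \<open>The second-order Taylor term at \<open>r *\<^sub>R z\<close>, divided by
        \<open>r\<close>.\<close>
      define e where "e = (r / 2) *\<^sub>R q z"
      have nz: "n z > 0" by (rule n_pos[OF False])
      have z3: "norm z ^ 3 \<le> R ^ 3" using z by (intro power_mono) auto
      have "norm (\<phi> (u + r *\<^sub>R z) - (\<phi> u + T u (r *\<^sub>R z) + iter_deriv 2 (r *\<^sub>R z) \<phi> u /\<^sub>R 2)) \<le> C\<^sub>3 * norm (r *\<^sub>R z) ^ 3"
        by (rule C\<^sub>3(2)[OF u scaled[OF z]])
      also have "\<phi> (u + r *\<^sub>R z) - (\<phi> u + T u (r *\<^sub>R z) + iter_deriv 2 (r *\<^sub>R z) \<phi> u /\<^sub>R 2)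
          = (\<phi> (u + r *\<^sub>R z) - \<phi> u) - r *\<^sub>R (T u z + e)"
        using q_hom[of r z] by (simp add: T_hom e_def q_def scaleR_add_right power2_eq_square)
      finally have "\<bar>norm (\<phi> (u + r *\<^sub>R z) - \<phi> u) - norm (r *\<^sub>R (T u z + e))\<bar> \<le> C\<^sub>3 * (r ^ 3 * norm z ^ 3)"
        using norm_triangle_ineq3[of "\<phi> (u + r *\<^sub>R z) - \<phi> u" "r *\<^sub>R (T u z + e)"] r by (simp add: power_mult_distrib)
      also have "\<dots> \<le> C\<^sub>3 * (r ^ 3 * R ^ 3)" using z3 C\<^sub>3(1) r by (intro mult_left_mono) auto
      finally have "\<bar>r * \<Phi> z - r * norm (T u z + e)\<bar> \<le> r * (C\<^sub>3 * R ^ 3 * r\<^sup>2)"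
        using r by (simp add: \<Phi>_def power3_eq_cube power2_eq_square mult_ac)
      then have "r * \<bar>\<Phi> z - norm (T u z + e)\<bar> \<le> r * (C\<^sub>3 * R ^ 3 * r\<^sup>2)"
        using r by (simp add: abs_mult flip: right_diff_distrib)
      then have 1: "\<bar>\<Phi> z - norm (T u z + e)\<bar> \<le> C\<^sub>3 * R ^ 3 * r\<^sup>2" using r by simp
      have "\<bar>norm (T u z + e) - n z - T u z \<bullet> e / n z\<bar> \<le> (norm e)\<^sup>2 / n z"
        unfolding n_def by (rule norm_add_expansion) (use nz in \<open>auto simp: n_def\<close>)
      also have "T u z \<bullet> e / n z = r * (n z * c z)"
        using nz by (simp add: e_def c_def power2_eq_square)
      finally have 2: "\<bar>norm (T u z + e) - n z - r * (n z * c z)\<bar> \<le> (norm e)\<^sup>2 / n z" .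
      have "norm e \<le> r / 2 * (q\<^sub>1 * (norm z)\<^sup>2)" using q_le[of z] r by (simp add: e_def)
      also have "\<dots> \<le> r * (q\<^sub>1 * (norm z)\<^sup>2)" using r q\<^sub>1(1) by (intro mult_right_mono) auto
      finally have "(norm e)\<^sup>2 \<le> (r * (q\<^sub>1 * (norm z)\<^sup>2))\<^sup>2" by (intro power_mono) auto
      then have "(norm e)\<^sup>2 / n z \<le> (r * (q\<^sub>1 * (norm z)\<^sup>2))\<^sup>2 / (a * norm z)"
        using n_ge[of z] a(1) False by (intro frac_le) auto
      also have "\<dots> = q\<^sub>1\<^sup>2 * norm z ^ 3 / a * r\<^sup>2"
        using False a(1) by (simp add: power_mult_distrib field_simps power2_eq_square power3_eq_cube)
      also have "\<dots> \<le> q\<^sub>1\<^sup>2 * R ^ 3 / a * r\<^sup>2"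
        using z3 a(1) by (intro mult_right_mono divide_right_mono mult_left_mono) auto
      finally have "\<bar>\<Phi> z - n z - r * (n z * c z)\<bar> \<le> (C\<^sub>3 * R ^ 3 + q\<^sub>1\<^sup>2 * R ^ 3 / a) * r\<^sup>2"
        using 1 2 by (simp add: distrib_right)
      also have "\<dots> \<le> L * r\<^sup>2" using L1 by (rule mult_right_mono) simp
      finally show ?thesis .
    qed
    have h_meas [measurable]: "h \<in> borel_measurable borel"
      using borel_measurable_continuous_on_indicator[of U "\<lambda>v. f v * volume_density \<phi> v"]
        open_U Ck_on_imp_continuous_on[OF f] continuous_volume_density
      by (simp add: h_def[abs_def] continuous_on_mult)
    have ball_U: "cball u (R * r) \<subseteq> U"
    proof
      fix v assume "v \<in> cball u (R * r)"
      then have "norm (v - u) \<le> \<delta>" using rs(5) by (simp add: dist_norm norm_minus_commute)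
      then show "v \<in> U" using in_U[of "v - u"] by simp
    qed
    have "A = {v \<in> cball u (R * r). norm (\<phi> v - \<phi> u) < r}"
      by (auto simp: A_def dist_norm norm_minus_commute)
    then have A_meas [measurable]: "A \<in> sets borel" using sublevel_borel[OF compact_cball ball_U] by simp
    have SA: "z \<in> S \<longleftrightarrow> u + r *\<^sub>R z \<in> A" for z
      using r by (simp add: S_def A_def \<Phi>_def mult.commute[of R])
    then have S_eq: "S = (\<lambda>z. u + r *\<^sub>R z) -` A" by auto
    have S_meas: "S \<in> sets borel"
    proof -
      have "(\<lambda>z. u + r *\<^sub>R z) \<in> borel_measurable borel" by measurable
      from measurable_sets[OF this A_meas] show ?thesis by (simp add: S_eq)
    qed
    have H0: "\<bar>f u * volume_density \<phi> u\<bar> \<le> L"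
    proof -
      have "\<bar>f u * volume_density \<phi> u\<bar> \<le> C\<^sub>h * 1" using C\<^sub>h(2)[OF u] \<delta> by simp
      also have "\<dots> \<le> C\<^sub>h * (1 + R + R\<^sup>2)" using R C\<^sub>h(1) by (intro mult_left_mono) auto
      finally show ?thesis using L2 by simp
    qed
    have h_in: "h (u + r *\<^sub>R z) = f (u + r *\<^sub>R z) * volume_density \<phi> (u + r *\<^sub>R z)"
      "h (u - r *\<^sub>R z) = f (u - r *\<^sub>R z) * volume_density \<phi> (u - r *\<^sub>R z)" if "norm z \<le> R" for z
      using in_U[OF scaled[OF that]] in_U[of "- (r *\<^sub>R z)"] scaled[OF that] by (simp_all add: h_def)
    have H1: "\<bar>h (u + r *\<^sub>R z) - f u * volume_density \<phi> u\<bar> \<le> L * r" if z: "norm z \<le> R" for z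
    proof -
      have "\<bar>h (u + r *\<^sub>R z) - f u * volume_density \<phi> u\<bar> \<le> C\<^sub>h * norm (r *\<^sub>R z)"
        using C\<^sub>h(3)[OF u scaled[OF z]] by (simp add: h_in[OF z])
      also have "\<dots> \<le> C\<^sub>h * (1 + R + R\<^sup>2) * r"
      proof -
        have "norm z \<le> 1 + R + R\<^sup>2" using z zero_le_power2[of R] by linarith
        then have "C\<^sub>h * norm z * r \<le> C\<^sub>h * (1 + R + R\<^sup>2) * r" using r C\<^sub>h(1) by (intro mult_right_mono mult_left_mono) auto
        then show ?thesis using r by (simp add: mult_ac)
      qed
      also have "\<dots> \<le> L * r" using L2 r by (intro mult_right_mono) auto
      finally show ?thesis .
    qed
    have H2: "\<bar>h (u + r *\<^sub>R z) + h (u + r *\<^sub>R (- z)) - 2 * (f u * volume_density \<phi> u)\<bar> \<le> L * r\<^sup>2" if z: "norm z \<le> R" for z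
    proof -
      have "\<bar>h (u + r *\<^sub>R z) + h (u + r *\<^sub>R (- z)) - 2 * (f u * volume_density \<phi> u)\<bar> \<le> C\<^sub>h * (norm (r *\<^sub>R z))\<^sup>2"
        using C\<^sub>h(4)[OF u scaled[OF z]] by (simp add: h_in[OF z])
      also have "\<dots> \<le> C\<^sub>h * (1 + R + R\<^sup>2) * r\<^sup>2"
      proof -
        have "(norm z)\<^sup>2 \<le> R\<^sup>2" using z by (intro power_mono) auto
        then have "(norm z)\<^sup>2 \<le> 1 + R + R\<^sup>2" using R by linarith
        then have "C\<^sub>h * (norm z)\<^sup>2 * r\<^sup>2 \<le> C\<^sub>h * (1 + R + R\<^sup>2) * r\<^sup>2" using C\<^sub>h(1) by (intro mult_right_mono mult_left_mono) auto
        then show ?thesis by (simp add: power_mult_distrib mult_ac)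
      qed
      also have "\<dots> \<le> L * r\<^sup>2" using L2 by (intro mult_right_mono) auto
      finally show ?thesis .
    qed
    have "\<bar>(\<integral>z. indicator S z * h (u + r *\<^sub>R z) \<partial>lborel) - f u * volume_density \<phi> u * measure lborel {z. n z < 1}\<bar> \<le> C * r\<^sup>2"
    proof -
      have "(\<lambda>z. h (u + r *\<^sub>R z)) \<in> borel_measurable borel" by measurable
      from pg.integral_over_perturbed_ball[unfolded R_eq V_eq, OF r(1) small(1) rs(1) L G_def D_def C'_def
          small(2,3) Phi S_def S_meas this H0 H1 H2]
      show ?thesis unfolding C_def by simp
    qed
    moreover have "volume_density \<phi> u * measure lborel {z. n z < 1} = unit_ball_volume TYPE('d)"
      using ellipsoid_density[OF uU] by (simp add: n_def mult.commute)
    ultimately have bound: "\<bar>(\<integral>z. indicator S z * h (u + r *\<^sub>R z) \<partial>lborel) - unit_ball_volume TYPE('d) * f u\<bar> \<le> C * r\<^sup>2"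
      by (simp add: mult.assoc mult.commute)
    have "(\<integral>v. indicator A v * h v \<partial>lborel)
      = (\<integral>v. indicator A v * h v \<partial>density (distr lborel borel (\<lambda>x. u + r *\<^sub>R x)) (\<lambda>_. ennreal (\<bar>r\<bar> ^ CARD('d))))"
      using lborel_affine[of r u] r by simp
    also have "\<dots> = (\<integral>v. r ^ CARD('d) *\<^sub>R (indicator A v * h v) \<partial>distr lborel borel (\<lambda>x. u + r *\<^sub>R x))"
      using r by (subst integral_density) auto
    also have "\<dots> = (\<integral>z. r ^ CARD('d) *\<^sub>R (indicator A (u + r *\<^sub>R z) * h (u + r *\<^sub>R z)) \<partial>lborel)"
      by (subst integral_distr) auto
    also have "\<dots> = r ^ CARD('d) * (\<integral>z. indicator S z * h (u + r *\<^sub>R z) \<partial>lborel)"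
      by (simp add: S_eq indicator_def)
    finally have "(\<integral>v. indicator A v * h v \<partial>lborel) - unit_ball_volume TYPE('d) * f u * r ^ CARD('d)
      = r ^ CARD('d) * ((\<integral>z. indicator S z * h (u + r *\<^sub>R z) \<partial>lborel) - unit_ball_volume TYPE('d) * f u)"
      by (simp add: algebra_simps)
    then have "\<bar>(\<integral>v. indicator A v * h v \<partial>lborel) - unit_ball_volume TYPE('d) * f u * r ^ CARD('d)\<bar>
      \<le> r ^ CARD('d) * (C * r\<^sup>2)"
      using bound r by (simp add: abs_mult mult_left_mono)
    also have "r ^ CARD('d) * (C * r\<^sup>2) = C * r ^ (CARD('d) + 2)" by (simp only: power_add mult_ac)
    finally show ?thesis using rs(5) unfolding A_def h_def by simp
  qed
  show ?thesis
    using C r\<^sub>0 main unfolding R_def by (intro exI[of _ C] conjI exI[of _ r\<^sub>0]) auto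
qed

end

section \<open>The measure of small balls\<close>

context chart
begin

lemma homeomorphism_inverse: obtains \<psi> where "homeomorphism U (\<phi> ` U) \<phi> \<psi>"
  using lp by (auto simp: local_parametrization_def)

lemma openin_image:
  assumes "open B" "B \<subseteq> U"
  shows "openin (top_of_set M) (\<phi> ` B)"
proof -
  obtain \<psi> where "homeomorphism U (\<phi> ` U) \<phi> \<psi>" by (rule homeomorphism_inverse)
  then have "openin (top_of_set (\<phi> ` U)) (\<phi> ` B)"
    by (rule homeomorphism_imp_open_map) (use assms in \<open>auto intro: open_subset\<close>)
  moreover have "openin (top_of_set M) (\<phi> ` U)" using lp by (simp add: local_parametrization_def)
  ultimately show ?thesis by (rule openin_trans)
qed

lemma image_subset: "\<phi> ` U \<subseteq> M"
  using openin_imp_subset[OF openin_image[OF open_U order_refl]] by simp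

text \<open>\<open>M\<close> might come back close to the centre from outside the chart. Openness of
  the chart image in \<open>M\<close> excludes this at each point, and compactness of a smaller
  image gives one radius for all centres. The bound \<open>2 / a * r\<close> follows because \<phi>
  expands distances by at least \<open>a / 2\<close> near \<open>u0\<close>.\<close>

lemma ball_image:
  assumes u0: "u0 \<in> U"
  obtains \<delta> a \<epsilon> r\<^sub>1 where "\<delta> > 0" "cball u0 (2 * \<delta>) \<subseteq> U"
    "a > 0" "\<And>u w. u \<in> cball u0 \<delta> \<Longrightarrow> a * norm w \<le> norm (T u w)"
    "0 < \<epsilon>" "\<epsilon> \<le> \<delta>" "r\<^sub>1 > 0"
    "\<And>u r. u \<in> cball u0 \<epsilon> \<Longrightarrow> 0 < r \<Longrightarrow> r < r\<^sub>1 \<Longrightarrow>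
      M \<inter> ball (\<phi> u) r = \<phi> ` {v. norm (v - u) \<le> 2 / a * r \<and> norm (\<phi> v - \<phi> u) < r}"
proof -
  obtain e where e: "e > 0" "cball u0 e \<subseteq> U" using open_U u0 open_contains_cball by blast
  define \<delta> where "\<delta> = e / 2"
  have \<delta>: "\<delta> > 0" "cball u0 (2 * \<delta>) \<subseteq> U" using e by (auto simp: \<delta>_def)
  have sub1: "cball u0 \<delta> \<subseteq> U" using \<delta> by (auto simp: subset_iff)
  obtain a where a: "a > 0" "\<And>u w. u \<in> cball u0 \<delta> \<Longrightarrow> a * norm w \<le> norm (T u w)"
    using T_lower_bound[OF sub1] \<delta> by auto
  obtain C where C: "C \<ge> 0" "\<And>u w. u \<in> cball u0 \<delta> \<Longrightarrow> norm w \<le> \<delta> \<Longrightarrow>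
      norm (\<phi> (u + w) - (\<phi> u + T u w)) \<le> C * (norm w)\<^sup>2"
    using Taylor_Ck_on_uniform[OF open_U \<delta>(2) Ck[of 2]] by (auto simp: numeral_2_eq_2)
  \<comment> \<open>So small that the quadratic Taylor remainder takes away at most half of the
    lower bound \<open>a * norm w\<close>.\<close>
  define \<delta>\<^sub>1 where "\<delta>\<^sub>1 = min \<delta> (a / (2 * (C + 1)))"
  have \<delta>\<^sub>1: "\<delta>\<^sub>1 > 0" "\<delta>\<^sub>1 \<le> \<delta>" "C * \<delta>\<^sub>1 \<le> a / 2"
  proof -
    show "\<delta>\<^sub>1 > 0" "\<delta>\<^sub>1 \<le> \<delta>" using \<delta> a C by (auto simp: \<delta>\<^sub>1_def)
    have "C * \<delta>\<^sub>1 \<le> C * (a / (2 * (C + 1)))" using C(1) by (intro mult_left_mono) (auto simp: \<delta>\<^sub>1_def)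
    also have "\<dots> \<le> a / 2" using a(1) C(1) by (simp add: field_simps)
    finally show "C * \<delta>\<^sub>1 \<le> a / 2" .
  qed
  have lower: "a / 2 * norm w \<le> norm (\<phi> (u + w) - \<phi> u)" if u: "u \<in> cball u0 \<delta>" and w: "norm w \<le> \<delta>\<^sub>1" for u w
  proof -
    have "C * norm w * norm w \<le> a / 2 * norm w"
      using mult_left_mono[OF w C(1)] \<delta>\<^sub>1(3) by (intro mult_right_mono) auto
    then have "C * (norm w)\<^sup>2 \<le> a / 2 * norm w" by (simp add: power2_eq_square mult_ac)
    moreover have "norm (T u w) - norm (\<phi> (u + w) - \<phi> u) \<le> norm (\<phi> (u + w) - (\<phi> u + T u w))"
      using norm_triangle_ineq2[of "T u w" "\<phi> (u + w) - \<phi> u"] by (simp add: norm_minus_commute algebra_simps)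
    ultimately show ?thesis using C(2)[OF u, of w] w \<delta>\<^sub>1(2) a(2)[OF u, of w] by simp
  qed
  \<comment> \<open>The centre \<open>u\<close> is within a quarter and the preimage
    \<open>v\<close> within half of \<open>\<delta>\<^sub>1\<close> from \<open>u0\<close>, so
    \<open>lower\<close> applies to \<open>v - u\<close>.\<close>
  define \<epsilon> where "\<epsilon> = \<delta>\<^sub>1 / 4"
  have \<epsilon>: "0 < \<epsilon>" "\<epsilon> \<le> \<delta>" using \<delta>\<^sub>1 by (auto simp: \<epsilon>_def)
  have ball_U: "ball u0 (\<delta>\<^sub>1 / 2) \<subseteq> U" using sub1 \<delta>\<^sub>1 by (auto simp: subset_iff)
  have "openin (top_of_set M) (\<phi> ` ball u0 (\<delta>\<^sub>1 / 2))" by (rule openin_image[OF open_ball ball_U])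
  then obtain B where B: "open B" "\<phi> ` ball u0 (\<delta>\<^sub>1 / 2) = M \<inter> B" by (auto simp: openin_open)
  have eU: "cball u0 \<epsilon> \<subseteq> U" using sub1 \<epsilon> by (auto simp: subset_iff)
  have "compact (\<phi> ` cball u0 \<epsilon>)"
    using continuous_on_subset[OF continuous eU] by (intro compact_continuous_image) auto
  moreover have "\<phi> ` cball u0 \<epsilon> \<subseteq> B"
  proof -
    have "cball u0 \<epsilon> \<subseteq> ball u0 (\<delta>\<^sub>1 / 2)" using \<delta>\<^sub>1 by (auto simp: \<epsilon>_def)
    then show ?thesis using B(2) by blast
  qed
  ultimately obtain \<eta> where \<eta>: "\<eta> > 0" "(\<Union>x\<in>\<phi> ` cball u0 \<epsilon>. ball x \<eta>) \<subseteq> B"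
    using compact_subset_open_imp_ball_epsilon_subset[OF _ B(1)] by blast
  \<comment> \<open>The second entry gives \<open>2 / a * r \<le> \<delta>\<close>, which keeps the
    parameter set on the right inside \<open>U\<close>.\<close>
  define r\<^sub>1 where "r\<^sub>1 = min \<eta> (a / 2 * \<delta>)"
  have r\<^sub>1: "r\<^sub>1 > 0" using \<eta> a \<delta> by (simp add: r\<^sub>1_def)
  have "M \<inter> ball (\<phi> u) r = \<phi> ` {v. norm (v - u) \<le> 2 / a * r \<and> norm (\<phi> v - \<phi> u) < r}"
    if u: "u \<in> cball u0 \<epsilon>" and r: "0 < r" "r < r\<^sub>1" for u r
  proof (intro equalityI subsetI)
    have u': "u \<in> cball u0 \<delta>" using u \<epsilon> by auto
    fix y assume y: "y \<in> M \<inter> ball (\<phi> u) r"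
    then have "y \<in> ball (\<phi> u) \<eta>" using r by (auto simp: r\<^sub>1_def)
    then have "y \<in> B" using \<eta>(2) u by blast
    then have "y \<in> \<phi> ` ball u0 (\<delta>\<^sub>1 / 2)" using y unfolding B(2) by simp
    then obtain v where v: "v \<in> ball u0 (\<delta>\<^sub>1 / 2)" "y = \<phi> v" by blast
    have "norm (v - u) \<le> \<delta>\<^sub>1"
      using v(1) u dist_triangle[of v u u0] \<delta>\<^sub>1 by (auto simp: \<epsilon>_def dist_norm norm_minus_commute)
    from lower[OF u' this] have "a / 2 * norm (v - u) \<le> norm (\<phi> v - \<phi> u)" by simp
    also have "norm (\<phi> v - \<phi> u) < r" using y v by (simp add: dist_norm norm_minus_commute)
    finally have "norm (v - u) \<le> 2 / a * r" using a(1) by (simp add: field_simps)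
    then show "y \<in> \<phi> ` {v. norm (v - u) \<le> 2 / a * r \<and> norm (\<phi> v - \<phi> u) < r}"
      using \<open>norm (\<phi> v - \<phi> u) < r\<close> v by blast
  next
    fix y assume "y \<in> \<phi> ` {v. norm (v - u) \<le> 2 / a * r \<and> norm (\<phi> v - \<phi> u) < r}"
    then obtain v where v: "norm (v - u) \<le> 2 / a * r" "norm (\<phi> v - \<phi> u) < r" "y = \<phi> v" by auto
    have "2 / a * r \<le> \<delta>" using r a by (simp add: r\<^sub>1_def field_simps)
    then have "norm (v - u) \<le> \<delta>" using v by simp
    then have "v \<in> cball u0 (2 * \<delta>)"
      using u \<epsilon> dist_triangle[of u0 v u] by (auto simp: dist_norm norm_minus_commute)
    then have "v \<in> U" using \<delta> by auto
    then show "y \<in> M \<inter> ball (\<phi> u) r" using image_subset v by (auto simp: dist_norm norm_minus_commute)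
  qed
  then show ?thesis using that[OF \<delta> a \<epsilon> r\<^sub>1] by blast
qed

lemma borel_preimage:
  assumes "A \<in> sets borel" "A \<subseteq> U" "B \<in> sets borel"
  shows "{v \<in> A. \<phi> v \<in> B} \<in> sets borel"
proof -
  have "\<phi> \<in> borel_measurable (restrict_space borel A)"
    using continuous_on_subset[OF continuous assms(2)] by (rule borel_measurable_continuous_on_restrict)
  from measurable_sets[OF this assms(3)] have "\<phi> -` B \<inter> A \<in> sets (restrict_space borel A)"
    by (simp add: space_restrict_space)
  moreover have "{v \<in> A. \<phi> v \<in> B} = \<phi> -` B \<inter> A" by auto
  ultimately show ?thesis using assms(1) by (simp add: sets_restrict_space_iff)
qed

text \<open>The image is a preimage under the continuous inverse of \<phi>; the image of
  \<open>U\<close> itself is Borel as the intersection of the compact \<open>M\<close> with an open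
  set.\<close>

lemma borel_image:
  assumes M: "compact M" and A: "A \<in> sets borel" "A \<subseteq> U"
  shows "\<phi> ` A \<in> sets borel"
proof -
  obtain \<psi> where h: "homeomorphism U (\<phi> ` U) \<phi> \<psi>" by (rule homeomorphism_inverse)
  obtain B where "open B" "\<phi> ` U = M \<inter> B" using openin_image[OF open_U order_refl] by (auto simp: openin_open)
  then have U: "\<phi> ` U \<in> sets borel" using M by (auto intro: borel_compact)
  have "\<psi> \<in> borel_measurable (restrict_space borel (\<phi> ` U))"
    using h by (intro borel_measurable_continuous_on_restrict) (auto simp: homeomorphism_def)
  from measurable_sets[OF this A(1)] have "\<psi> -` A \<inter> \<phi> ` U \<in> sets (restrict_space borel (\<phi> ` U))"
    by (simp add: space_restrict_space)
  moreover have "\<phi> ` A = \<psi> -` A \<inter> \<phi> ` U" using h A(2) by (force simp: homeomorphism_def)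
  ultimately show ?thesis using U by (simp add: sets_restrict_space_iff)
qed

text \<open>\<open>riemannian_volume\<close> speaks only of volumes of images. Applied to all Borel
  parts of \<open>A\<close>, it identifies the volume on the image with a pushforward measure,
  against which \<open>f\<close> can be integrated.\<close>

lemma measure_image:
  fixes f :: "real^'n \<Rightarrow> real"
  assumes M: "compact M" "M \<noteq> {}" and V: "riemannian_volume TYPE('d) M V"
    and f [measurable]: "f \<in> borel_measurable V" and f0: "\<And>x. x \<in> M \<Longrightarrow> f x \<ge> 0"
    and A: "A \<in> sets borel" "A \<subseteq> U"
  shows "measure (density V (\<lambda>x. ennreal (f x))) (\<phi> ` A)
    = (\<integral>v. indicator A v * (indicator U v * (f (\<phi> v) * volume_density \<phi> v)) \<partial>lborel)"
proof -
  obtain x\<^sub>0 where x\<^sub>0: "x\<^sub>0 \<in> M" using M by auto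
  \<comment> \<open>A total map into \<open>M\<close> is needed for a pushforward. Its value off
    \<open>U\<close> is arbitrary, as the density \<open>J\<close> vanishes there.\<close>
  define \<phi>' where "\<phi>' v = (if v \<in> U then \<phi> v else x\<^sub>0)" for v
  define J where "J v = indicator U v * volume_density \<phi> v" for v
  have sV: "B \<in> sets V \<longleftrightarrow> B \<in> sets borel \<and> B \<subseteq> M" for B
    using V M by (auto simp: riemannian_volume_def sets_restrict_space_iff borel_compact)
  have spV: "space V = M" using V by (simp add: riemannian_volume_def)
  have U_borel: "U \<in> sets borel" using open_U by simp
  have J_meas [measurable]: "J \<in> borel_measurable borel"
    using borel_measurable_continuous_on_indicator[OF U_borel continuous_volume_density] by (simp add: J_def[abs_def])
  have \<phi>_meas [measurable]: "\<phi>' \<in> borel \<rightarrow>\<^sub>M V"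
  proof (rule measurableI)
    show "\<phi>' v \<in> space V" for v using image_subset x\<^sub>0 by (auto simp: \<phi>'_def spV)
    fix B assume "B \<in> sets V"
    then have "{v \<in> U. \<phi> v \<in> B} \<in> sets borel" using borel_preimage[OF U_borel] sV by blast
    moreover have "\<phi>' -` B \<inter> space borel = {v \<in> U. \<phi> v \<in> B} \<union> (if x\<^sub>0 \<in> B then - U else {})"
      by (auto simp: \<phi>'_def split: if_splits)
    ultimately show "\<phi>' -` B \<inter> space borel \<in> sets borel" using U_borel by auto
  qed
  have A_meas [measurable]: "A \<in> sets lborel" using A by simp
  have im: "\<phi> ` A \<in> sets V" using borel_image[OF M(1) A] image_subset A by (auto simp: sV)
  note [measurable] = im
  have eq: "density V (indicator (\<phi> ` A)) = distr (density lborel (\<lambda>v. indicator A v * ennreal (J v))) V \<phi>'"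
  proof (rule measure_eqI)
    fix B assume "B \<in> sets (density V (indicator (\<phi> ` A)))"
    then have B: "B \<in> sets V" by simp
    let ?A = "{v \<in> A. \<phi> v \<in> B}"
    have A': "?A \<in> sets borel" "?A \<subseteq> U" using borel_preimage[OF A] B A by (auto simp: sV)
    have pre: "\<phi>' -` B \<inter> space borel \<in> sets borel" using measurable_sets[OF \<phi>_meas B] .
    have "emeasure (density V (indicator (\<phi> ` A))) B = emeasure V (\<phi> ` A \<inter> B)"
      using B im by (simp add: emeasure_density indicator_inter_arith[symmetric] nn_integral_indicator)
    also have "\<phi> ` A \<inter> B = \<phi> ` ?A" by auto
    also have "emeasure V (\<phi> ` ?A) = (\<integral>\<^sup>+v\<in>?A. ennreal (volume_density \<phi> v) \<partial>lborel)"
      using V lp A' unfolding riemannian_volume_def volume_density_def by blast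
    also have "\<dots> = (\<integral>\<^sup>+v. (indicator A v * ennreal (J v)) * indicator (\<phi>' -` B) v \<partial>lborel)"
      using A(2) by (intro nn_integral_cong) (auto simp: J_def \<phi>'_def indicator_def)
    also have "\<dots> = emeasure (density lborel (\<lambda>v. indicator A v * ennreal (J v))) (\<phi>' -` B)"
      using pre by (subst emeasure_density) auto
    also have "\<dots> = emeasure (distr (density lborel (\<lambda>v. indicator A v * ennreal (J v))) V \<phi>') B"
      using B by (subst emeasure_distr) auto
    finally show "emeasure (density V (indicator (\<phi> ` A))) B
      = emeasure (distr (density lborel (\<lambda>v. indicator A v * ennreal (J v))) V \<phi>') B" .
  qed simp
  have "emeasure (density V (\<lambda>x. ennreal (f x))) (\<phi> ` A) = (\<integral>\<^sup>+x. indicator (\<phi> ` A) x * ennreal (f x) \<partial>V)"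
    using im by (subst emeasure_density) (auto simp: mult.commute)
  also have "\<dots> = (\<integral>\<^sup>+x. ennreal (f x) \<partial>density V (indicator (\<phi> ` A)))"
    by (subst nn_integral_density) auto
  also have "\<dots> = (\<integral>\<^sup>+v. indicator A v * ennreal (J v) * ennreal (f (\<phi>' v)) \<partial>lborel)"
    unfolding eq by (subst nn_integral_distr) (auto simp: nn_integral_density)
  also have "\<dots> = (\<integral>\<^sup>+v. ennreal (indicator A v * (J v * f (\<phi>' v))) \<partial>lborel)"
    by (intro nn_integral_cong) (auto simp: indicator_def J_def ennreal_mult'' f0 \<phi>'_def image_subset[THEN subsetD])
  finally have "measure (density V (\<lambda>x. ennreal (f x))) (\<phi> ` A)
      = enn2real (\<integral>\<^sup>+v. ennreal (indicator A v * (J v * f (\<phi>' v))) \<partial>lborel)" by (simp add: measure_def)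
  also have "\<dots> = (\<integral>v. indicator A v * (J v * f (\<phi>' v)) \<partial>lborel)"
  proof (rule integral_eq_nn_integral[symmetric])
    have "J v * f (\<phi>' v) \<ge> 0" for v
      using f0[of "\<phi> v"] image_subset det_metric_pos[of v]
      by (auto simp: J_def \<phi>'_def indicator_def volume_density_def image_subset_iff intro!: mult_nonneg_nonneg dest: less_imp_le)
    then show "AE v in lborel. 0 \<le> indicator A v * (J v * f (\<phi>' v))" by (auto simp: indicator_def)
  qed measurable
  also have "\<dots> = (\<integral>v. indicator A v * (indicator U v * (f (\<phi> v) * volume_density \<phi> v)) \<partial>lborel)"
    by (intro Bochner_Integration.integral_cong) (auto simp: indicator_def J_def \<phi>'_def)
  finally show ?thesis .
qed

end

text \<open>In a chart, \<open>f\<close> is the composition of its smooth coordinate expression with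
  the continuous inverse of \<phi>. The chart image is open in \<open>M\<close>, so continuity there
  is continuity within \<open>M\<close>.\<close>

lemma continuous_on_smooth_on_submanifold:
  assumes "smooth_submanifold TYPE('d::finite) M" "smooth_on_submanifold TYPE('d) M f"
  shows "continuous_on M f"
  unfolding continuous_on_eq_continuous_within
proof
  fix x assume x: "x \<in> M"
  obtain U :: "(real^'d) set" and \<phi> where lp: "local_parametrization M U \<phi>" and xU: "x \<in> \<phi> ` U"
    using assms(1) x unfolding smooth_submanifold_def by blast
  interpret chart M U \<phi> by standard (rule lp)
  obtain \<psi> where h: "homeomorphism U (\<phi> ` U) \<phi> \<psi>" by (rule homeomorphism_inverse)
  have "smooth_on U (f \<circ> \<phi>)" using assms(2) lp by (simp add: smooth_on_submanifold_def)
  then have "continuous_on U (f \<circ> \<phi>)" using Ck_on.simps(1) unfolding smooth_on_def by blast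
  then have "continuous_on (\<phi> ` U) (\<lambda>y. (f \<circ> \<phi>) (\<psi> y))"
    using h by (intro continuous_on_compose2[of U "f \<circ> \<phi>" "\<phi> ` U" \<psi>]) (auto simp: homeomorphism_def)
  then have "continuous_on (\<phi> ` U) f"
    by (rule continuous_on_eq) (use h in \<open>auto simp: homeomorphism_def\<close>)
  then have "continuous (at x within \<phi> ` U) f" using xU continuous_on_eq_continuous_within by blast
  moreover obtain B where B: "open B" "\<phi> ` U = M \<inter> B"
    using openin_image[OF open_U order_refl] by (auto simp: openin_open)
  have "at x within \<phi> ` U = at x within M"
    using B xU by (intro at_within_nhd[of x B]) auto
  ultimately show "continuous (at x within M) f" by simp
qed

text \<open>Each point has a chart neighbourhood with its own constants. A finite subcover allows
  the sum of the \<open>C x\<close> and the minimum of the radii to serve on all of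
  \<open>M\<close>.\<close>

lemma ball_measure_expansion:
  fixes M :: "(real^'n) set" and p :: "real^'n \<Rightarrow> real"
  assumes M: "compact M" "M \<noteq> {}" and sm: "smooth_submanifold TYPE('d::finite) M"
    and V: "riemannian_volume TYPE('d) M V" and p: "smooth_on_submanifold TYPE('d) M p"
    and p0: "\<And>x. x \<in> M \<Longrightarrow> p x \<ge> 0"
  shows "\<exists>C\<ge>0. \<exists>r\<^sub>0>0. \<forall>x\<in>M. \<forall>r. 0 < r \<longrightarrow> r < r\<^sub>0 \<longrightarrow>
    \<bar>measure (density V (\<lambda>x. ennreal (p x))) (M \<inter> ball x r) - unit_ball_volume TYPE('d) * p x * r ^ CARD('d)\<bar>
      \<le> C * r ^ (CARD('d) + 2)"
proof -
  let ?ok = "\<lambda>C x r. \<bar>measure (density V (\<lambda>x. ennreal (p x))) (M \<inter> ball x r)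
      - unit_ball_volume TYPE('d) * p x * r ^ CARD('d)\<bar> \<le> C * r ^ (CARD('d) + 2)"
  have "continuous_on M p" by (rule continuous_on_smooth_on_submanifold[OF sm p])
  then have "p \<in> borel_measurable (restrict_space borel M)" by (rule borel_measurable_continuous_on_restrict)
  moreover have "sets V = sets (restrict_space borel M)" using V by (simp add: riemannian_volume_def)
  ultimately have p_meas: "p \<in> borel_measurable V" by (simp cong: measurable_cong_sets)
  have local: "\<exists>B C r\<^sub>0. open B \<and> x \<in> B \<and> C \<ge> 0 \<and> r\<^sub>0 > 0 \<and> (\<forall>y\<in>M \<inter> B. \<forall>r. 0 < r \<longrightarrow> r < r\<^sub>0 \<longrightarrow> ?ok C y r)"
    if x: "x \<in> M" for x
  proof -
    obtain U :: "(real^'d) set" and \<phi> where lp: "local_parametrization M U \<phi>" and xU: "x \<in> \<phi> ` U"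
      using sm x unfolding smooth_submanifold_def by blast
    interpret chart M U \<phi> by standard (rule lp)
    have Ckp: "Ck_on 2 U (p \<circ> \<phi>)" using p lp by (simp add: smooth_on_submanifold_def smooth_on_def)
    obtain u0 where u0: "u0 \<in> U" "x = \<phi> u0" using xU by auto
    obtain \<delta> a \<epsilon> r\<^sub>1 where \<delta>: "\<delta> > 0" "cball u0 (2 * \<delta>) \<subseteq> U"
      and a: "a > 0" "\<And>u w. u \<in> cball u0 \<delta> \<Longrightarrow> a * norm w \<le> norm (T u w)"
      and \<epsilon>: "0 < \<epsilon>" "\<epsilon> \<le> \<delta>" and r\<^sub>1: "r\<^sub>1 > 0"
      and im: "\<And>u r. u \<in> cball u0 \<epsilon> \<Longrightarrow> 0 < r \<Longrightarrow> r < r\<^sub>1 \<Longrightarrow>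
        M \<inter> ball (\<phi> u) r = \<phi> ` {v. norm (v - u) \<le> 2 / a * r \<and> norm (\<phi> v - \<phi> u) < r}"
      using ball_image[OF u0(1)] by blast
    obtain C r\<^sub>0 where C: "C \<ge> 0" "r\<^sub>0 > 0" and exp: "\<And>u r. u \<in> cball u0 \<delta> \<Longrightarrow> 0 < r \<Longrightarrow> r < r\<^sub>0 \<Longrightarrow>
      2 / a * r \<le> \<delta> \<and> \<bar>(\<integral>v. indicator {v. norm (v - u) \<le> 2 / a * r \<and> norm (\<phi> v - \<phi> u) < r} v *
          (indicator U v * ((p \<circ> \<phi>) v * volume_density \<phi> v)) \<partial>lborel)
      - unit_ball_volume TYPE('d) * (p \<circ> \<phi>) u * r ^ CARD('d)\<bar> \<le> C * r ^ (CARD('d) + 2)"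
      using chart_integral_expansion[OF \<delta>(2,1) a Ckp] by blast
    have sub: "ball u0 \<epsilon> \<subseteq> U" using \<delta> \<epsilon> by (auto simp: subset_iff)
    obtain B where B: "open B" "\<phi> ` ball u0 \<epsilon> = M \<inter> B"
      using openin_image[OF open_ball sub] by (auto simp: openin_open)
    have "x \<in> B" using B(2) u0 \<epsilon> by (metis IntD2 centre_in_ball imageI)
    moreover have "?ok C y r" if y: "y \<in> M \<inter> B" and r: "0 < r" "r < min r\<^sub>0 r\<^sub>1" for y r
    proof -
      obtain u where u: "u \<in> ball u0 \<epsilon>" "y = \<phi> u" using B(2) y by blast
      have u1: "u \<in> cball u0 \<epsilon>" and u2: "u \<in> cball u0 \<delta>" using u \<epsilon> by auto
      let ?A = "{v. norm (v - u) \<le> 2 / a * r \<and> norm (\<phi> v - \<phi> u) < r}"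
      have e: "2 / a * r \<le> \<delta>" using exp[OF u2] r by simp
      have cU: "cball u (2 / a * r) \<subseteq> U"
      proof
        fix v assume "v \<in> cball u (2 / a * r)"
        then have "v \<in> cball u0 (2 * \<delta>)" using u2 e dist_triangle[of u0 v u] by simp
        then show "v \<in> U" using \<delta> by auto
      qed
      have A_eq: "?A = {v \<in> cball u (2 / a * r). norm (\<phi> v - \<phi> u) < r}"
        by (auto simp: dist_norm norm_minus_commute)
      have A: "?A \<in> sets borel" "?A \<subseteq> U"
        unfolding A_eq using sublevel_borel[OF compact_cball cU] cU by auto
      show ?thesis
        using exp[OF u2 r(1)] r im[OF u1 r(1)] measure_image[OF M V p_meas p0 A] by (simp add: u(2))
    qed
    ultimately show ?thesis using B(1) C r\<^sub>1 by (intro exI[of _ B] exI[of _ C] exI[of _ "min r\<^sub>0 r\<^sub>1"]) auto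
  qed
  then obtain B C r\<^sub>0 where B: "\<And>x. x \<in> M \<Longrightarrow> open (B x) \<and> x \<in> B x \<and> C x \<ge> 0 \<and> r\<^sub>0 x > 0
      \<and> (\<forall>y\<in>M \<inter> B x. \<forall>r. 0 < r \<longrightarrow> r < r\<^sub>0 x \<longrightarrow> ?ok (C x) y r)"
    by metis
  obtain F where F: "F \<subseteq> M" "finite F" "M \<subseteq> (\<Union>x\<in>F. B x)"
    using compactE_image[OF M(1), of M B] B by blast
  have F0: "F \<noteq> {}" using F M by auto
  define C' where "C' = (\<Sum>x\<in>F. C x)"
  define r' where "r' = Min (r\<^sub>0 ` F)"
  have "C' \<ge> 0" unfolding C'_def using B F by (intro sum_nonneg) auto
  moreover have "r' > 0" unfolding r'_def using F F0 B by (subst Min_gr_iff) auto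
  moreover have "?ok C' y r" if y: "y \<in> M" and r: "0 < r" "r < r'" for y r
  proof -
    obtain x where x: "x \<in> F" "y \<in> B x" using F y by auto
    have "r < r\<^sub>0 x" using r x F unfolding r'_def by (subst (asm) Min_gr_iff) auto
    then have "?ok (C x) y r" using B[of x] x y r F by blast
    moreover have "C x \<le> C'" unfolding C'_def using F B x by (intro member_le_sum) auto
    then have "C x * r ^ (CARD('d) + 2) \<le> C' * r ^ (CARD('d) + 2)" using r by (intro mult_right_mono) auto
    ultimately show ?thesis by linarith
  qed
  ultimately show ?thesis by blast
qed

section \<open>Counting samples\<close>

text \<open>\<open>(1 - x + x\<^sup>2) * (1 + x)\<close> equals \<open>1 + x ^ 3\<close>, and
  \<open>1 + x\<close> is at most \<open>exp x\<close>.\<close>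

lemma exp_minus_le_quadratic:
  fixes x :: real
  assumes "0 \<le> x"
  shows "exp (- x) \<le> 1 - x + x\<^sup>2"
proof -
  have "1 \<le> (1 - x + x\<^sup>2) * (1 + x)" using assms by (simp add: algebra_simps power2_eq_square)
  also have "\<dots> \<le> (1 - x + x\<^sup>2) * exp x"
  proof (rule mult_left_mono)
    have "1 - x + x\<^sup>2 = (x - 1/2)\<^sup>2 + 3/4" by (simp add: power2_eq_square algebra_simps)
    then show "0 \<le> 1 - x + x\<^sup>2" by simp
  qed simp
  finally show ?thesis by (simp add: exp_minus field_simps)
qed

section \<open>Chernoff bounds for counts of independent samples, and nets\<close>

context prob_space
begin

text \<open>Independence factorises the expectation, and \<open>1 + s \<le> exp s\<close> bounds
  each factor. The sign of \<open>l\<close> is left open so that both tails can use it.\<close>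

lemma mgf_count:
  assumes B [measurable]: "B \<in> sets M" and that: "finite I"
  shows "(\<integral>\<^sup>+y. ennreal (exp (l * (\<Sum>j\<in>I. of_bool (y j \<in> B)))) \<partial>(\<Pi>\<^sub>M j\<in>I. M))
    \<le> ennreal (exp (real (card I) * prob B * (exp l - 1)))"
proof -
  interpret product_sigma_finite "\<lambda>_. M" by standard
  have one: "(\<integral>\<^sup>+x. ennreal (exp (l * of_bool (x \<in> B))) \<partial>M) = ennreal (1 + (exp l - 1) * prob B)"
  proof -
    have eq: "exp (l * of_bool (x \<in> B)) = 1 + (exp l - 1) * indicator B x" for x by simp
    have "integrable M (\<lambda>x. 1 + (exp l - 1) * indicator B x :: real)"
      using B by (intro Bochner_Integration.integrable_add integrable_mult_right integrable_real_indicator)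
        (auto simp: emeasure_eq_measure)
    then have "(\<integral>\<^sup>+x. ennreal (1 + (exp l - 1) * indicator B x) \<partial>M) = ennreal (\<integral>x. 1 + (exp l - 1) * indicator B x \<partial>M)"
      by (rule nn_integral_eq_integral) (auto simp: indicator_def)
    also have "(\<integral>x. 1 + (exp l - 1) * indicator B x \<partial>M) = 1 + (exp l - 1) * prob B"
      using B by (subst Bochner_Integration.integral_add) (auto simp: emeasure_eq_measure prob_space)
    finally show ?thesis by (simp add: eq)
  qed
  have nonneg: "0 \<le> 1 + (exp l - 1) * prob B"
  proof -
    have "0 \<le> (1 - prob B) + exp l * prob B" by (intro add_nonneg_nonneg mult_nonneg_nonneg) auto
    then show ?thesis by (simp add: algebra_simps)
  qed
  have "(\<integral>\<^sup>+y. ennreal (exp (l * (\<Sum>j\<in>I. of_bool (y j \<in> B)))) \<partial>(\<Pi>\<^sub>M j\<in>I. M))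
    = (\<integral>\<^sup>+y. (\<Prod>j\<in>I. ennreal (exp (l * of_bool (y j \<in> B)))) \<partial>(\<Pi>\<^sub>M j\<in>I. M))"
    by (simp add: sum_distrib_left exp_sum[OF that] prod_ennreal)
  also have "\<dots> = (\<Prod>j\<in>I. \<integral>\<^sup>+x. ennreal (exp (l * of_bool (x \<in> B))) \<partial>M)"
    using that B by (intro product_nn_integral_prod) measurable
  also have "\<dots> = ennreal ((1 + (exp l - 1) * prob B) ^ card I)"
    using nonneg by (simp add: one ennreal_power)
  also have "(1 + (exp l - 1) * prob B) ^ card I \<le> exp ((exp l - 1) * prob B) ^ card I"
    using nonneg exp_ge_add_one_self by (intro power_mono) auto
  also have "\<dots> = exp (real (card I) * prob B * (exp l - 1))"
    by (simp add: exp_of_nat_mult[symmetric] mult_ac)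
  finally show ?thesis by (simp add: ennreal_leI)
qed

text \<open>Markov's inequality for the exponential moment. Writing the event with the factor
  \<open>l\<close> makes it an upper tail for positive and a lower tail for negative
  \<open>l\<close>.\<close>

lemma chernoff_count:
  assumes B [measurable]: "B \<in> sets M" and "finite I"
  shows "measure (\<Pi>\<^sub>M j\<in>I. M) {y \<in> space (\<Pi>\<^sub>M j\<in>I. M). l * t \<le> l * (\<Sum>j\<in>I. of_bool (y j \<in> B))}
    \<le> exp (real (card I) * prob B * (exp l - 1) - l * t)"
proof -
  let ?S = "\<Pi>\<^sub>M j\<in>I. M"
  have pm: "(\<lambda>y. \<Sum>j\<in>I. of_bool (y j \<in> B) :: real) \<in> borel_measurable ?S"
    using B by measurable
  have "emeasure ?S {y \<in> space ?S. l * t \<le> l * (\<Sum>j\<in>I. of_bool (y j \<in> B))}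
    = (\<integral>\<^sup>+y. indicator {y \<in> space ?S. l * t \<le> l * (\<Sum>j\<in>I. of_bool (y j \<in> B))} y \<partial>?S)"
    by (subst nn_integral_indicator) auto
  also have "\<dots> \<le> (\<integral>\<^sup>+y. ennreal (exp (- (l * t))) * ennreal (exp (l * (\<Sum>j\<in>I. of_bool (y j \<in> B)))) \<partial>?S)"
    by (intro nn_integral_mono) (auto simp: indicator_def ennreal_mult[symmetric] mult_exp_exp)
  also have "\<dots> = ennreal (exp (- (l * t))) * (\<integral>\<^sup>+y. ennreal (exp (l * (\<Sum>j\<in>I. of_bool (y j \<in> B)))) \<partial>?S)"
    using pm by (intro nn_integral_cmult) measurable
  also have "\<dots> \<le> ennreal (exp (- (l * t))) * ennreal (exp (real (card I) * prob B * (exp l - 1)))"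
    by (intro mult_left_mono mgf_count assms) simp
  also have "\<dots> = ennreal (exp (real (card I) * prob B * (exp l - 1) - l * t))"
    by (simp add: ennreal_mult[symmetric] mult_exp_exp add.commute)
  finally show ?thesis unfolding measure_def by (simp add: enn2real_leI)
qed

text \<open>Here and in \<open>count_lower_tail\<close> the threshold \<open>t\<close> is fixed and
  the mean varies: later \<open>t\<close> is \<open>k\<close>, while the two radii change the ball
  mass. Both tails then have the same exponent.\<close>

lemma count_upper_tail:
  assumes B [measurable]: "B \<in> sets M" and "finite I" and d: "0 < d" "d \<le> 1"
    and m: "real (card I) * prob B \<le> t / (1 + d)" and t: "t \<ge> 0"
  shows "measure (\<Pi>\<^sub>M j\<in>I. M) {y \<in> space (\<Pi>\<^sub>M j\<in>I. M). t \<le> (\<Sum>j\<in>I. of_bool (y j \<in> B))}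
    \<le> exp (- (t * d\<^sup>2 / (4 * (1 + d))))"
proof -
  \<comment> \<open>Minimises \<open>t / (1 + d) * (l + l\<^sup>2) - l * t\<close>, the exponent
    after a quadratic bound on \<open>exp l - 1\<close>.\<close>
  let ?l = "d / 2"
  have "exp ?l - 1 \<le> ?l + ?l\<^sup>2" using exp_bound[of ?l] d by simp
  then have "real (card I) * prob B * (exp ?l - 1) \<le> t / (1 + d) * (?l + ?l\<^sup>2)"
    using m t d by (intro mult_mono) auto
  also have "t / (1 + d) * (?l + ?l\<^sup>2) - ?l * t = - (t * d\<^sup>2 / (4 * (1 + d)))"
    using d by (simp add: field_simps power2_eq_square)
  finally have "real (card I) * prob B * (exp ?l - 1) - ?l * t \<le> - (t * d\<^sup>2 / (4 * (1 + d)))" by simp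
  moreover have "measure (\<Pi>\<^sub>M j\<in>I. M) {y \<in> space (\<Pi>\<^sub>M j\<in>I. M). ?l * t \<le> ?l * (\<Sum>j\<in>I. of_bool (y j \<in> B))}
    \<le> exp (real (card I) * prob B * (exp ?l - 1) - ?l * t)" by (rule chernoff_count) fact+
  ultimately show ?thesis using d(1) by (simp add: order_trans[OF _ exp_le_cancel_iff[THEN iffD2]])
qed

lemma count_lower_tail:
  assumes B [measurable]: "B \<in> sets M" and "finite I" and d: "0 < d" "d \<le> 1"
    and m: "real (card I) * prob B \<ge> t * (1 + d)" and t: "t \<ge> 0"
  shows "measure (\<Pi>\<^sub>M j\<in>I. M) {y \<in> space (\<Pi>\<^sub>M j\<in>I. M). (\<Sum>j\<in>I. of_bool (y j \<in> B)) \<le> t}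
    \<le> exp (- (t * d\<^sup>2 / (4 * (1 + d))))"
proof -
  \<comment> \<open>Minimises \<open>t * (1 + d) * (- l + l\<^sup>2) + l * t\<close>, the
    corresponding exponent for the parameter \<open>- l\<close>.\<close>
  let ?l = "d / (2 * (1 + d))"
  have l: "?l > 0" "?l \<le> 1" using d by auto
  have e: "exp (- ?l) - 1 \<le> - ?l + ?l\<^sup>2" using exp_minus_le_quadratic[of ?l] l by simp
  have "real (card I) * prob B * (exp (- ?l) - 1) \<le> t * (1 + d) * (exp (- ?l) - 1)"
    using m l by (intro mult_right_mono_neg) auto
  also have "\<dots> \<le> t * (1 + d) * (- ?l + ?l\<^sup>2)" using e t d by (intro mult_left_mono) auto
  also have "t * (1 + d) * (- ?l + ?l\<^sup>2) - (- ?l) * t = - (t * d\<^sup>2 / (4 * (1 + d)))"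
  proof -
    have "t * k * (- (d / (2 * k)) + (d / (2 * k))\<^sup>2) - (- (d / (2 * k))) * t = t * d * (2 + d - 2 * k) / (4 * k)"
      if "k > 0" for k using that by (simp add: field_simps power2_eq_square)
    from this[of "1 + d"] show ?thesis using d by (simp add: power2_eq_square)
  qed
  finally have "real (card I) * prob B * (exp (- ?l) - 1) - (- ?l) * t \<le> - (t * d\<^sup>2 / (4 * (1 + d)))" by simp
  moreover have "measure (\<Pi>\<^sub>M j\<in>I. M) {y \<in> space (\<Pi>\<^sub>M j\<in>I. M). (- ?l) * t \<le> (- ?l) * (\<Sum>j\<in>I. of_bool (y j \<in> B))}
    \<le> exp (real (card I) * prob B * (exp (- ?l) - 1) - (- ?l) * t)" by (rule chernoff_count) fact+
  moreover have "(- ?l) * t \<le> (- ?l) * s \<longleftrightarrow> s \<le> t" for s using l(1) mult_le_cancel_left_neg[of "- ?l" t s] by simp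
  ultimately show ?thesis by (simp only:) (simp add: order_trans[OF _ exp_le_cancel_iff[THEN iffD2]])
qed

text \<open>A maximal \<open>e\<close>-separated set is an \<open>e\<close>-net. Its size is bounded
  by packing with respect to the probability measure itself: disjoint sets of mass at least
  \<open>c\<close>.\<close>

lemma finite_net:
  fixes A :: "'b::metric_space set" and f :: "'b \<Rightarrow> 'a set"
  assumes sets: "\<And>x. x \<in> A \<Longrightarrow> f x \<in> sets M" and c: "c > 0" "\<And>x. x \<in> A \<Longrightarrow> c \<le> prob (f x)"
    and disj: "\<And>x y. x \<in> A \<Longrightarrow> y \<in> A \<Longrightarrow> dist x y \<ge> e \<Longrightarrow> f x \<inter> f y = {}"
    and e: "e > 0"
  obtains Z where "finite Z" "Z \<subseteq> A" "real (card Z) \<le> 1 / c" "\<And>x. x \<in> A \<Longrightarrow> \<exists>z\<in>Z. dist x z < e"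
proof -
  define sep where "sep Z \<longleftrightarrow> finite Z \<and> Z \<subseteq> A \<and> (\<forall>x\<in>Z. \<forall>y\<in>Z. x \<noteq> y \<longrightarrow> dist x y \<ge> e)" for Z
  have bound: "real (card Z) \<le> 1 / c" if "sep Z" for Z
  proof -
    have "real (card Z) * c = (\<Sum>x\<in>Z. c)" by simp
    also have "\<dots> \<le> (\<Sum>x\<in>Z. prob (f x))" using that c by (intro sum_mono) (auto simp: sep_def)
    also have "\<dots> = prob (\<Union>x\<in>Z. f x)"
      using that sets disj by (intro finite_measure_finite_Union[symmetric])
        (auto simp: sep_def disjoint_family_on_def subset_iff)
    also have "\<dots> \<le> 1" by (rule prob_le_1)
    finally show ?thesis using c(1) by (simp add: field_simps)
  qed
  have "sep {}" by (simp add: sep_def)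
  moreover have "card Z \<le> nat \<lfloor>1 / c\<rfloor>" if "sep Z" for Z using bound[OF that] by (simp add: le_nat_floor)
  ultimately obtain Z where Z: "sep Z" "\<And>Z'. sep Z' \<Longrightarrow> card Z' \<le> card Z"
    using ex_has_greatest_nat[of sep "{}" card "Suc (nat \<lfloor>1 / c\<rfloor>)"] by (metis le_imp_less_Suc less_imp_le_nat)
  have "\<exists>z\<in>Z. dist x z < e" if x: "x \<in> A" for x
  proof (rule ccontr)
    assume "\<not> ?thesis"
    then have far: "dist x z \<ge> e" if "z \<in> Z" for z using that by force
    then have "x \<notin> Z" using e by force
    moreover have "sep (insert x Z)" using Z(1) x far by (auto simp: sep_def dist_commute)
    ultimately show False using Z(2)[of "insert x Z"] Z(1) by (simp add: sep_def)
  qed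
  with Z(1) bound[OF Z(1)] show ?thesis by (intro that[of Z]) (auto simp: sep_def)
qed

end

section \<open>The kNN radius as a function of the sample and of the centre\<close>

definition ball_count :: "nat \<Rightarrow> (nat \<Rightarrow> real^'n) \<Rightarrow> real^'n \<Rightarrow> real \<Rightarrow> nat" where
  "ball_count N y x r = (\<Sum>j=1..N. of_bool (norm (y j - x) < r))"

lemma knn_radius_eq: "knn_radius N k y x = Inf {r. r > 0 \<and> ball_count N y x r \<ge> k}"
  by (simp add: knn_radius_def ball_count_def)

lemma ball_count_mono:
  assumes "dist x z \<le> s - r"
  shows "ball_count N y x r \<le> ball_count N y z s"
  unfolding ball_count_def
proof (rule sum_mono)
  fix j
  have "norm (y j - z) \<le> norm (y j - x) + dist x z"
    using norm_triangle_ineq[of "y j - x" "x - z"] by (simp add: dist_norm)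
  then show "of_bool (norm (y j - x) < r) \<le> (of_bool (norm (y j - z) < s) :: nat)"
    using assms by (auto simp: of_bool_def)
qed

lemma knn_radius_le: "0 < r \<Longrightarrow> k \<le> ball_count N y x r \<Longrightarrow> knn_radius N k y x \<le> r"
  unfolding knn_radius_eq by (intro cInf_lower) (auto intro!: bdd_belowI[of _ 0])

lemma ball_count_exists:
  assumes "k \<le> N"
  shows "\<exists>r>0. k \<le> ball_count N y x r"
proof (intro exI conjI)
  let ?r = "1 + (\<Sum>j=1..N. norm (y j - x))"
  show "?r > 0" by (intro add_pos_nonneg sum_nonneg) auto
  have "norm (y j - x) < ?r" if "j \<in> {1..N}" for j
    using member_le_sum[of j "{1..N}" "\<lambda>j. norm (y j - x)"] that by simp
  then have "ball_count N y x ?r = (\<Sum>j=1..N. 1)" unfolding ball_count_def by (intro sum.cong) auto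
  then show "k \<le> ball_count N y x ?r" using assms by simp
qed

lemma knn_radius_ge:
  assumes "k \<le> N" "\<And>r. 0 < r \<Longrightarrow> k \<le> ball_count N y x r \<Longrightarrow> a \<le> r"
  shows "a \<le> knn_radius N k y x"
  unfolding knn_radius_eq using assms(2) ball_count_exists[OF assms(1), of y x] by (intro cInf_greatest) auto

text \<open>Restricting to rational radii writes the event as a countable union, from which
  measurability in the sample follows.\<close>

lemma knn_radius_less_iff:
  assumes "k \<le> N"
  shows "knn_radius N k y x < a \<longleftrightarrow> (\<exists>r\<in>\<rat>. 0 < r \<and> r < a \<and> k \<le> ball_count N y x r)"
proof
  assume "knn_radius N k y x < a"
  then obtain r where r: "0 < r" "k \<le> ball_count N y x r" "r < a"
    unfolding knn_radius_eq using ball_count_exists[OF assms, of y x] by (subst (asm) cInf_less_iff) (auto intro!: bdd_belowI[of _ 0])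
  obtain q where q: "q \<in> \<rat>" "r < q" "q < a" using Rats_dense_in_real[OF r(3)] by blast
  have "ball_count N y x r \<le> ball_count N y x q" using q by (intro ball_count_mono) simp
  then show "\<exists>r\<in>\<rat>. 0 < r \<and> r < a \<and> k \<le> ball_count N y x r" using q r by (intro bexI[of _ q]) auto
qed (use knn_radius_le in fastforce)

text \<open>A ball about \<open>x\<close> that holds \<open>k\<close> samples lies in the ball about
  \<open>z\<close> whose radius is larger by \<open>dist x z\<close>.\<close>

lemma knn_radius_lipschitz:
  assumes "k \<le> N"
  shows "\<bar>knn_radius N k y x - knn_radius N k y z\<bar> \<le> dist x z"
proof -
  have "knn_radius N k y z - dist x z \<le> knn_radius N k y x" for x z
  proof (rule knn_radius_ge[OF assms])
    fix r assume r: "0 < r" "k \<le> ball_count N y x r"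
    have "ball_count N y x r \<le> ball_count N y z (r + dist x z)" by (intro ball_count_mono) simp
    then have "knn_radius N k y z \<le> r + dist x z" using r by (intro knn_radius_le) (auto intro: add_pos_nonneg)
    then show "knn_radius N k y z - dist x z \<le> r" by simp
  qed
  from this[of x z] this[of z x] show ?thesis by (simp add: dist_commute abs_le_iff)
qed

lemma continuous_on_knn_radius:
  assumes "k \<le> N"
  shows "continuous_on A (knn_radius N k y)"
  unfolding continuous_on_iff
proof (intro ballI allI impI)
  fix x and e :: real assume "e > 0"
  moreover have "dist (knn_radius N k y x') (knn_radius N k y x) \<le> dist x' x" for x'
    using knn_radius_lipschitz[OF assms] by (simp add: dist_real_def)
  ultimately show "\<exists>d>0. \<forall>x'\<in>A. dist x' x < d \<longrightarrow> dist (knn_radius N k y x') (knn_radius N k y x) < e"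
    by (intro exI[of _ e] conjI ballI impI) (auto intro: le_less_trans)
qed

section \<open>The bandwidth estimate\<close>

lemma measurable_knn_radius:
  fixes P :: "(real^'n) measure"
  assumes sets: "sets P = sets (restrict_space borel A)" and k: "k \<le> N"
  shows "(\<lambda>y. knn_radius N k y x) \<in> borel_measurable (\<Pi>\<^sub>M j\<in>{1..N}. P)"
proof (rule borel_measurableI_less)
  fix a :: real
  let ?S = "\<Pi>\<^sub>M j\<in>{1..N}. P"
  have id: "(\<lambda>v. v) \<in> borel_measurable P"
    using sets by (simp add: measurable_restrict_space1 cong: measurable_cong_sets)
  have comp: "(\<lambda>y. y j) \<in> borel_measurable ?S" if "j \<in> {1..N}" for j
    using measurable_compose[OF measurable_component_singleton[OF that] id] by simp
  have "(\<lambda>y. of_bool (norm (y j - x) < r) :: nat) \<in> measurable ?S (count_space UNIV)" if "j \<in> {1..N}" for j r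
  proof -
    note [measurable] = comp[OF that]
    show ?thesis by measurable
  qed
  then have bc: "(\<lambda>y. ball_count N y x r) \<in> measurable ?S (count_space UNIV)" for r
    unfolding ball_count_def by measurable
  have lev: "{y \<in> space ?S. 0 < r \<and> r < a \<and> k \<le> ball_count N y x r} \<in> sets ?S" for r
  proof -
    have "(\<lambda>y. ball_count N y x r) -` {k..} \<inter> space ?S \<in> sets ?S" using bc by (rule measurable_sets) simp
    moreover have "{y \<in> space ?S. 0 < r \<and> r < a \<and> k \<le> ball_count N y x r}
      = (if 0 < r \<and> r < a then (\<lambda>y. ball_count N y x r) -` {k..} \<inter> space ?S else {})" by auto
    ultimately show ?thesis by simp
  qed
  have "(\<Union>r\<in>\<rat>. {y \<in> space ?S. 0 < r \<and> r < a \<and> k \<le> ball_count N y x r}) \<in> sets ?S"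
    by (rule sets.countable_UN''[OF countable_rat lev])
  also have "(\<Union>r\<in>\<rat>. {y \<in> space ?S. 0 < r \<and> r < a \<and> k \<le> ball_count N y x r}) = {y \<in> space ?S. knn_radius N k y x < a}"
    using knn_radius_less_iff[OF k] by auto
  finally show "{y \<in> space ?S. knn_radius N k y x < a} \<in> sets ?S" .
qed

text \<open>From here on the geometry of \<open>M\<close> enters only through the expansion
  \<open>ball_measure\<close>; charts and volume forms are gone.\<close>

locale knn_sampling = prob_space P for P :: "(real^'n) measure" +
  fixes M :: "(real^'n) set" and p :: "real^'n \<Rightarrow> real" and pmin pmax m\<^sub>0 C\<^sub>0 r\<^sub>0 :: real and d :: nat
  assumes sets_P: "sets P = sets (restrict_space borel M)" and M: "compact M" "M \<noteq> {}"
    and continuous_p: "continuous_on M p" and pmin: "0 < pmin"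
    and p_bounds: "\<And>x. x \<in> M \<Longrightarrow> pmin \<le> p x \<and> p x \<le> pmax"
    and d: "d > 0" and m\<^sub>0: "m\<^sub>0 > 0" and C\<^sub>0: "C\<^sub>0 \<ge> 0" and r\<^sub>0: "r\<^sub>0 > 0"
    and ball_measure: "\<And>x r. x \<in> M \<Longrightarrow> 0 < r \<Longrightarrow> r < r\<^sub>0 \<Longrightarrow>
      \<bar>prob (M \<inter> ball x r) - m\<^sub>0 * p x * r ^ d\<bar> \<le> C\<^sub>0 * r ^ (d + 2)"
begin

lemma space_P: "space P = M"
  using sets_eq_imp_space_eq[OF sets_P] by (simp add: space_restrict_space)

lemma ball_sets: "M \<inter> ball x r \<in> sets P"
  using sets_P by (auto simp: sets_restrict_space)

lemma p_pos: "x \<in> M \<Longrightarrow> p x > 0" using p_bounds pmin by force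

lemma pmax: "pmax > 0" using M p_bounds pmin by force

text \<open>With $r^d = k/N$, a ball about \<open>x\<close> of radius \<open>r * \<sigma> * \<rho> x\<close> contains $k$ samples on average, to
  leading order.\<close>

definition \<rho> where "\<rho> x = p x powr (- 1 / real d)"

definition \<sigma> where "\<sigma> = m\<^sub>0 powr (- 1 / real d)"

definition \<rho>\<^sub>1 where "\<rho>\<^sub>1 = pmin powr (- 1 / real d)"

definition \<rho>\<^sub>2 where "\<rho>\<^sub>2 = pmax powr (- 1 / real d)"

text \<open>Relative error of a ball mass in units of \<open>r\<^sup>2\<close>: the error term of
  \<open>ball_measure\<close> over its leading term, for radii up to
  \<open>2 * r * \<sigma> * \<rho>\<^sub>1\<close>.\<close>

definition c\<^sub>2 where "c\<^sub>2 = 4 * C\<^sub>0 * (\<sigma> * \<rho>\<^sub>1)\<^sup>2 / (m\<^sub>0 * pmin)"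

definition c\<^sub>3 where "c\<^sub>3 = (m\<^sub>0 * pmax * 2 ^ d + C\<^sub>0 * (1 + 2 ^ (d + 2))) / m\<^sub>0"

text \<open>The constant of the O-term. Its summands are the price of the mass error, of replacing
  the density at a net point by that at \<open>x\<close>, and of the Lipschitz step across the
  mesh.\<close>

definition c where "c = 2 * c\<^sub>2 + 2 * (c\<^sub>3 / pmin) + 1 / (\<sigma> * \<rho>\<^sub>2)"

text \<open>In order: all balls in use have radius below \<open>r\<^sub>0\<close>, both those scaled
  by the bandwidth and those of radius up to \<open>2 * r\<close>; the relative mass error is at
  most 1/25; the small balls that bound the net keep at least half of their leading mass.\<close>

definition small :: "real \<Rightarrow> bool" where
  "small r \<longleftrightarrow> 0 < r \<and> r \<le> 1 \<and> 2 * r * (\<sigma> * \<rho>\<^sub>1 + 1) < r\<^sub>0 \<and> 25 * c\<^sub>2 * r\<^sup>2 \<le> 1 \<and> C\<^sub>0 * r\<^sup>2 \<le> m\<^sub>0 * pmin / 2"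

lemma \<sigma>: "\<sigma> > 0" using m\<^sub>0 by (simp add: \<sigma>_def)

lemma \<rho>: "x \<in> M \<Longrightarrow> \<rho> x > 0" "x \<in> M \<Longrightarrow> \<rho> x \<le> \<rho>\<^sub>1" "x \<in> M \<Longrightarrow> \<rho>\<^sub>2 \<le> \<rho> x"
  using p_bounds[of x] p_pos[of x] pmin d unfolding \<rho>_def \<rho>\<^sub>1_def \<rho>\<^sub>2_def by (auto intro!: powr_mono2')

lemma \<rho>\<^sub>1: "\<rho>\<^sub>1 > 0" and \<rho>\<^sub>2: "\<rho>\<^sub>2 > 0" using pmin pmax by (auto simp: \<rho>\<^sub>1_def \<rho>\<^sub>2_def)

lemma c_nonneg: "c\<^sub>2 \<ge> 0" "c\<^sub>3 \<ge> 0" "c \<ge> 0"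
proof -
  show "c\<^sub>2 \<ge> 0" "c\<^sub>3 \<ge> 0" using C\<^sub>0 m\<^sub>0 pmin pmax by (auto simp: c\<^sub>2_def c\<^sub>3_def)
  then show "c \<ge> 0" using pmin \<sigma> \<rho>\<^sub>2 by (simp add: c_def)
qed

lemma root_power:
  assumes "v > 0"
  shows "(v powr (- 1 / real d)) ^ d = 1 / v"
proof -
  have "(v powr (- 1 / real d)) ^ d = (v powr (- 1 / real d)) powr real d"
    using assms by (intro powr_realpow[symmetric]) simp
  also have "\<dots> = v powr (- 1)" unfolding powr_powr using d by simp
  finally show ?thesis using assms by (simp add: powr_minus_divide)
qed

text \<open>The factors \<open>\<sigma>\<close> and \<open>\<rho> x\<close> cancel
  \<open>m\<^sub>0\<close> and \<open>p x\<close> in the leading term. The range of \<open>t\<close>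
  covers the later factors \<open>1 + \<tau>\<close> and \<open>1 - \<tau>\<close>.\<close>

lemma ball_mass:
  assumes x: "x \<in> M" and r: "small r" and t: "0 < t" "t \<le> 2"
  shows "\<bar>prob (M \<inter> ball x (r * \<sigma> * \<rho> x * t)) - r ^ d * t ^ d\<bar> \<le> r ^ d * t ^ d * (c\<^sub>2 * r\<^sup>2)"
proof -
  let ?a = "r * \<sigma> * \<rho> x * t"
  have r0: "r > 0" using r by (simp add: small_def)
  have px: "p x > 0" by (rule p_pos[OF x])
  have a: "?a > 0" using r0 \<sigma> \<rho>(1)[OF x] t by simp
  have st: "\<sigma> * \<rho> x * t \<le> \<sigma> * \<rho>\<^sub>1 * 2"
    using \<sigma> \<rho>[OF x] t by (intro mult_mono) auto
  have a_le: "?a \<le> 2 * r * (\<sigma> * \<rho>\<^sub>1)" using mult_left_mono[OF st, of r] r0 by (simp add: mult_ac)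
  also have "\<dots> < r\<^sub>0" using r r0 by (simp add: small_def algebra_simps)
  finally have "?a < r\<^sub>0" .
  from ball_measure[OF x a this]
  have "\<bar>prob (M \<inter> ball x ?a) - m\<^sub>0 * p x * ?a ^ d\<bar> \<le> C\<^sub>0 * ?a ^ (d + 2)" .
  also have pow: "m\<^sub>0 * p x * ?a ^ d = r ^ d * t ^ d"
    using root_power[OF m\<^sub>0] root_power[OF px] m\<^sub>0 px by (simp add: power_mult_distrib \<sigma>_def \<rho>_def)
  also have "C\<^sub>0 * ?a ^ (d + 2) = r ^ d * t ^ d * (C\<^sub>0 * ?a\<^sup>2 / (m\<^sub>0 * p x))"
  proof -
    have "m * q * a ^ d * (C\<^sub>0 * a\<^sup>2 / (m * q)) = C\<^sub>0 * a ^ (d + 2)" if "m > 0" "q > 0" for m q a :: real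
      using that by (simp add: power_add power2_eq_square)
    from this[OF m\<^sub>0 px, of ?a] show ?thesis unfolding pow by simp
  qed
  also have "\<dots> \<le> r ^ d * t ^ d * (c\<^sub>2 * r\<^sup>2)"
  proof (rule mult_left_mono)
    have "?a\<^sup>2 \<le> (2 * r * (\<sigma> * \<rho>\<^sub>1))\<^sup>2" using a a_le by (intro power_mono) auto
    then have "C\<^sub>0 * ?a\<^sup>2 / (m\<^sub>0 * p x) \<le> C\<^sub>0 * (2 * r * (\<sigma> * \<rho>\<^sub>1))\<^sup>2 / (m\<^sub>0 * pmin)"
      using C\<^sub>0 m\<^sub>0 pmin p_bounds[OF x] by (intro frac_le mult_left_mono) auto
    then show "C\<^sub>0 * ?a\<^sup>2 / (m\<^sub>0 * p x) \<le> c\<^sub>2 * r\<^sup>2" by (simp add: c\<^sub>2_def power_mult_distrib mult_ac)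
  qed (use r0 t in auto)
  finally show ?thesis .
qed

text \<open>Comparing the masses of nested balls shows that the density varies little between close points.\<close>

lemma density_increment:
  assumes x: "x \<in> M" and z: "z \<in> M" and r: "small r" and xz: "dist x z \<le> r ^ 3"
  shows "p z - p x \<le> c\<^sub>3 * r\<^sup>2"
proof -
  have r0: "0 < r" "r \<le> 1" using r by (auto simp: small_def)
  have r2: "2 * r < r\<^sub>0"
  proof -
    have "2 * r * 1 \<le> 2 * r * (\<sigma> * \<rho>\<^sub>1 + 1)" using r0 \<sigma> \<rho>\<^sub>1 by (intro mult_left_mono) auto
    also have "\<dots> < r\<^sub>0" using r by (simp add: small_def)
    finally show ?thesis by simp
  qed
  have sq: "r\<^sup>2 \<le> 1" using r0 by (simp add: power_le_one)
  \<comment> \<open>The enlarged radius is \<open>r * (1 + r\<^sup>2)\<close>, so its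
    \<open>d\<close>-th power changes by a relative O(r^2), the same order as the error of the
    expansion. This is what a mesh of \<open>r ^ 3\<close> buys.\<close>
  define e where "e = r + r ^ 3"
  have e: "e = r * (1 + r\<^sup>2)" by (simp add: e_def power2_eq_square power3_eq_cube algebra_simps)
  have e2: "e \<le> r * 2" unfolding e using r0 sq by (intro mult_left_mono) auto
  have e0: "e > 0" using r0 by (simp add: e_def add_pos_pos)
  have "M \<inter> ball z r \<subseteq> M \<inter> ball x e"
  proof
    fix y assume "y \<in> M \<inter> ball z r"
    then show "y \<in> M \<inter> ball x e" using xz dist_triangle[of x y z] by (auto simp: e_def)
  qed
  then have "prob (M \<inter> ball z r) \<le> prob (M \<inter> ball x e)" using ball_sets by (rule finite_measure_mono)
  moreover have "m\<^sub>0 * p z * r ^ d - C\<^sub>0 * r ^ (d + 2) \<le> prob (M \<inter> ball z r)"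
    using ball_measure[OF z r0(1)] r2 r0 by simp
  moreover have "prob (M \<inter> ball x e) \<le> m\<^sub>0 * p x * e ^ d + C\<^sub>0 * e ^ (d + 2)"
    using ball_measure[OF x e0] e2 r2 by simp
  ultimately have "m\<^sub>0 * p z * r ^ d - C\<^sub>0 * r ^ (d + 2) \<le> m\<^sub>0 * p x * e ^ d + C\<^sub>0 * e ^ (d + 2)" by linarith
  also have "\<dots> \<le> m\<^sub>0 * p x * (r ^ d * (1 + 2 ^ d * r\<^sup>2)) + C\<^sub>0 * (r ^ (d + 2) * 2 ^ (d + 2))"
  proof -
    have "e ^ d \<le> r ^ d * (1 + 2 ^ d * r\<^sup>2)"
      unfolding e power_mult_distrib using r0 sq by (intro mult_left_mono power_one_plus_le) auto
    moreover have "e ^ (d + 2) \<le> (r * 2) ^ (d + 2)" using e2 e0 by (intro power_mono) auto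
    ultimately show ?thesis
      using m\<^sub>0 p_pos[OF x] C\<^sub>0 unfolding power_mult_distrib by (intro add_mono mult_left_mono) auto
  qed
  finally have "r ^ d * (m\<^sub>0 * (p z - p x)) \<le> r ^ d * ((m\<^sub>0 * p x * 2 ^ d + C\<^sub>0 * (1 + 2 ^ (d + 2))) * r\<^sup>2)"
    by (simp add: algebra_simps power_add power2_eq_square)
  then have "m\<^sub>0 * (p z - p x) \<le> (m\<^sub>0 * p x * 2 ^ d + C\<^sub>0 * (1 + 2 ^ (d + 2))) * r\<^sup>2"
    using r0 by (simp only: mult_le_cancel_left_pos zero_less_power)
  also have "\<dots> \<le> (m\<^sub>0 * pmax * 2 ^ d + C\<^sub>0 * (1 + 2 ^ (d + 2))) * r\<^sup>2"
    using p_bounds[OF x] m\<^sub>0 by (intro mult_right_mono add_right_mono mult_left_mono) auto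
  finally show ?thesis using m\<^sub>0 by (simp add: c\<^sub>3_def field_simps)
qed

lemma bandwidth_close:
  assumes x: "x \<in> M" and z: "z \<in> M" and r: "small r" and xz: "dist x z \<le> r ^ 3"
  shows "\<bar>\<rho> z - \<rho> x\<bar> \<le> c\<^sub>3 / pmin * r\<^sup>2 * \<rho> x"
proof -
  define w where "w = p x / p z"
  have w: "w > 0" using p_pos[OF x] p_pos[OF z] by (simp add: w_def)
  have "\<bar>p x - p z\<bar> \<le> c\<^sub>3 * r\<^sup>2"
    using density_increment[OF x z r xz] density_increment[OF z x r] xz by (simp add: dist_commute)
  then have "\<bar>p x - p z\<bar> / p z \<le> c\<^sub>3 * r\<^sup>2 / pmin"
    using p_bounds[OF z] pmin by (intro frac_le) auto
  moreover have "w - 1 = (p x - p z) / p z" using p_pos[OF z] by (simp add: w_def field_simps)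
  then have "\<bar>w - 1\<bar> = \<bar>p x - p z\<bar> / p z" using p_pos[OF z] by (simp add: abs_divide)
  ultimately have w1: "\<bar>w - 1\<bar> \<le> c\<^sub>3 / pmin * r\<^sup>2" by simp
  \<comment> \<open>The \<open>d\<close>-th root of \<open>w\<close> lies between 1 and
    \<open>w\<close>.\<close>
  have "\<bar>w powr (1 / real d) - 1\<bar> \<le> \<bar>w - 1\<bar>"
  proof (cases "w \<ge> 1")
    case True
    have "w powr (1 / real d) \<le> w powr 1" using True d by (intro powr_mono) auto
    moreover have "1 \<le> w powr (1 / real d)" using True by (simp add: ge_one_powr_ge_zero)
    ultimately show ?thesis using True by simp
  next
    case False
    have "w powr 1 \<le> w powr (1 / real d)" using False w d by (intro powr_mono') auto
    moreover have "w powr (1 / real d) \<le> 1" using False w by (intro powr_le1) auto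
    ultimately show ?thesis using False w by simp
  qed
  also note w1
  finally have "\<bar>w powr (1 / real d) - 1\<bar> * \<rho> x \<le> c\<^sub>3 / pmin * r\<^sup>2 * \<rho> x"
    using \<rho>(1)[OF x] by (intro mult_right_mono) auto
  moreover have "\<rho> z = w powr (1 / real d) * \<rho> x"
    using p_pos[OF x] p_pos[OF z] by (simp add: \<rho>_def w_def powr_divide powr_minus_divide)
  then have "\<rho> z - \<rho> x = (w powr (1 / real d) - 1) * \<rho> x" by (simp add: algebra_simps)
  ultimately show ?thesis using \<rho>(1)[OF x] by (simp add: abs_mult)
qed

text \<open>Balls of radius \<open>r ^ 3 / 2\<close> about separated points are disjoint and have
  mass at least \<open>m\<^sub>0 * pmin / 2\<close> times that radius to the power \<open>d\<close>,
  which is a multiple of \<open>(r ^ d) ^ 3\<close>.\<close>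

lemma net:
  assumes r: "small r"
  obtains Z where "finite Z" "Z \<subseteq> M" "real (card Z) \<le> 2 * 2 ^ d / (m\<^sub>0 * pmin) / (r ^ d) ^ 3"
    "\<And>x. x \<in> M \<Longrightarrow> \<exists>z\<in>Z. dist x z < r ^ 3"
proof -
  have r0: "0 < r" "r \<le> 1" using r by (auto simp: small_def)
  define e where "e = r ^ 3 / 2"
  have e: "e > 0" using r0 by (simp add: e_def)
  have "r ^ 3 \<le> r ^ 1" using r0 by (intro power_decreasing) auto
  then have er: "e \<le> r" using r0 by (simp add: e_def)
  have "2 * r * 1 \<le> 2 * r * (\<sigma> * \<rho>\<^sub>1 + 1)" using r0 \<sigma> \<rho>\<^sub>1 by (intro mult_left_mono) auto
  also have "\<dots> < r\<^sub>0" using r by (simp add: small_def)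
  finally have "e < r\<^sub>0" using r0 er by simp
  define c' where "c' = m\<^sub>0 * pmin / 2 * e ^ d"
  have c': "c' > 0" using m\<^sub>0 pmin e by (simp add: c'_def)
  have mass: "c' \<le> prob (M \<inter> ball x e)" if x: "x \<in> M" for x
  proof -
    have "C\<^sub>0 * e\<^sup>2 \<le> C\<^sub>0 * r\<^sup>2" using er e C\<^sub>0 by (intro mult_left_mono power_mono) auto
    then have "C\<^sub>0 * e\<^sup>2 \<le> m\<^sub>0 * pmin / 2" using r by (simp add: small_def)
    then have "C\<^sub>0 * e\<^sup>2 * e ^ d \<le> m\<^sub>0 * pmin / 2 * e ^ d" using e by (intro mult_right_mono) auto
    moreover have "m\<^sub>0 * pmin * e ^ d \<le> m\<^sub>0 * p x * e ^ d"
      using p_bounds[OF x] m\<^sub>0 e by (intro mult_right_mono mult_left_mono) auto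
    moreover have "m\<^sub>0 * p x * e ^ d - C\<^sub>0 * e ^ (d + 2) \<le> prob (M \<inter> ball x e)"
      using ball_measure[OF x e \<open>e < r\<^sub>0\<close>] by simp
    ultimately show ?thesis by (simp add: c'_def power_add power2_eq_square mult_ac)
  qed
  have disj: "(M \<inter> ball x e) \<inter> (M \<inter> ball y e) = {}" if "dist x y \<ge> r ^ 3" for x y
  proof -
    have "\<not> (dist x v < e \<and> dist y v < e)" for v
      using that dist_triangle[of x y v] by (auto simp: e_def dist_commute)
    then show ?thesis by auto
  qed
  obtain Z where Z: "finite Z" "Z \<subseteq> M" "real (card Z) \<le> 1 / c'" "\<And>x. x \<in> M \<Longrightarrow> \<exists>z\<in>Z. dist x z < r ^ 3"
    using finite_net[where A=M and f="\<lambda>x. M \<inter> ball x e" and c=c' and e="r ^ 3", OF ball_sets c' mass disj] r0 by auto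
  moreover have "1 / c' = 2 * 2 ^ d / (m\<^sub>0 * pmin) / (r ^ d) ^ 3"
    using m\<^sub>0 pmin r0 by (simp add: c'_def e_def power_divide power_mult[symmetric] mult.commute[of d])
  ultimately show ?thesis using that[of Z] by simp
qed

lemma knn_radius_close:
  assumes r: "small r" and \<tau>: "0 \<le> \<tau>" "\<tau> < 1" and k: "k \<le> N" and Z: "Z \<subseteq> M" "\<And>x. x \<in> M \<Longrightarrow> \<exists>z\<in>Z. dist x z < r ^ 3"
    and upper: "\<And>z. z \<in> Z \<Longrightarrow> k \<le> ball_count N y z (r * \<sigma> * \<rho> z * (1 + \<tau>))"
    and lower: "\<And>z. z \<in> Z \<Longrightarrow> ball_count N y z (r * \<sigma> * \<rho> z * (1 - \<tau>)) < k"
    and x: "x \<in> M"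
  shows "\<bar>knn_radius N k y x - r * \<sigma> * \<rho> x\<bar> \<le> r * \<sigma> * \<rho> x * (\<tau> + (2 * (c\<^sub>3 / pmin) + 1 / (\<sigma> * \<rho>\<^sub>2)) * r\<^sup>2)"
proof -
  have r0: "r > 0" using r by (simp add: small_def)
  have rs: "r * \<sigma> > 0" using r0 \<sigma> by simp
  obtain z where z: "z \<in> Z" "dist x z < r ^ 3" using Z x by blast
  have zM: "z \<in> M" using z Z by auto
  have R1: "knn_radius N k y z \<le> r * \<sigma> * \<rho> z * (1 + \<tau>)"
    using upper[OF z(1)] rs \<rho>(1)[OF zM] \<tau> by (intro knn_radius_le) auto
  have R2: "r * \<sigma> * \<rho> z * (1 - \<tau>) \<le> knn_radius N k y z"
  proof (rule knn_radius_ge[OF k])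
    fix s assume s: "0 < s" "k \<le> ball_count N y z s"
    show "r * \<sigma> * \<rho> z * (1 - \<tau>) \<le> s"
    proof (rule ccontr)
      assume "\<not> ?thesis"
      then have "ball_count N y z s \<le> ball_count N y z (r * \<sigma> * \<rho> z * (1 - \<tau>))" by (intro ball_count_mono) simp
      then show False using lower[OF z(1)] s(2) by simp
    qed
  qed
  have R3: "\<bar>knn_radius N k y x - knn_radius N k y z\<bar> \<le> r ^ 3"
    using knn_radius_lipschitz[OF k, of y x z] z(2) by simp
  \<comment> \<open>\<open>\<beta>\<close> is the relative change of the bandwidth from
    \<open>z\<close> to \<open>x\<close>. It is paid twice: for the centre of the interval and,
    using \<open>\<tau> < 1\<close>, for its half-width.\<close>
  define \<beta> where "\<beta> = c\<^sub>3 / pmin * r\<^sup>2"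
  have \<beta>: "\<beta> \<ge> 0" using c_nonneg pmin by (simp add: \<beta>_def)
  have close: "\<bar>\<rho> z - \<rho> x\<bar> \<le> \<beta> * \<rho> x" unfolding \<beta>_def by (rule bandwidth_close[OF x zM r]) (use z in simp)
  then have "r * \<sigma> * \<bar>\<rho> z - \<rho> x\<bar> \<le> r * \<sigma> * (\<beta> * \<rho> x)" using rs by (intro mult_left_mono) auto
  then have A: "\<bar>r * \<sigma> * \<rho> z - r * \<sigma> * \<rho> x\<bar> \<le> r * \<sigma> * \<rho> x * \<beta>"
    using rs abs_mult[of "r * \<sigma>" "\<rho> z - \<rho> x"] by (simp only: abs_of_pos right_diff_distrib[symmetric]) (simp add: mult_ac)
  then have "r * \<sigma> * \<rho> z * \<tau> \<le> (r * \<sigma> * \<rho> x * (1 + \<beta>)) * \<tau>"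
    using \<tau> by (intro mult_right_mono) (auto simp: algebra_simps)
  also have "\<dots> \<le> r * \<sigma> * \<rho> x * (\<tau> + \<beta>)"
  proof -
    have "\<beta> * \<tau> \<le> \<beta>" using \<tau> \<beta> by (simp add: mult_left_le)
    then have "r * \<sigma> * \<rho> x * (\<tau> + \<beta> * \<tau>) \<le> r * \<sigma> * \<rho> x * (\<tau> + \<beta>)"
      using rs \<rho>(1)[OF x] by (intro mult_left_mono) auto
    then show ?thesis by (simp add: algebra_simps)
  qed
  finally have B: "r * \<sigma> * \<rho> z * \<tau> \<le> r * \<sigma> * \<rho> x * (\<tau> + \<beta>)" .
  have "1 \<le> \<rho> x / \<rho>\<^sub>2" using \<rho>(3)[OF x] \<rho>\<^sub>2 by simp
  then have "r ^ 3 * 1 \<le> r ^ 3 * (\<rho> x / \<rho>\<^sub>2)" using r0 by (intro mult_left_mono) auto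
  also have "\<dots> = r * \<sigma> * \<rho> x * (1 / (\<sigma> * \<rho>\<^sub>2) * r\<^sup>2)" using \<sigma> by (simp add: power3_eq_cube power2_eq_square)
  finally have D: "r ^ 3 \<le> r * \<sigma> * \<rho> x * (1 / (\<sigma> * \<rho>\<^sub>2) * r\<^sup>2)" by simp
  have "\<bar>knn_radius N k y z - r * \<sigma> * \<rho> z\<bar> \<le> r * \<sigma> * \<rho> z * \<tau>" using R1 R2 by (simp add: algebra_simps abs_le_iff)
  then have "\<bar>knn_radius N k y x - r * \<sigma> * \<rho> x\<bar> \<le> r ^ 3 + r * \<sigma> * \<rho> z * \<tau> + r * \<sigma> * \<rho> x * \<beta>"
    using R3 A by linarith
  also have "\<dots> \<le> r * \<sigma> * \<rho> x * (1 / (\<sigma> * \<rho>\<^sub>2) * r\<^sup>2) + r * \<sigma> * \<rho> x * (\<tau> + \<beta>) + r * \<sigma> * \<rho> x * \<beta>"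
    using B D by linarith
  also have "\<dots> = r * \<sigma> * \<rho> x * (\<tau> + (2 * \<beta> + 1 / (\<sigma> * \<rho>\<^sub>2) * r\<^sup>2))" by (simp add: algebra_simps)
  also have "2 * \<beta> + 1 / (\<sigma> * \<rho>\<^sub>2) * r\<^sup>2 = (2 * (c\<^sub>3 / pmin) + 1 / (\<sigma> * \<rho>\<^sub>2)) * r\<^sup>2"
    by (simp add: \<beta>_def algebra_simps)
  finally show ?thesis .
qed

text \<open>Both sides of the inequality are continuous in \<open>x\<close>, so the uncountable
  intersection over \<open>M\<close> reduces to one over a countable dense subset.\<close>

lemma good_event_sets:
  assumes k: "k \<le> N"
  shows "{y \<in> space (\<Pi>\<^sub>M j\<in>{1..N}. P). \<forall>x\<in>M. \<bar>knn_radius N k y x - s * \<rho> x\<bar> \<le> s * \<rho> x * t} \<in> sets (\<Pi>\<^sub>M j\<in>{1..N}. P)"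
proof -
  let ?S = "\<Pi>\<^sub>M j\<in>{1..N}. P"
  obtain D where D: "countable D" "D \<subseteq> M" "M \<subseteq> closure D" by (rule separable)
  have cl: "closure D = M" using D M(1) by (metis closure_minimal compact_imp_closed subset_antisym)
  have contR: "continuous_on M \<rho>"
    unfolding \<rho>_def[abs_def] by (intro continuous_intros continuous_p) (force dest: p_pos)
  have "(\<forall>x\<in>M. \<bar>knn_radius N k y x - s * \<rho> x\<bar> \<le> s * \<rho> x * t) \<longleftrightarrow> (\<forall>x\<in>D. \<bar>knn_radius N k y x - s * \<rho> x\<bar> \<le> s * \<rho> x * t)" for y
  proof
    assume *: "\<forall>x\<in>D. \<bar>knn_radius N k y x - s * \<rho> x\<bar> \<le> s * \<rho> x * t"
    have cont: "continuous_on (closure D) (\<lambda>x. \<bar>knn_radius N k y x - s * \<rho> x\<bar> - s * \<rho> x * t)"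
    proof -
      have m: "continuous_on M (\<lambda>x. s * \<rho> x)" by (rule continuous_on_mult_left[OF contR])
      have "continuous_on M (\<lambda>x. knn_radius N k y x - s * \<rho> x)"
        by (rule continuous_on_diff[OF continuous_on_knn_radius[OF k] m])
      then have "continuous_on M (\<lambda>x. \<bar>knn_radius N k y x - s * \<rho> x\<bar>)" by (rule continuous_on_rabs)
      then have "continuous_on M (\<lambda>x. \<bar>knn_radius N k y x - s * \<rho> x\<bar> - s * \<rho> x * t)"
        by (rule continuous_on_diff[OF _ continuous_on_mult_right[OF m]])
      then show ?thesis by (simp only: cl)
    qed
    show "\<forall>x\<in>M. \<bar>knn_radius N k y x - s * \<rho> x\<bar> \<le> s * \<rho> x * t"
    proof
      fix x assume "x \<in> M"
      then have x: "x \<in> closure D" by (simp only: cl)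
      have "\<bar>knn_radius N k y x - s * \<rho> x\<bar> - s * \<rho> x * t \<le> 0"
        by (rule continuous_le_on_closure[OF cont x]) (use * in \<open>simp only: diff_le_0_iff_le\<close>)
      then show "\<bar>knn_radius N k y x - s * \<rho> x\<bar> \<le> s * \<rho> x * t" by simp
    qed
  qed (use D in auto)
  moreover have "{y \<in> space ?S. \<forall>x\<in>D. \<bar>knn_radius N k y x - s * \<rho> x\<bar> \<le> s * \<rho> x * t} \<in> sets ?S"
  proof -
    have "D \<noteq> {}" using cl M(2) by auto
    note [measurable] = measurable_knn_radius[OF sets_P k]
    have "{y \<in> space ?S. \<bar>knn_radius N k y x - s * \<rho> x\<bar> \<le> s * \<rho> x * t} \<in> sets ?S" for x by measurable
    then have "(\<Inter>x\<in>D. {y \<in> space ?S. \<bar>knn_radius N k y x - s * \<rho> x\<bar> \<le> s * \<rho> x * t}) \<in> sets ?S"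
      by (intro sets.countable_INT'[OF D(1) \<open>D \<noteq> {}\<close>]) blast
    moreover have "(\<Inter>x\<in>D. {y \<in> space ?S. \<bar>knn_radius N k y x - s * \<rho> x\<bar> \<le> s * \<rho> x * t})
      = {y \<in> space ?S. \<forall>x\<in>D. \<bar>knn_radius N k y x - s * \<rho> x\<bar> \<le> s * \<rho> x * t}"
      using \<open>D \<noteq> {}\<close> by blast
    ultimately show ?thesis by simp
  qed
  ultimately show ?thesis by simp
qed

lemma ball_count_eq:
  assumes "y \<in> space (\<Pi>\<^sub>M j\<in>{1..N}. P)"
  shows "real (ball_count N y z a) = (\<Sum>j=1..N. of_bool (y j \<in> M \<inter> ball z a))"
proof -
  have "y j \<in> M" if "j \<in> {1..N}" for j using assms that by (auto simp: space_PiM space_P)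
  then show ?thesis
    unfolding ball_count_def of_nat_sum of_nat_of_bool
    by (intro sum.cong) (auto simp: dist_norm norm_minus_commute)
qed

text \<open>Net points contribute two bad events each, of probability at most
  \<open>1 / real N ^ 20\<close>. Outside all of them \<open>knn_radius_close\<close> applies at
  every \<open>x\<close>.\<close>

lemma good_event_prob:
  fixes N k :: nat
  assumes N: "N \<ge> 2" and k: "k \<ge> 1" "k \<le> N" and r_def: "r = (real k / real N) powr (1 / real d)"
    and r: "small r" and l_def: "l = sqrt (ln (real N) / real k)" and l: "l \<le> 1 / 40"
  shows "measure (\<Pi>\<^sub>M j\<in>{1..N}. P) {y \<in> space (\<Pi>\<^sub>M j\<in>{1..N}. P).
      \<forall>x\<in>M. \<bar>knn_radius N k y x - r * \<sigma> * \<rho> x\<bar> \<le> r * \<sigma> * \<rho> x * (3 * sqrt 13 / real d * l + c * r\<^sup>2)}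
    \<ge> 1 - 4 * 2 ^ d / (m\<^sub>0 * pmin) * real N ^ 3 / real N ^ 20" (is "measure ?S ?E \<ge> _")
proof -
  interpret S: prob_space ?S by (intro prob_space_PiM prob_space_axioms)
  define x where "x = c\<^sub>2 * r\<^sup>2"
  have x: "0 \<le> x" "25 * x \<le> 1" using r c_nonneg by (auto simp: x_def small_def)
  define \<theta> where "\<theta> = 3 * sqrt 13 / real d * l"
  \<comment> \<open>The relative deviation of the mean from \<open>k\<close> that the tail bounds
    need; see \<open>tail\<close> for the factor 10.\<close>
  define \<delta> where "\<delta> = 10 * l"
  \<comment> \<open>The part \<open>2 * x\<close> compensates the error of the ball mass and
    \<open>\<theta>\<close> provides the deviation \<open>\<delta>\<close>.\<close>
  define \<tau> where "\<tau> = 2 * x + \<theta>"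
  have lnN: "ln (real N) > 0" using N by simp
  then have l0: "l > 0" using k by (simp add: l_def)
  have \<delta>: "0 < \<delta>" "\<delta> \<le> 1 / 4" using l l0 by (auto simp: \<delta>_def)
  have s13: "36 / 10 \<le> sqrt 13" "sqrt 13 \<le> 4" by (rule real_le_rsqrt, simp add: power2_eq_square) (rule real_le_lsqrt, simp_all)
  have d1: "real d \<ge> 1" using d by simp
  have \<theta>0: "\<theta> \<ge> 0" using l0 by (simp add: \<theta>_def)
  \<comment> \<open>This gives \<open>\<theta> \<le> 3 / 10\<close>, and \<open>2 * x\<close> is at
    most 2/25, so \<open>\<tau>\<close> stays below 1.\<close>
  have "\<theta> \<le> 3 * 4 / 1 * (1 / 40)"
    unfolding \<theta>_def using s13 d1 l l0 by (intro mult_mono frac_le) auto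
  then have \<tau>: "0 \<le> \<tau>" "\<tau> < 1" using x \<theta>0 by (auto simp: \<tau>_def)
  \<comment> \<open>Bernoulli reduces the claim to a linear one, which is where the factor
    \<open>1 / real d\<close> in \<open>\<theta>\<close> is consumed. As \<open>3 * sqrt 13\<close>
    is at least 10.8, the excess over 10 covers the cross term \<open>20 * l * x\<close>, at most
    \<open>8 / 10 * l\<close>.\<close>
  have key: "(1 + \<delta>) * (1 + 2 * x) \<le> (1 + \<tau>) ^ d"
  proof -
    have "36 / 10 * l \<le> sqrt 13 * l" using s13 l0 by (intro mult_right_mono) auto
    moreover have "real d * \<theta> = 3 * (sqrt 13 * l)" using d by (simp add: \<theta>_def)
    moreover have "1 * (2 * x) \<le> real d * (2 * x)" using d1 x by (intro mult_right_mono) auto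
    moreover have "20 * l * x \<le> 20 * l * (1 / 25)" using x l0 by (intro mult_left_mono) auto
    moreover have "(1 + \<delta>) * (1 + 2 * x) = 1 + 10 * l + 2 * x + 20 * l * x" by (simp add: \<delta>_def algebra_simps)
    moreover have "real d * \<tau> = real d * (2 * x) + real d * \<theta>" by (simp only: \<tau>_def distrib_left)
    ultimately have "(1 + \<delta>) * (1 + 2 * x) \<le> 1 + real d * \<tau>" by linarith
    also have "\<dots> \<le> (1 + \<tau>) ^ d" using \<tau> by (intro Bernoulli_inequality) simp
    finally show ?thesis .
  qed
  have rd: "r ^ d = real k / real N"
  proof -
    have "r ^ d = r powr real d" using r by (intro powr_realpow[symmetric]) (simp add: small_def)
    also have "\<dots> = real k / real N" unfolding r_def powr_powr using d k N by simp
    finally show ?thesis .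
  qed
  have N0: "real N > 0" using N by simp
  have upper: "real k * (1 + \<delta>) \<le> real N * prob (M \<inter> ball z (r * \<sigma> * \<rho> z * (1 + \<tau>)))" if z: "z \<in> M" for z
  proof -
    have "r ^ d * (1 + \<tau>) ^ d * (1 - x) \<le> prob (M \<inter> ball z (r * \<sigma> * \<rho> z * (1 + \<tau>)))"
      using ball_mass[OF z r, of "1 + \<tau>"] \<tau> by (simp add: x_def abs_le_iff algebra_simps)
    moreover have "r ^ d * ((1 + \<delta>) * (1 + 2 * x)) * (1 - x) \<le> r ^ d * (1 + \<tau>) ^ d * (1 - x)"
      using key x rd by (intro mult_right_mono mult_left_mono) auto
    moreover have "r ^ d * (1 + \<delta>) * 1 \<le> r ^ d * (1 + \<delta>) * ((1 + 2 * x) * (1 - x))"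
    proof (rule mult_left_mono)
      have "x * (2 * x) \<le> x * 1" using x by (intro mult_left_mono) auto
      then show "1 \<le> (1 + 2 * x) * (1 - x)" by (simp add: algebra_simps)
    qed (use rd \<delta> in auto)
    ultimately have "r ^ d * (1 + \<delta>) \<le> prob (M \<inter> ball z (r * \<sigma> * \<rho> z * (1 + \<tau>)))" by (simp add: mult.assoc)
    then show ?thesis using N0 by (simp add: rd field_simps)
  qed
  have lower: "real N * prob (M \<inter> ball z (r * \<sigma> * \<rho> z * (1 - \<tau>))) \<le> real k / (1 + \<delta>)" if z: "z \<in> M" for z
  proof -
    have "prob (M \<inter> ball z (r * \<sigma> * \<rho> z * (1 - \<tau>))) \<le> r ^ d * (1 - \<tau>) ^ d * (1 + x)"
      using ball_mass[OF z r, of "1 - \<tau>"] \<tau> by (simp add: x_def abs_le_iff algebra_simps)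
    also have "\<dots> \<le> r ^ d * (1 / (1 + \<delta>))"
    proof -
      \<comment> \<open>The bound for the larger radius also serves the smaller one, since
        \<open>(1 - \<tau>) * (1 + \<tau>)\<close> is at most 1.\<close>
      have "(1 - \<tau>) ^ d * ((1 + \<delta>) * (1 + 2 * x)) \<le> (1 - \<tau>) ^ d * (1 + \<tau>) ^ d"
        using key \<tau> by (intro mult_left_mono) auto
      also have "\<dots> = (1 - \<tau>\<^sup>2) ^ d" by (simp add: power_mult_distrib[symmetric] power2_eq_square algebra_simps)
      also have "\<dots> \<le> 1" using \<tau> by (intro power_le_one) (auto simp: power_le_one abs_square_le_1)
      finally have "(1 - \<tau>) ^ d * (1 + 2 * x) * (1 + \<delta>) \<le> 1" by (simp add: mult_ac)
      moreover have "(1 - \<tau>) ^ d * (1 + x) * (1 + \<delta>) \<le> (1 - \<tau>) ^ d * (1 + 2 * x) * (1 + \<delta>)"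
        using \<tau> x \<delta> by (intro mult_right_mono mult_left_mono) auto
      ultimately have "(1 - \<tau>) ^ d * (1 + x) \<le> 1 / (1 + \<delta>)" using \<delta> by (simp add: field_simps)
      then have "r ^ d * ((1 - \<tau>) ^ d * (1 + x)) \<le> r ^ d * (1 / (1 + \<delta>))" using rd by (intro mult_left_mono) auto
      then show ?thesis by (simp add: mult.assoc)
    qed
    finally have "real N * prob (M \<inter> ball z (r * \<sigma> * \<rho> z * (1 - \<tau>))) \<le> real N * (r ^ d * (1 / (1 + \<delta>)))"
      using N0 by (intro mult_left_mono) auto
    also have "\<dots> = real k / (1 + \<delta>)" using N0 by (simp add: rd)
    finally show ?thesis .
  qed
  \<comment> \<open>\<open>real k * \<delta>\<^sup>2\<close> is \<open>100 * ln (real N)\<close>,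
    and \<open>4 * (1 + \<delta>)\<close> is at most 5.\<close>
  have tail: "exp (- (real k * \<delta>\<^sup>2 / (4 * (1 + \<delta>)))) \<le> 1 / real N ^ 20"
  proof -
    have "real k * \<delta>\<^sup>2 = 100 * ln (real N)" using lnN k by (simp add: \<delta>_def l_def power_mult_distrib)
    then have "100 * ln (real N) / (4 * (1 + 1 / 4)) \<le> real k * \<delta>\<^sup>2 / (4 * (1 + \<delta>))"
      using \<delta> lnN by (simp only:) (intro divide_left_mono, auto)
    then have "exp (- (real k * \<delta>\<^sup>2 / (4 * (1 + \<delta>)))) \<le> exp (- (real 20 * ln (real N)))" by simp
    also have "\<dots> = 1 / real N ^ 20"
      unfolding exp_minus exp_of_nat_mult using N0 by (simp add: divide_inverse)
    finally show ?thesis .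
  qed
  obtain Z where Z: "finite Z" "Z \<subseteq> M" "real (card Z) \<le> 2 * 2 ^ d / (m\<^sub>0 * pmin) / (r ^ d) ^ 3"
    "\<And>x. x \<in> M \<Longrightarrow> \<exists>z\<in>Z. dist x z < r ^ 3"
    using net[OF r] by blast
  \<comment> \<open>The bad events at a net point: \<open>A z\<close> has too few samples in the
    larger ball, \<open>B z\<close> too many in the smaller one.\<close>
  define A where "A z = {y \<in> space ?S. (\<Sum>j\<in>{1..N}. of_bool (y j \<in> M \<inter> ball z (r * \<sigma> * \<rho> z * (1 + \<tau>)))) \<le> real k}" for z
  define B where "B z = {y \<in> space ?S. real k \<le> (\<Sum>j\<in>{1..N}. of_bool (y j \<in> M \<inter> ball z (r * \<sigma> * \<rho> z * (1 - \<tau>))))}" for z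
  have A_sets: "A z \<in> sets ?S" and B_sets: "B z \<in> sets ?S" for z
  proof -
    note [measurable] = ball_sets
    show "A z \<in> sets ?S" "B z \<in> sets ?S" unfolding A_def B_def by measurable
  qed
  have A_prob: "measure ?S (A z) \<le> 1 / real N ^ 20" if "z \<in> M" for z
    unfolding A_def
    by (rule order_trans[OF count_lower_tail[OF ball_sets finite_atLeastAtMost \<delta>(1)] tail])
      (use \<delta> upper[OF that] in auto)
  have B_prob: "measure ?S (B z) \<le> 1 / real N ^ 20" if "z \<in> M" for z
    unfolding B_def
    by (rule order_trans[OF count_upper_tail[OF ball_sets finite_atLeastAtMost \<delta>(1)] tail])
      (use \<delta> lower[OF that] in auto)
  have E_sets: "?E \<in> sets ?S" using good_event_sets[OF k(2), of "r * \<sigma>" "3 * sqrt 13 / real d * l + c * r\<^sup>2"] .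
  have sub: "space ?S - ?E \<subseteq> (\<Union>z\<in>Z. A z \<union> B z)"
  proof
    fix y assume y: "y \<in> space ?S - ?E"
    show "y \<in> (\<Union>z\<in>Z. A z \<union> B z)"
    proof (rule ccontr)
      assume no: "y \<notin> (\<Union>z\<in>Z. A z \<union> B z)"
      have yS: "y \<in> space ?S" using y by simp
      have "\<bar>knn_radius N k y x - r * \<sigma> * \<rho> x\<bar> \<le> r * \<sigma> * \<rho> x * (\<tau> + (2 * (c\<^sub>3 / pmin) + 1 / (\<sigma> * \<rho>\<^sub>2)) * r\<^sup>2)" if "x \<in> M" for x
      proof (rule knn_radius_close[OF r \<tau> k(2) Z(2,4) _ _ that])
        fix z assume z: "z \<in> Z"
        have "real k < real (ball_count N y z (r * \<sigma> * \<rho> z * (1 + \<tau>)))"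
          using no z yS unfolding ball_count_eq[OF yS] A_def by force
        then show "k \<le> ball_count N y z (r * \<sigma> * \<rho> z * (1 + \<tau>))" by simp
        have "real (ball_count N y z (r * \<sigma> * \<rho> z * (1 - \<tau>))) < real k"
          using no z yS unfolding ball_count_eq[OF yS] B_def by force
        then show "ball_count N y z (r * \<sigma> * \<rho> z * (1 - \<tau>)) < k" by simp
      qed
      moreover have "\<tau> + (2 * (c\<^sub>3 / pmin) + 1 / (\<sigma> * \<rho>\<^sub>2)) * r\<^sup>2 = 3 * sqrt 13 / real d * l + c * r\<^sup>2"
        by (simp add: \<tau>_def \<theta>_def x_def c_def algebra_simps)
      ultimately have "y \<in> ?E" using yS by simp
      then show False using y by simp
    qed
  qed
  have "measure ?S (space ?S - ?E) \<le> measure ?S (\<Union>z\<in>Z. A z \<union> B z)"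
    using sub A_sets B_sets Z(1) by (intro S.finite_measure_mono sets.finite_UN) auto
  also have "\<dots> \<le> (\<Sum>z\<in>Z. measure ?S (A z \<union> B z))"
    using A_sets B_sets Z(1) by (intro S.finite_measure_subadditive_finite) auto
  also have "\<dots> \<le> (\<Sum>z\<in>Z. 2 / real N ^ 20)"
  proof (rule sum_mono)
    fix z assume "z \<in> Z"
    then have "z \<in> M" using Z by auto
    then show "measure ?S (A z \<union> B z) \<le> 2 / real N ^ 20"
      using measure_Un_le[OF A_sets B_sets, of z z] A_prob[of z] B_prob[of z] by simp
  qed
  also have "\<dots> = real (card Z) * (2 / real N ^ 20)" by simp
  also have "\<dots> \<le> 2 * 2 ^ d / (m\<^sub>0 * pmin) * real N ^ 3 * (2 / real N ^ 20)"
  proof (rule mult_right_mono)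
    \<comment> \<open>\<open>r ^ d\<close> is \<open>k / N\<close> and \<open>k\<close> is at least
      1.\<close>
    have "1 / (r ^ d) ^ 3 \<le> real N ^ 3"
      using k N0 by (simp add: rd power_divide divide_le_eq mult_left_mono[of 1 "real k ^ 3" "real N ^ 3", simplified] one_le_power)
    then have "2 * 2 ^ d / (m\<^sub>0 * pmin) * (1 / (r ^ d) ^ 3) \<le> 2 * 2 ^ d / (m\<^sub>0 * pmin) * real N ^ 3"
      using m\<^sub>0 pmin by (intro mult_left_mono) auto
    then show "real (card Z) \<le> 2 * 2 ^ d / (m\<^sub>0 * pmin) * real N ^ 3" using Z(3) by simp
  qed simp
  finally have "measure ?S (space ?S - ?E) \<le> 4 * 2 ^ d / (m\<^sub>0 * pmin) * real N ^ 3 / real N ^ 20" by simp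
  moreover have "measure ?S ?E = 1 - measure ?S (space ?S - ?E)"
    using S.prob_compl[OF E_sets] by simp
  ultimately show ?thesis by simp
qed

end

section \<open>Asymptotics in \<open>N\<close> and the final estimate\<close>

lemma knn_rates:
  fixes k :: "nat \<Rightarrow> nat"
  assumes k1: "(\<lambda>N. real (k N)) \<in> o(\<lambda>N. real N)"
    and k2: "filterlim (\<lambda>N. real (k N) / ln (real N)) at_top sequentially" and "d > 0"
  shows "(\<lambda>N. (real (k N) / real N) powr (1 / real d)) \<longlonglongrightarrow> 0"
    and "(\<lambda>N. (real (k N) / real N) powr (2 / real d)) \<longlonglongrightarrow> 0"
    and "(\<lambda>N. sqrt (ln (real N) / real (k N))) \<longlonglongrightarrow> 0"
    and "\<forall>\<^sub>F N in sequentially. 1 \<le> k N \<and> k N \<le> N"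
proof -
  have r: "(\<lambda>N. real (k N) / real N) \<longlonglongrightarrow> 0" by (rule smalloD_tendsto[OF k1])
  have "(\<lambda>N. (real (k N) / real N) powr s) \<longlonglongrightarrow> 0" if "s > 0" for s
    using tendsto_powr'[OF r tendsto_const[of s]] that by simp
  then show "(\<lambda>N. (real (k N) / real N) powr (1 / real d)) \<longlonglongrightarrow> 0"
    "(\<lambda>N. (real (k N) / real N) powr (2 / real d)) \<longlonglongrightarrow> 0" using assms(3) by auto
  have "(\<lambda>N. inverse (real (k N) / ln (real N))) \<longlonglongrightarrow> 0"
    by (rule filterlim_compose[OF tendsto_inverse_0_at_top k2]) (rule filterlim_ident)
  then have "(\<lambda>N. sqrt (inverse (real (k N) / ln (real N)))) \<longlonglongrightarrow> sqrt 0" by (rule tendsto_real_sqrt)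
  then show "(\<lambda>N. sqrt (ln (real N) / real (k N))) \<longlonglongrightarrow> 0" by simp
  have "\<forall>\<^sub>F N in sequentially. real (k N) / ln (real N) \<ge> 1" using k2 by (simp add: filterlim_at_top)
  moreover have "\<forall>\<^sub>F N in sequentially. real (k N) / real N < 1" using order_tendstoD(2)[OF r, of 1] by simp
  moreover have "\<forall>\<^sub>F N in sequentially. N \<ge> (1::nat)" by (rule eventually_ge_at_top)
  ultimately show "\<forall>\<^sub>F N in sequentially. 1 \<le> k N \<and> k N \<le> N"
  proof eventually_elim
    case (elim N)
    have "k N \<noteq> 0" using elim(1) by (cases "k N = 0") auto
    moreover have "k N \<le> N" using elim by (simp add: divide_less_eq)
    ultimately show ?case by simp
  qed
qed

lemma (in knn_sampling) eventually_small:
  assumes "f \<longlonglongrightarrow> 0" "\<forall>\<^sub>F N in sequentially. f N > 0"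
  shows "\<forall>\<^sub>F N in sequentially. small (f N)"
proof -
  have "(\<lambda>N. 2 * f N * (\<sigma> * \<rho>\<^sub>1 + 1)) \<longlonglongrightarrow> 2 * 0 * (\<sigma> * \<rho>\<^sub>1 + 1)" "(\<lambda>N. 25 * c\<^sub>2 * (f N)\<^sup>2) \<longlonglongrightarrow> 25 * c\<^sub>2 * 0\<^sup>2"
    "(\<lambda>N. C\<^sub>0 * (f N)\<^sup>2) \<longlonglongrightarrow> C\<^sub>0 * 0\<^sup>2"
    by (intro tendsto_intros assms)+
  then have lim: "(\<lambda>N. 2 * f N * (\<sigma> * \<rho>\<^sub>1 + 1)) \<longlonglongrightarrow> 0" "(\<lambda>N. 25 * c\<^sub>2 * (f N)\<^sup>2) \<longlonglongrightarrow> 0"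
    "(\<lambda>N. C\<^sub>0 * (f N)\<^sup>2) \<longlonglongrightarrow> 0" by simp_all
  have "m\<^sub>0 * pmin / 2 > 0" using m\<^sub>0 pmin by simp
  from order_tendstoD(2)[OF assms(1) zero_less_one] order_tendstoD(2)[OF lim(1) r\<^sub>0]
    order_tendstoD(2)[OF lim(2) zero_less_one] order_tendstoD(2)[OF lim(3) this] assms(2)
  show ?thesis by eventually_elim (auto simp: small_def)
qed

theorem theorem2p3:
  fixes M :: "(real^'n) set" and V :: "(real^'n) measure"
    and p :: "real^'n \<Rightarrow> real" and pmin pmax :: real
  assumes "compact M" and "smooth_submanifold TYPE('d::finite) M"
    and "riemannian_volume TYPE('d) M V"
    and "smooth_on_submanifold TYPE('d) M p"
    and "prob_space (density V (\<lambda>x. ennreal (p x)))"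
    and "0 < pmin" and "\<And>x. x \<in> M \<Longrightarrow> pmin \<le> p x \<and> p x \<le> pmax"
  shows "\<exists>C\<ge>0. \<forall>k :: nat \<Rightarrow> nat.
    (\<lambda>N. real (k N)) \<in> o(\<lambda>N. real N) \<longrightarrow>
    filterlim (\<lambda>N. real (k N) / ln (real N)) at_top sequentially \<longrightarrow>
    (let rhs = (\<lambda>N. C * (real (k N) / real N) powr (2 / real CARD('d))
                  + 3 * sqrt 13 / real CARD('d) * sqrt (ln (real N) / real (k N)))
     in (\<forall>\<^sub>F N in sequentially.
           measure (iid_samples V p N)
             {y \<in> space (iid_samples V p N).
                (SUP x\<in>M. ereal (\<bar>knn_bandwidth TYPE('d) N (k N) y x - population_bandwidth TYPE('d) p x\<bar>
                                 / population_bandwidth TYPE('d) p x))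
                  \<le> ereal (rhs N)}
           > 1 - real N powi (-10))
        \<and> rhs \<in> o(\<lambda>_. 1))"
proof -
  let ?P = "density V (\<lambda>x. ennreal (p x))" and ?d = "CARD('d)" and ?m = "unit_ball_volume TYPE('d)"
  have sets_V: "sets V = sets (restrict_space borel M)" and "space V = M"
    using assms(3) by (auto simp: riemannian_volume_def)
  interpret P: prob_space ?P by fact
  \<comment> \<open>A probability measure on \<open>M\<close> exists, so \<open>M\<close> is
    nonempty.\<close>
  have M_ne: "M \<noteq> {}" using P.not_empty \<open>space V = M\<close> by simp
  have p_nonneg: "p x \<ge> 0" if "x \<in> M" for x using assms(6) assms(7)[OF that] by simp
  obtain C\<^sub>0 r\<^sub>0 where C\<^sub>0: "C\<^sub>0 \<ge> 0" "r\<^sub>0 > 0" and ball: "\<And>x r. x \<in> M \<Longrightarrow> 0 < r \<Longrightarrow> r < r\<^sub>0 \<Longrightarrow>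
      \<bar>measure ?P (M \<inter> ball x r) - ?m * p x * r ^ ?d\<bar> \<le> C\<^sub>0 * r ^ (?d + 2)"
    using ball_measure_expansion[OF assms(1) M_ne assms(2-4) p_nonneg] by blast
  interpret knn_sampling ?P M p pmin pmax ?m C\<^sub>0 r\<^sub>0 ?d
    by unfold_locales
      (use assms sets_V M_ne C\<^sub>0 ball unit_ball_volume_pos continuous_on_smooth_on_submanifold[OF assms(2,4)] in auto)
  have pop: "population_bandwidth TYPE('d) p x = \<rho> x" for x by (simp add: population_bandwidth_def \<rho>_def)
  have iid: "iid_samples V p N = (\<Pi>\<^sub>M j\<in>{1..N}. ?P)" for N by (simp add: iid_samples_def)
  show ?thesis
  \<comment> \<open>The witness is fixed before \<open>k\<close>: \<open>c\<close> is built from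
    \<open>p\<close>, its bounds, the dimension and the constants of the ball expansion.\<close>
  proof (intro exI[of _ c] conjI allI impI)
    show "c \<ge> 0" by (rule c_nonneg)
    fix k :: "nat \<Rightarrow> nat"
    assume k: "(\<lambda>N. real (k N)) \<in> o(\<lambda>N. real N)" "filterlim (\<lambda>N. real (k N) / ln (real N)) at_top sequentially"
    define rhs where "rhs N = c * (real (k N) / real N) powr (2 / real ?d)
      + 3 * sqrt 13 / real ?d * sqrt (ln (real N) / real (k N))" for N
    note rates = knn_rates[OF k, of ?d, OF zero_less_card_finite]
    have "rhs \<longlonglongrightarrow> c * 0 + 3 * sqrt 13 / real ?d * 0"
      unfolding rhs_def by (intro tendsto_intros rates)
    then have "rhs \<in> o(\<lambda>_. 1)" by (intro smalloI_tendsto) auto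
    moreover have "\<forall>\<^sub>F N in sequentially. measure (iid_samples V p N)
        {y \<in> space (iid_samples V p N).
          (SUP x\<in>M. ereal (\<bar>knn_bandwidth TYPE('d) N (k N) y x - population_bandwidth TYPE('d) p x\<bar>
             / population_bandwidth TYPE('d) p x)) \<le> ereal (rhs N)} > 1 - real N powi (-10)"
    proof -
      let ?r = "\<lambda>N. (real (k N) / real N) powr (1 / real ?d)" and ?K = "4 * 2 ^ ?d / (?m * pmin)"
      have k_pos: "\<forall>\<^sub>F N in sequentially. ?r N > 0"
        using rates(4) eventually_gt_at_top[of "0::nat"] by eventually_elim auto
      have l: "\<forall>\<^sub>F N in sequentially. sqrt (ln (real N) / real (k N)) < 1 / 40"
        using order_tendstoD(2)[OF rates(3), of "1 / 40"] by simp
      have big: "\<forall>\<^sub>F N in sequentially. real N > ?K"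
        using filterlim_real_sequentially by (simp add: filterlim_at_top_dense)
      from eventually_small[OF rates(1) k_pos] rates(4) l big eventually_ge_at_top[of "2::nat"]
      show ?thesis
      proof eventually_elim
        case (elim N)
        let ?S = "\<Pi>\<^sub>M j\<in>{1..N}. ?P"
        have kN: "k N \<ge> 1" "k N \<le> N" and N0: "real N > 0" using elim by auto
        have r0: "?r N > 0" using elim(1) by (simp add: small_def)
        have r_sq: "(?r N)\<^sup>2 = (real (k N) / real N) powr (2 / real ?d)"
          using r0 by (simp add: powr_realpow[symmetric, of _ 2, simplified] powr_powr)
        \<comment> \<open>The normalising factor of the bandwidth is the reciprocal of
          \<open>?r N * \<sigma>\<close>, so the estimate for the bandwidth is the one for the
          radius divided by this scale.\<close>
        have scale: "(1 / ?m * (real (k N) / real N)) powr (- 1 / real ?d) = 1 / (?r N * \<sigma>)"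
        proof -
          have "(1 / ?m * (real (k N) / real N)) powr (1 / real ?d) = ?r N * \<sigma>"
            unfolding powr_mult \<sigma>_def using m\<^sub>0 by (simp add: powr_divide powr_minus_divide)
          then show ?thesis by (simp add: powr_minus_divide)
        qed
        \<comment> \<open>In \<open>ereal\<close> a supremum is below a bound exactly when all its
          terms are, without a boundedness condition. Multiplying by the positive scale and
          bandwidth clears the divisions.\<close>
        have ev: "(SUP x\<in>M. ereal (\<bar>knn_bandwidth TYPE('d) N (k N) y x - population_bandwidth TYPE('d) p x\<bar>
             / population_bandwidth TYPE('d) p x)) \<le> ereal (rhs N) \<longleftrightarrow>
           (\<forall>x\<in>M. \<bar>knn_radius N (k N) y x - ?r N * \<sigma> * \<rho> x\<bar> \<le> ?r N * \<sigma> * \<rho> x *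
              (3 * sqrt 13 / real ?d * sqrt (ln (real N) / real (k N)) + c * (?r N)\<^sup>2))" for y
        proof -
          have s0: "?r N * \<sigma> > 0" using r0 \<sigma> by simp
          have "\<bar>a / s - q\<bar> / q \<le> t \<longleftrightarrow> \<bar>a - s * q\<bar> \<le> s * q * t" if "s > 0" "q > 0" for a s q t :: real
          proof -
            have "a / s - q = (a - s * q) / s" using that by (simp add: field_simps)
            then have "\<bar>a / s - q\<bar> / q = \<bar>a - s * q\<bar> / (s * q)" using that by (simp add: abs_divide)
            then show ?thesis using that by (simp add: pos_divide_le_eq mult.commute)
          qed
          from this[OF s0 \<rho>(1)] show ?thesis
            unfolding SUP_le_iff ereal_less_eq pop knn_bandwidth_def scale rhs_def r_sq[symmetric]
            by (simp add: add.commute)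
        qed
        \<comment> \<open>The union bound leaves \<open>?K / real N ^ 17\<close>. One power of
          \<open>N\<close> beats the constant strictly, and raising it to the seventh power leaves
          exactly the exponent -10.\<close>
        have "real N ^ 3 / real N ^ 20 = 1 / real N ^ 17" using N0 by (simp add: field_simps flip: power_add)
        moreover have "K * a / b = K / b'" if "a / b = 1 / b'" for K a b b' :: real
          using that by (metis mult.right_neutral times_divide_eq_right)
        ultimately have "?K * real N ^ 3 / real N ^ 20 = ?K / real N ^ 17" by blast
        also have "\<dots> < real N / real N ^ 17" using elim(4) N0 by (intro divide_strict_right_mono) auto
        also have "\<dots> \<le> real N ^ 7 / real N ^ 17"
          using elim(5) N0 self_le_power[of "real N" 7] by (intro divide_right_mono) auto
        also have "\<dots> = real N powi (- 10)" using N0 by (simp add: power_int_minus field_simps flip: power_add)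
        finally have "1 - real N powi (- 10) < 1 - ?K * real N ^ 3 / real N ^ 20" by simp
        also have "\<dots> \<le> measure ?S {y \<in> space ?S. \<forall>x\<in>M. \<bar>knn_radius N (k N) y x - ?r N * \<sigma> * \<rho> x\<bar> \<le> ?r N * \<sigma> * \<rho> x *
              (3 * sqrt 13 / real ?d * sqrt (ln (real N) / real (k N)) + c * (?r N)\<^sup>2)}"
          by (rule good_event_prob[OF elim(5) kN refl elim(1) refl]) (use elim(3) in simp)
        finally show ?case unfolding iid ev .
      qed
    qed
    ultimately show "let rhs = (\<lambda>N. c * (real (k N) / real N) powr (2 / real CARD('d))
                  + 3 * sqrt 13 / real CARD('d) * sqrt (ln (real N) / real (k N)))
     in (\<forall>\<^sub>F N in sequentially.
           measure (iid_samples V p N)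
             {y \<in> space (iid_samples V p N).
                (SUP x\<in>M. ereal (\<bar>knn_bandwidth TYPE('d) N (k N) y x - population_bandwidth TYPE('d) p x\<bar>
                                 / population_bandwidth TYPE('d) p x))
                  \<le> ereal (rhs N)}
           > 1 - real N powi (-10))
        \<and> rhs \<in> o(\<lambda>_. 1)"
      by (simp add: Let_def rhs_def[abs_def])
  qed
qed

end
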